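(* Let $R$ be a complete discrete valuation ring with finite residue class field whose fraction field $K$ is a finite extension of $\mathbb{Q}_p$ for some prime $p$, let $V$ be a finite-dimensional $K$-vector space of odd dimension with a non-degenerate symmetric bilinear form $F$, and let $L$ be a semi-regular lattice in $V$. Then $\mathfrak{c}(V,F)=1$.
   Context: $Q_F(v)=\frac12F(v,v)$. A lattice in $V$ is a finitely generated $R$-submodule containing a $K$-basis of $V$; it is even if $Q_F(L)\subseteq R$; its dual is $L^\#=\{v\in V: F(v,L)\subseteq R\}$. A semi-regular lattice is an even lattice $L$ in an odd-dimensional space with $L^\#/L\cong R/2R$. The Clifford algebra $\mathcal{C}(V,F)$ is the tensor algebra of $V$ modulo the ideal generated by $v\otimes v-Q_F(v)$; for $\dim V$ odd, $\mathfrak{c}(V,F)\in\mathrm{Br}(K)$ is the Brauer class of the even subalgebra $\mathcal{C}_0(V,F)$. *)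

theory Defs
  imports
    "HOL-Algebra.Algebraic_Closure_Type"
    "HOL-Algebra.QuotRing"
    "HOL-Algebra.Module"
    "HOL-Computational_Algebra.Primes"
    "HOL-Library.Set_Algebras"
begin

text \<open>
  The field \<open>K\<close> is a type \<open>'k\<close> of class \<^class>\<open>field\<close>; the space \<open>V\<close> is a type \<open>'v\<close> with a scalar
  multiplication \<open>scale\<close>; \<open>R\<close> and \<open>L\<close> are subsets of \<open>'k\<close> and \<open>'v\<close>.  Algebras that have to be
  constructed from this data are records over carrier sets.
\<close>

section \<open>Discrete valuations\<close>

text \<open>The value of a valuation at \<open>0\<close> is irrelevant; \<open>0\<close> is treated as having infinite value.\<close>

definition val_ge :: "('a::field \<Rightarrow> int) \<Rightarrow> int \<Rightarrow> 'a \<Rightarrow> bool" where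
  "val_ge \<nu> n x \<longleftrightarrow> x = 0 \<or> n \<le> \<nu> x"

definition discrete_valuation :: "('a::field \<Rightarrow> int) \<Rightarrow> bool" where
  "discrete_valuation \<nu> \<longleftrightarrow>
     (\<forall>x y. x \<noteq> 0 \<longrightarrow> y \<noteq> 0 \<longrightarrow> \<nu> (x * y) = \<nu> x + \<nu> y) \<and>
     (\<forall>x y. x \<noteq> 0 \<longrightarrow> y \<noteq> 0 \<longrightarrow> x + y \<noteq> 0 \<longrightarrow> min (\<nu> x) (\<nu> y) \<le> \<nu> (x + y)) \<and>
     (\<forall>n. \<exists>x. x \<noteq> 0 \<and> \<nu> x = n)"

definition valuation_ring :: "('a::field \<Rightarrow> int) \<Rightarrow> 'a set" where
  "valuation_ring \<nu> = {x. val_ge \<nu> 0 x}"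

definition val_cauchy :: "('a::field \<Rightarrow> int) \<Rightarrow> (nat \<Rightarrow> 'a) \<Rightarrow> bool" where
  "val_cauchy \<nu> u \<longleftrightarrow> (\<forall>k. \<exists>N. \<forall>m\<ge>N. \<forall>n\<ge>N. val_ge \<nu> k (u m - u n))"

definition val_tendsto :: "('a::field \<Rightarrow> int) \<Rightarrow> (nat \<Rightarrow> 'a) \<Rightarrow> 'a \<Rightarrow> bool" where
  "val_tendsto \<nu> u l \<longleftrightarrow> (\<forall>k. \<exists>N. \<forall>n\<ge>N. val_ge \<nu> k (u n - l))"

text \<open>
  A discrete valuation ring is the valuation ring of a discrete valuation of its fraction field.
  So the following says that \<open>R\<close> is a complete discrete valuation ring whose fraction field is the
  whole type \<open>'a\<close> (see \<open>complete_dvr_fraction_field\<close>).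
\<close>

definition complete_dvr :: "'a::field set \<Rightarrow> bool" where
  "complete_dvr R \<longleftrightarrow> (\<exists>\<nu>. discrete_valuation \<nu> \<and> R = valuation_ring \<nu> \<and>
     (\<forall>u. (\<forall>n. u n \<in> R) \<and> val_cauchy \<nu> u \<longrightarrow> (\<exists>l\<in>R. val_tendsto \<nu> u l)))"

lemma complete_dvr_fraction_field:
  assumes "complete_dvr R"
  shows "\<exists>a\<in>R. \<exists>b\<in>R. b \<noteq> 0 \<and> x = a / b"
proof -
  obtain \<nu> where \<nu>: "discrete_valuation \<nu>" and R: "R = valuation_ring \<nu>"
    using assms unfolding complete_dvr_def by blast
  have mult: "\<nu> (y * z) = \<nu> y + \<nu> z" if "y \<noteq> 0" "z \<noteq> 0" for y z
    using \<nu> that unfolding discrete_valuation_def by blast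
  obtain b where b: "b \<noteq> 0" "\<nu> b = \<bar>\<nu> x\<bar>"
    using \<nu> unfolding discrete_valuation_def by blast
  have "x * b \<in> R" "b \<in> R"
    using b mult[of x b] by (cases "x = 0"; simp add: R valuation_ring_def val_ge_def)+
  moreover have "x = x * b / b"
    using b by simp
  ultimately show ?thesis
    using b by blast
qed

section \<open>Quotient modules\<close>

definition cosets :: "'a::ab_group_add set \<Rightarrow> 'a set \<Rightarrow> 'a set set" where
  "cosets M N = (\<lambda>x. x +o N) ` M"

definition coset_scale :: "('k \<Rightarrow> 'a::ab_group_add \<Rightarrow> 'a) \<Rightarrow> 'a set \<Rightarrow> 'k \<Rightarrow> 'a set \<Rightarrow> 'a set" where
  "coset_scale s N r C = (\<Union>x\<in>C. s r x +o N)"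

text \<open>\<open>M / N \<cong> M' / N'\<close> as \<open>R\<close>-modules; the sum of two cosets is their elementwise sum.\<close>

definition quotient_modules_iso ::
  "'k set \<Rightarrow> ('k \<Rightarrow> 'a::ab_group_add \<Rightarrow> 'a) \<Rightarrow> 'a set \<Rightarrow> 'a set \<Rightarrow>
   ('k \<Rightarrow> 'b::ab_group_add \<Rightarrow> 'b) \<Rightarrow> 'b set \<Rightarrow> 'b set \<Rightarrow> bool" where
  "quotient_modules_iso R s M N s' M' N' \<longleftrightarrow>
     (\<exists>f. bij_betw f (cosets M N) (cosets M' N') \<and>
        (\<forall>C\<in>cosets M N. \<forall>D\<in>cosets M N. f (C + D) = f C + f D) \<and>
        (\<forall>r\<in>R. \<forall>C\<in>cosets M N. f (coset_scale s N r C) = coset_scale s' N' r (f C)))"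

text \<open>For a local ring, the maximal ideal consists of the non-units.\<close>

definition nonunits :: "'a::field set \<Rightarrow> 'a set" where
  "nonunits R = {x \<in> R. \<not> (\<exists>y\<in>R. x * y = 1)}"

definition finite_residue_field :: "'a::field set \<Rightarrow> bool" where
  "finite_residue_field R \<longleftrightarrow> finite (cosets R (nonunits R))"

section \<open>The field of \<open>p\<close>-adic numbers\<close>

definition padic_val :: "nat \<Rightarrow> rat \<Rightarrow> int" where
  "padic_val p x = int (multiplicity (int p) (fst (quotient_of x)))
                 - int (multiplicity (int p) (snd (quotient_of x)))"

definition padic_cauchy_ring :: "nat \<Rightarrow> (nat \<Rightarrow> rat) ring" where
  "padic_cauchy_ring p =
     \<lparr>carrier = {u. val_cauchy (padic_val p) u},
      monoid.mult = (\<lambda>u w n. u n * w n), one = (\<lambda>n. 1), ring.zero = (\<lambda>n. 0),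
      add = (\<lambda>u w n. u n + w n)\<rparr>"

definition padic_null :: "nat \<Rightarrow> (nat \<Rightarrow> rat) set" where
  "padic_null p = {u. val_tendsto (padic_val p) u 0}"

text \<open>\<open>\<rat>\<^sub>p\<close> as the completion of \<open>\<rat>\<close>: Cauchy sequences modulo null sequences.\<close>

definition padic_field :: "nat \<Rightarrow> (nat \<Rightarrow> rat) set ring" where
  "padic_field p = padic_cauchy_ring p Quot padic_null p"

definition finite_extension_of_padics :: "nat \<Rightarrow> 'k::field itself \<Rightarrow> bool" where
  "finite_extension_of_padics p T \<longleftrightarrow>
     (\<exists>\<phi> \<in> ring_hom (padic_field p) (ring_of_type_algebra :: 'k ring).
        \<exists>B. finite B \<and>
          (\<forall>x. \<exists>c. c ` B \<subseteq> carrier (padic_field p) \<and> x = (\<Sum>b\<in>B. \<phi> (c b) * b)))"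

section \<open>Quadratic spaces and lattices\<close>

definition finite_dimensional :: "('k::field \<Rightarrow> 'v::ab_group_add \<Rightarrow> 'v) \<Rightarrow> bool" where
  "finite_dimensional scale \<longleftrightarrow> (\<exists>B. finite_dimensional_vector_space scale B)"

definition symmetric_bilinear_form ::
  "('k::field \<Rightarrow> 'v::ab_group_add \<Rightarrow> 'v) \<Rightarrow> ('v \<Rightarrow> 'v \<Rightarrow> 'k) \<Rightarrow> bool" where
  "symmetric_bilinear_form scale F \<longleftrightarrow>
     (\<forall>v. Vector_Spaces.linear scale (*) (F v)) \<and> (\<forall>v w. F v w = F w v)"

definition nondegenerate :: "('v::ab_group_add \<Rightarrow> 'v \<Rightarrow> 'k::field) \<Rightarrow> bool" where
  "nondegenerate F \<longleftrightarrow> (\<forall>v. (\<forall>w. F v w = 0) \<longrightarrow> v = 0)"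

definition quad :: "('v \<Rightarrow> 'v \<Rightarrow> 'k::field) \<Rightarrow> 'v \<Rightarrow> 'k" where
  "quad F v = 1 / 2 * F v v"

definition span_over ::
  "('k \<Rightarrow> 'v::ab_group_add \<Rightarrow> 'v) \<Rightarrow> 'k set \<Rightarrow> 'v set \<Rightarrow> 'v set" where
  "span_over scale R S = {\<Sum>s\<in>S. scale (a s) s | a. a ` S \<subseteq> R}"

definition is_lattice ::
  "('k::field \<Rightarrow> 'v::ab_group_add \<Rightarrow> 'v) \<Rightarrow> 'k set \<Rightarrow> 'v set \<Rightarrow> bool" where
  "is_lattice scale R L \<longleftrightarrow>
     (\<exists>S. finite S \<and> L = span_over scale R S) \<and>
     (\<exists>B\<subseteq>L. \<not> module.dependent scale B \<and> module.span scale B = UNIV)"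

definition even_lattice ::
  "('k::field \<Rightarrow> 'v::ab_group_add \<Rightarrow> 'v) \<Rightarrow> ('v \<Rightarrow> 'v \<Rightarrow> 'k) \<Rightarrow> 'k set \<Rightarrow> 'v set \<Rightarrow> bool" where
  "even_lattice scale F R L \<longleftrightarrow> is_lattice scale R L \<and> quad F ` L \<subseteq> R"

definition dual_lattice :: "('v \<Rightarrow> 'v \<Rightarrow> 'k) \<Rightarrow> 'k set \<Rightarrow> 'v set \<Rightarrow> 'v set" where
  "dual_lattice F R L = {v. F v ` L \<subseteq> R}"

definition semi_regular ::
  "('k::field \<Rightarrow> 'v::ab_group_add \<Rightarrow> 'v) \<Rightarrow> ('v \<Rightarrow> 'v \<Rightarrow> 'k) \<Rightarrow> 'k set \<Rightarrow> 'v set \<Rightarrow> bool" where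
  "semi_regular scale F R L \<longleftrightarrow>
     odd (vector_space.dim scale (UNIV :: 'v set)) \<and>
     even_lattice scale F R L \<and>
     quotient_modules_iso R scale (dual_lattice F R L) L (*) R ((*) 2 ` R)"

section \<open>Algebras over \<open>K\<close>\<close>

text \<open>
  A \<open>K\<close>-algebra is a record of type \<open>('k, 'a) module\<close>, which contains the ring operations as well
  as the scalar multiplication.  (The library locale \<^locale>\<open>algebra\<close> covers only commutative ones.)
\<close>

definition k_algebra :: "('k::field, 'a) module \<Rightarrow> bool" where
  "k_algebra A \<longleftrightarrow> ring A \<and> Module.module (ring_of_type_algebra :: 'k ring) A \<and>
     (\<forall>a. \<forall>x\<in>carrier A. \<forall>y\<in>carrier A.
        (a \<odot>\<^bsub>A\<^esub> x) \<otimes>\<^bsub>A\<^esub> y = a \<odot>\<^bsub>A\<^esub> (x \<otimes>\<^bsub>A\<^esub> y) \<and>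
        x \<otimes>\<^bsub>A\<^esub> (a \<odot>\<^bsub>A\<^esub> y) = a \<odot>\<^bsub>A\<^esub> (x \<otimes>\<^bsub>A\<^esub> y))"

definition self_algebra :: "('k::field, 'k) module" where
  "self_algebra =
     \<lparr>carrier = UNIV, monoid.mult = (*), one = 1, ring.zero = 0, add = (+),
      module.smult = (*)\<rparr>"

definition algebra_iso :: "('k, 'a) module \<Rightarrow> ('k, 'b) module \<Rightarrow> bool" where
  "algebra_iso A B \<longleftrightarrow>
     (\<exists>\<phi> \<in> ring_iso A B. \<forall>a. \<forall>x\<in>carrier A. \<phi> (a \<odot>\<^bsub>A\<^esub> x) = a \<odot>\<^bsub>B\<^esub> \<phi> x)"

definition quotient_algebra :: "('k, 'a) module \<Rightarrow> 'a set \<Rightarrow> ('k, 'a set) module" where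
  "quotient_algebra A I =
     \<lparr>carrier = carrier (A Quot I), monoid.mult = monoid.mult (A Quot I), one = one (A Quot I),
      ring.zero = ring.zero (A Quot I), add = add (A Quot I),
      module.smult = (\<lambda>a C. \<Union>x\<in>C. I +>\<^bsub>A\<^esub> (a \<odot>\<^bsub>A\<^esub> x))\<rparr>"

text \<open>Entries outside the index range are normalised to zero.\<close>

definition matrix_algebra :: "nat \<Rightarrow> ('k, 'a) module \<Rightarrow> ('k, nat \<Rightarrow> nat \<Rightarrow> 'a) module" where
  "matrix_algebra n A =
     \<lparr>carrier = {M. \<forall>i j. (i < n \<and> j < n \<longrightarrow> M i j \<in> carrier A) \<and>
                          (\<not> (i < n \<and> j < n) \<longrightarrow> M i j = \<zero>\<^bsub>A\<^esub>)},
      monoid.mult = (\<lambda>M N i j.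
        if i < n \<and> j < n then (\<Oplus>\<^bsub>A\<^esub>k\<in>{..<n}. M i k \<otimes>\<^bsub>A\<^esub> N k j) else \<zero>\<^bsub>A\<^esub>),
      one = (\<lambda>i j. if i < n \<and> i = j then \<one>\<^bsub>A\<^esub> else \<zero>\<^bsub>A\<^esub>),
      ring.zero = (\<lambda>i j. \<zero>\<^bsub>A\<^esub>),
      add = (\<lambda>M N i j. M i j \<oplus>\<^bsub>A\<^esub> N i j),
      module.smult = (\<lambda>a M i j. a \<odot>\<^bsub>A\<^esub> M i j)\<rparr>"

section \<open>Brauer classes\<close>

definition central_simple_algebra :: "('k::field, 'a) module \<Rightarrow> bool" where
  "central_simple_algebra A \<longleftrightarrow>
     k_algebra A \<and>
     (\<exists>S\<subseteq>carrier A. finite S \<and>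
        (\<forall>x\<in>carrier A. \<exists>c. x = (\<Oplus>\<^bsub>A\<^esub>s\<in>S. c s \<odot>\<^bsub>A\<^esub> s))) \<and>
     carrier A \<noteq> {\<zero>\<^bsub>A\<^esub>} \<and>
     (\<forall>I. ideal I A \<longrightarrow> I = {\<zero>\<^bsub>A\<^esub>} \<or> I = carrier A) \<and>
     {z \<in> carrier A. \<forall>x\<in>carrier A. z \<otimes>\<^bsub>A\<^esub> x = x \<otimes>\<^bsub>A\<^esub> z} = {a \<odot>\<^bsub>A\<^esub> \<one>\<^bsub>A\<^esub> | a. True}"

definition brauer_equivalent :: "('k::field, 'a) module \<Rightarrow> ('k, 'b) module \<Rightarrow> bool" where
  "brauer_equivalent A B \<longleftrightarrow>
     central_simple_algebra A \<and> central_simple_algebra B \<and>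
     (\<exists>m>0. \<exists>n>0. algebra_iso (matrix_algebra m A) (matrix_algebra n B))"

text \<open>
  To make classes of algebras with different carrier types comparable, the members of a class are
  taken with carrier in the fixed type \<open>nat \<Rightarrow> 'k\<close>, which contains a copy of every
  finite-dimensional \<open>K\<close>-algebra.  The class of an algebra that is not central simple is empty
  and hence different from every class in \<open>Br(K)\<close>.
\<close>

definition brauer_class :: "('k::field, 'a) module \<Rightarrow> ('k, nat \<Rightarrow> 'k) module set" where
  "brauer_class A = {B. brauer_equivalent A B}"

definition brauer_one :: "('k::field, nat \<Rightarrow> 'k) module set" where
  "brauer_one = brauer_class (self_algebra :: ('k, 'k) module)"

section \<open>The Clifford algebra\<close>

text \<open>
  The free associative algebra on the set \<open>V\<close>: finitely supported functions on words over \<open>V\<close>.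
\<close>

definition free_algebra :: "('k::field, 'v list \<Rightarrow> 'k) module" where
  "free_algebra =
     \<lparr>carrier = {f. finite {w. f w \<noteq> 0}},
      monoid.mult = (\<lambda>f g w. \<Sum>i\<le>length w. f (take i w) * g (drop i w)),
      one = (\<lambda>w. if w = [] then 1 else 0),
      ring.zero = (\<lambda>w. 0),
      add = (\<lambda>f g w. f w + g w),
      module.smult = (\<lambda>a f w. a * f w)\<rparr>"

definition word :: "'v list \<Rightarrow> 'v list \<Rightarrow> 'k::field" where
  "word u = (\<lambda>w. if w = u then 1 else 0)"

definition linearity_ideal ::
  "('k::field \<Rightarrow> 'v::ab_group_add \<Rightarrow> 'v) \<Rightarrow> ('v list \<Rightarrow> 'k) set" where
  "linearity_ideal scale = Idl\<^bsub>free_algebra\<^esub>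
     ({word [v + w] - word [v] - word [w] | v w. True} \<union>
      {word [scale a v] - (\<lambda>u. a * word [v] u) | a v. True})"

text \<open>
  The tensor algebra of \<open>V\<close>: the free algebra on the set \<open>V\<close> modulo the relations which make
  \<open>v \<mapsto> [v]\<close> linear.  The class of the word \<open>[v\<^sub>1, \<dots>, v\<^sub>n]\<close> is \<open>v\<^sub>1 \<otimes> \<dots> \<otimes> v\<^sub>n\<close>.
\<close>

definition tensor_algebra ::
  "('k::field \<Rightarrow> 'v::ab_group_add \<Rightarrow> 'v) \<Rightarrow> ('k, ('v list \<Rightarrow> 'k) set) module" where
  "tensor_algebra scale = quotient_algebra free_algebra (linearity_ideal scale)"

definition tensor_class ::
  "('k::field \<Rightarrow> 'v::ab_group_add \<Rightarrow> 'v) \<Rightarrow> ('v list \<Rightarrow> 'k) \<Rightarrow> ('v list \<Rightarrow> 'k) set" where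
  "tensor_class scale f = linearity_ideal scale +>\<^bsub>free_algebra\<^esub> f"

abbreviation vec_tensor ::
  "('k::field \<Rightarrow> 'v::ab_group_add \<Rightarrow> 'v) \<Rightarrow> 'v \<Rightarrow> ('v list \<Rightarrow> 'k) set" where
  "vec_tensor scale v \<equiv> tensor_class scale (word [v])"

definition clifford_ideal ::
  "('k::field \<Rightarrow> 'v::ab_group_add \<Rightarrow> 'v) \<Rightarrow> ('v \<Rightarrow> 'v \<Rightarrow> 'k) \<Rightarrow> ('v list \<Rightarrow> 'k) set set" where
  "clifford_ideal scale F = (let T = tensor_algebra scale in
     Idl\<^bsub>T\<^esub> {(vec_tensor scale v \<otimes>\<^bsub>T\<^esub> vec_tensor scale v) \<ominus>\<^bsub>T\<^esub> (quad F v \<odot>\<^bsub>T\<^esub> \<one>\<^bsub>T\<^esub>) | v. True})"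

definition clifford_algebra ::
  "('k::field \<Rightarrow> 'v::ab_group_add \<Rightarrow> 'v) \<Rightarrow> ('v \<Rightarrow> 'v \<Rightarrow> 'k) \<Rightarrow>
   ('k, ('v list \<Rightarrow> 'k) set set) module" where
  "clifford_algebra scale F = quotient_algebra (tensor_algebra scale) (clifford_ideal scale F)"

text \<open>The tensors of even degree are the classes of linear combinations of words of even length.\<close>

definition even_tensors ::
  "('k::field \<Rightarrow> 'v::ab_group_add \<Rightarrow> 'v) \<Rightarrow> ('v list \<Rightarrow> 'k) set set" where
  "even_tensors scale =
     tensor_class scale ` {f \<in> carrier free_algebra. \<forall>w. f w \<noteq> 0 \<longrightarrow> even (length w)}"

definition even_clifford_algebra ::
  "('k::field \<Rightarrow> 'v::ab_group_add \<Rightarrow> 'v) \<Rightarrow> ('v \<Rightarrow> 'v \<Rightarrow> 'k) \<Rightarrow>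
   ('k, ('v list \<Rightarrow> 'k) set set) module" where
  "even_clifford_algebra scale F = (clifford_algebra scale F)
     \<lparr>carrier := (\<lambda>t. clifford_ideal scale F +>\<^bsub>tensor_algebra scale\<^esub> t) ` even_tensors scale\<rparr>"

definition clifford_invariant ::
  "('k::field \<Rightarrow> 'v::ab_group_add \<Rightarrow> 'v) \<Rightarrow> ('v \<Rightarrow> 'v \<Rightarrow> 'k) \<Rightarrow> ('k, nat \<Rightarrow> 'k) module set" where
  "clifford_invariant scale F = brauer_class (even_clifford_algebra scale F)"

end

theory Submission
  imports Defs
begin

text \<open>
  A semi-regular lattice splits as an orthogonal sum of hyperbolic planes and a line.  As soon as
  the rank is at least \<open>3\<close> there is a vector \<open>v\<close> with \<open>Q v\<close> in the maximal ideal \<open>P\<close> and \<open>F v L = R\<close>: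
  if \<open>2\<close> is a unit, by counting squares in the finite residue field; if \<open>2 \<in> P\<close>, by correcting any
  vector with a multiple of \<open>z = 2 y\<^sub>0\<close>, where \<open>y\<^sub>0\<close> generates \<open>L\<^sup># / L\<close>, because \<open>Q z\<close> is a unit, \<open>z\<close> is
  orthogonal to \<open>L\<close> modulo \<open>P\<close>, and squaring is bijective on the residue field.  Hensel's lemma
  makes \<open>v\<close> isotropic, and the hyperbolic plane through \<open>v\<close> splits off.

  With a hyperbolic basis \<open>e\<^sub>i, f\<^sub>i, g\<close> of \<open>V\<close> the elements \<open>g s\<^sub>0 \<dots> s\<^sub>i\<^sub>-\<^sub>1 e\<^sub>i\<close> and \<open>g s\<^sub>0 \<dots> s\<^sub>i\<^sub>-\<^sub>1 f\<^sub>i\<close>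
  (up to a scalar), where \<open>s\<^sub>i = e\<^sub>i f\<^sub>i - f\<^sub>i e\<^sub>i\<close>, form commuting pairs of off-diagonal \<open>2 \<times> 2\<close> matrix
  units which generate the even Clifford algebra.  Their products are matrix units spanning it,
  so it is a full matrix algebra over \<open>K\<close>, provided that it is nonzero; that follows from an
  explicit module.
\<close>

section \<open>Complete discrete valuation rings\<close>

text \<open>The lattice is tracked through a generator \<open>y0\<close> of its discriminant group
  rather than through a lattice basis: an orthogonal splitting merely replaces \<open>y0\<close> by
  its component in the complement. So a single induction, in steps of two down to a line, builds the
  hyperbolic basis in both residue characteristics.

  In the Clifford algebra \<open>e_i\<close> and \<open>f_i\<close> already satisfy the relations of
  off-diagonal matrix units, but they are odd, and vectors of different planes anticommute. In the 2
  x 2 picture \<open>s_i\<close> is diag(1, -1): it anticommutes with its own plane and commutes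
  with the others, while \<open>g\<close> anticommutes with every plane. Hence
  \<open>g s_0 ... s_(i-1)\<close> commutes with the planes before \<open>i\<close> and anticommutes
  with the rest. Multiplying by it makes the vectors even and turns the unwanted signs between
  planes into commutation.

  The dimension of the Clifford algebra is never computed. Matrix units that span an algebra are
  automatically linearly independent once 1 is not 0, because a vanishing unit would annihilate
  1.\<close>

lemma coset_eq_iff:
  fixes N :: "'a::ab_group_add set"
  assumes zero: "0 \<in> N" and diff: "\<And>x y. x \<in> N \<Longrightarrow> y \<in> N \<Longrightarrow> x - y \<in> N"
  shows "x +o N = y +o N \<longleftrightarrow> x - y \<in> N"
proof
  assume "x +o N = y +o N"
  then have "x + 0 \<in> y +o N" using zero by (metis set_plus_intro2)
  then show "x - y \<in> N" by (auto simp: elt_set_plus_def)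
next
  assume a: "x - y \<in> N"
  have *: "a +o N \<subseteq> b +o N" if "a - b \<in> N" for a b
  proof
    fix z assume "z \<in> a +o N"
    then obtain n where n: "n \<in> N" "z = a + n" by (auto simp: elt_set_plus_def)
    have "(a - b) - (0 - n) \<in> N" using diff that zero n by blast
    moreover have "z = b + ((a - b) - (0 - n))" using n by simp
    ultimately show "z \<in> b +o N" unfolding elt_set_plus_def by blast
  qed
  have "0 - (x - y) \<in> N" using diff a zero by blast
  then show "x +o N = y +o N" using *[of x y] *[of y x] a by simp
qed

section \<open>Arithmetic of the valuation and of the maximal ideal; Hensel's lemma\<close>

locale complete_valuation =
  fixes \<nu> :: "'k::field \<Rightarrow> int" and R :: "'k set" and \<pi> :: 'k
  assumes dv: "discrete_valuation \<nu>"
    and R_eq: "R = valuation_ring \<nu>"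
    and pi_nz: "\<pi> \<noteq> 0" and val_pi: "\<nu> \<pi> = 1"
    and complete: "\<And>u. \<lbrakk>\<And>n. u n \<in> R; val_cauchy \<nu> u\<rbrakk> \<Longrightarrow> \<exists>l\<in>R. val_tendsto \<nu> u l"
    and finite_residue: "finite_residue_field R"
begin

lemma val_mult: "x \<noteq> 0 \<Longrightarrow> y \<noteq> 0 \<Longrightarrow> \<nu> (x * y) = \<nu> x + \<nu> y"
  using dv unfolding discrete_valuation_def by blast

lemma val_one: "\<nu> 1 = 0"
  using val_mult[of 1 1] by simp

lemma val_uminus: "\<nu> (- x) = \<nu> x"
proof (cases "x = 0")
  case False
  have "\<nu> ((-1) * (-1)) = \<nu> (-1) + \<nu> (-1)"
    by (rule val_mult) auto
  then have "\<nu> (-1) = 0"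
    using val_one by simp
  then show ?thesis
    using val_mult[of "-1" x] False by simp
qed simp

lemma val_inverse: "x \<noteq> 0 \<Longrightarrow> \<nu> (inverse x) = - \<nu> x"
  using val_mult[of x "inverse x"] val_one by simp

lemma ge_add: "val_ge \<nu> n x \<Longrightarrow> val_ge \<nu> n y \<Longrightarrow> val_ge \<nu> n (x + y)"
proof -
  assume a: "val_ge \<nu> n x" "val_ge \<nu> n y"
  show ?thesis
  proof (cases "x = 0 \<or> y = 0 \<or> x + y = 0")
    case True
    then show ?thesis using a by (auto simp: val_ge_def)
  next
    case False
    then have "min (\<nu> x) (\<nu> y) \<le> \<nu> (x + y)"
      using dv unfolding discrete_valuation_def by blast
    then show ?thesis using a False by (auto simp: val_ge_def)
  qed
qed

lemma ge_uminus: "val_ge \<nu> n x \<Longrightarrow> val_ge \<nu> n (- x)"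
  by (auto simp: val_ge_def val_uminus)

lemma ge_diff: "val_ge \<nu> n x \<Longrightarrow> val_ge \<nu> n y \<Longrightarrow> val_ge \<nu> n (x - y)"
  using ge_add[of n x "- y"] ge_uminus by simp

lemma ge_mult: "val_ge \<nu> m x \<Longrightarrow> val_ge \<nu> n y \<Longrightarrow> val_ge \<nu> (m + n) (x * y)"
  using val_mult[of x y] by (cases "x = 0 \<or> y = 0") (auto simp: val_ge_def)

lemma ge_mono: "val_ge \<nu> m x \<Longrightarrow> n \<le> m \<Longrightarrow> val_ge \<nu> n x"
  by (auto simp: val_ge_def)

lemma ge_all_imp_zero: "(\<And>k. val_ge \<nu> k x) \<Longrightarrow> x = 0"
  by (metis val_ge_def add_le_same_cancel2 not_one_le_zero)

definition P :: "'k set" where "P = {x. val_ge \<nu> 1 x}"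

lemma R_iff: "x \<in> R \<longleftrightarrow> val_ge \<nu> 0 x"
  by (simp add: R_eq valuation_ring_def)

lemma R_zero [simp, intro]: "0 \<in> R" and R_one [simp, intro]: "1 \<in> R"
  by (simp_all add: R_iff val_ge_def val_one)

lemma R_add [intro]: "x \<in> R \<Longrightarrow> y \<in> R \<Longrightarrow> x + y \<in> R"
  and R_diff [intro]: "x \<in> R \<Longrightarrow> y \<in> R \<Longrightarrow> x - y \<in> R"
  and R_uminus [intro]: "x \<in> R \<Longrightarrow> - x \<in> R"
  by (simp_all add: R_iff ge_add ge_diff ge_uminus)

lemma R_mult [intro]: "x \<in> R \<Longrightarrow> y \<in> R \<Longrightarrow> x * y \<in> R"
  using ge_mult[of 0 x 0 y] by (simp add: R_iff)

lemma R_power [intro]: "x \<in> R \<Longrightarrow> x ^ n \<in> R"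
  by (induction n) auto

lemma R_two [simp, intro]: "2 \<in> R"
  using R_add[of 1 1] by simp

lemma P_R: "x \<in> P \<Longrightarrow> x \<in> R"
  by (auto simp: P_def R_iff intro: ge_mono)

lemma P_zero [simp, intro]: "0 \<in> P"
  by (simp add: P_def val_ge_def)

lemma P_add [intro]: "x \<in> P \<Longrightarrow> y \<in> P \<Longrightarrow> x + y \<in> P"
  and P_diff [intro]: "x \<in> P \<Longrightarrow> y \<in> P \<Longrightarrow> x - y \<in> P"
  and P_uminus [intro]: "x \<in> P \<Longrightarrow> - x \<in> P"
  by (simp_all add: P_def ge_add ge_diff ge_uminus)

lemma P_mult_left [intro]: "x \<in> R \<Longrightarrow> y \<in> P \<Longrightarrow> x * y \<in> P"
  using ge_mult[of 0 x 1 y] by (simp add: R_iff P_def)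

lemma P_mult_right [intro]: "x \<in> P \<Longrightarrow> y \<in> R \<Longrightarrow> x * y \<in> P"
  using P_mult_left[of y x] by (simp add: mult.commute)

lemma one_notin_P: "1 \<notin> P"
  by (simp add: P_def val_ge_def val_one)

lemma pi_P: "\<pi> \<in> P"
  by (simp add: P_def val_ge_def val_pi)

text \<open>This translates "\<open>F x y\<close> lies in \<open>P\<close> for all \<open>y\<close>
  in the lattice" into "\<open>x\<close> divided by \<open>\<pi>\<close> lies in the dual lattice",
  the form in which non-degeneracy modulo \<open>P\<close> gets used.\<close>

lemma P_iff: "x \<in> P \<longleftrightarrow> inverse \<pi> * x \<in> R"
proof (cases "x = 0")
  case False
  then show ?thesis
    using val_mult[of "inverse \<pi>" x] val_inverse[OF pi_nz] val_pi pi_nz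
    by (auto simp: P_def R_iff val_ge_def)
qed simp

lemma unit_iff: "x \<in> R \<Longrightarrow> x \<notin> P \<longleftrightarrow> x \<noteq> 0 \<and> inverse x \<in> R"
  using val_inverse[of x] by (auto simp: P_def R_iff val_ge_def)

lemma unit_inverse: "x \<in> R \<Longrightarrow> x \<notin> P \<Longrightarrow> inverse x \<in> R"
  and unit_nz: "x \<notin> P \<Longrightarrow> x \<noteq> 0"
  using unit_iff by auto

lemma unit_mult: "\<lbrakk>x \<in> R; x \<notin> P; y \<in> R; y \<notin> P\<rbrakk> \<Longrightarrow> x * y \<notin> P"
  using unit_iff[of x] unit_iff[of y] unit_iff[of "x * y"] R_mult[of x y]
    R_mult[of "inverse x" "inverse y"] by simp

lemma P_prime: "\<lbrakk>x \<in> R; y \<in> R; x * y \<in> P\<rbrakk> \<Longrightarrow> x \<in> P \<or> y \<in> P"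
  using unit_mult by blast

lemma P_divide_unit: "\<lbrakk>y \<in> R; y \<notin> P; x * y \<in> P\<rbrakk> \<Longrightarrow> x \<in> P"
  using P_mult_right[of "x * y" "inverse y"] unit_iff[of y] by (simp add: mult.assoc)

text \<open>For \<open>x\<close> nonzero the valuation of \<open>x\<close> divided by
  \<open>\<pi> ^ n\<close> is \<open>\<nu> x - n\<close>, which becomes negative.\<close>

lemma infinitely_divisible_zero:
  assumes "\<And>n. inverse \<pi> ^ n * x \<in> R"
  shows "x = 0"
proof (rule ccontr)
  assume x: "x \<noteq> 0"
  have v: "\<nu> (inverse \<pi> ^ n * x) = \<nu> x - int n" for n
  proof (induction n)
    case (Suc n)
    have "\<nu> (inverse \<pi> * (inverse \<pi> ^ n * x)) = \<nu> (inverse \<pi>) + \<nu> (inverse \<pi> ^ n * x)"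
      by (rule val_mult) (use pi_nz x in auto)
    then show ?case
      using Suc val_inverse[OF pi_nz] val_pi by (simp add: mult.assoc)
  qed simp
  have "inverse \<pi> ^ nat (\<bar>\<nu> x\<bar> + 1) * x \<noteq> 0"
    using x pi_nz by simp
  then have "0 \<le> \<nu> x - int (nat (\<bar>\<nu> x\<bar> + 1))"
    using assms[of "nat (\<bar>\<nu> x\<bar> + 1)"] v by (metis R_iff val_ge_def)
  then show False by simp
qed

text \<open>A root is a fixed point of \<open>t \<mapsto> - (a + b t^2)\<close>. This map preserves
  \<open>P\<close> and contracts it, since the difference of two values is the difference of the
  arguments times \<open>- b (t + t')\<close>, an element of \<open>P\<close>. The linear
  coefficient being 1, the argument is the same in residue characteristic 2.\<close>

lemma hensel_quadratic:
  assumes a: "a \<in> P" and b: "b \<in> R"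
  shows "\<exists>t\<in>P. a + t + b * t\<^sup>2 = 0"
proof -
  define u where "u = rec_nat 0 (\<lambda>_ t. - (a + b * t\<^sup>2))"
  have u0: "u 0 = 0" and uS: "u (Suc n) = - (a + b * (u n)\<^sup>2)" for n
    by (simp_all add: u_def)
  have uP: "u n \<in> P" for n
  proof (induction n)
    case (Suc n)
    then have "b * (u n * u n) \<in> P"
      using b P_R by blast
    then show ?case
      using a by (auto simp: uS power2_eq_square)
  qed (simp add: u0)
  have step: "val_ge \<nu> (int n + 1) (u (Suc n) - u n)" for n
  proof (induction n)
    case 0
    show ?case using uP[of 1] by (simp add: u0 P_def)
  next
    case (Suc n)
    have eq: "u (Suc (Suc n)) - u (Suc n) = (u (Suc n) - u n) * (- b * (u (Suc n) + u n))"
      by (subst uS, subst (2) uS) (simp add: power2_eq_square algebra_simps)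
    have "- b * (u (Suc n) + u n) \<in> P"
      using b uP by blast
    then show ?case
      unfolding eq using ge_mult[OF Suc] by (fastforce simp: P_def)
  qed
  have diff: "val_ge \<nu> (int n + 1) (u (n + k) - u n)" for n k
  proof (induction k)
    case 0
    show ?case by (simp add: val_ge_def)
  next
    case (Suc k)
    have "val_ge \<nu> (int n + 1) (u (Suc (n + k)) - u (n + k))"
      by (rule ge_mono[OF step]) simp
    from ge_add[OF this Suc] show ?case by simp
  qed
  have cauchy: "val_cauchy \<nu> u"
    unfolding val_cauchy_def
  proof (intro allI exI impI)
    fix k :: int and m n :: nat
    assume mn: "nat k \<le> m" "nat k \<le> n"
    have "val_ge \<nu> k (u m - u (nat k))" "val_ge \<nu> k (u n - u (nat k))"
      using diff[of "nat k" "m - nat k"] diff[of "nat k" "n - nat k"] mn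
      by (auto intro: ge_mono)
    from ge_diff[OF this] show "val_ge \<nu> k (u m - u n)" by simp
  qed
  obtain l where l: "l \<in> R" "val_tendsto \<nu> u l"
    using complete[of u] cauchy uP P_R by blast
  have near: "\<exists>n. val_ge \<nu> k (u n - l) \<and> val_ge \<nu> k (u (Suc n) - l)" for k
    using l(2) unfolding val_tendsto_def by (meson le_Suc_eq order_refl)
  obtain n where "val_ge \<nu> 1 (u n - l)"
    using near by blast
  then have "u n - l \<in> P"
    by (simp add: P_def)
  from P_diff[OF uP[of n] this] have lP: "l \<in> P" by simp
  have "a + l + b * l\<^sup>2 = 0"
  proof (rule ge_all_imp_zero)
    fix k
    obtain n where n: "val_ge \<nu> k (u n - l)" "val_ge \<nu> k (u (Suc n) - l)"
      using near by blast
    have eq: "a + l + b * l\<^sup>2 = - (u (Suc n) - l) - (u n - l) * (b * (u n + l))"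
      by (simp add: uS power2_eq_square algebra_simps)
    have "b * (u n + l) \<in> R"
      using b l uP P_R by blast
    then have "val_ge \<nu> k ((u n - l) * (b * (u n + l)))"
      using ge_mult[OF n(1), of 0] by (simp add: R_iff)
    then show "val_ge \<nu> k (a + l + b * l\<^sup>2)"
      unfolding eq using n(2) by (blast intro: ge_diff ge_uminus)
  qed
  then show ?thesis using lP by blast
qed

section \<open>Squares in the finite residue field\<close>

lemma nonunits_eq: "nonunits R = P"
proof -
  have "(\<exists>y\<in>R. x * y = 1) \<longleftrightarrow> x \<noteq> 0 \<and> inverse x \<in> R" if "x \<in> R" for x
    by (metis inverse_unique mult_zero_left right_inverse zero_neq_one)
  then show ?thesis
    using unit_iff P_R unfolding nonunits_def by blast
qed

text \<open>Counting takes place on a transversal \<open>T\<close> of the residue classes inside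
  \<open>R\<close>, with \<open>r\<close> as reduction map; injectivity and cardinality arguments
  then concern subsets of one finite set.\<close>

lemma residue_representatives:
  obtains T r where "finite T" "T \<subseteq> R" "\<And>x. x \<in> R \<Longrightarrow> r x \<in> T" "\<And>x. x \<in> R \<Longrightarrow> x - r x \<in> P"
    "\<And>x y. x \<in> T \<Longrightarrow> y \<in> T \<Longrightarrow> x - y \<in> P \<Longrightarrow> x = y"
proof -
  have fin: "finite ((\<lambda>x. x +o P) ` R)"
    using finite_residue by (simp add: finite_residue_field_def cosets_def nonunits_eq)
  have eq: "x +o P = y +o P \<longleftrightarrow> x - y \<in> P" for x y
    by (rule coset_eq_iff) auto
  define r where "r x = inv_into R (\<lambda>x. x +o P) (x +o P)" for x
  have r: "r x \<in> R" "r x +o P = x +o P" if "x \<in> R" for x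
    using inv_into_into[of "x +o P" "\<lambda>x. x +o P" R] f_inv_into_f[of "x +o P" "\<lambda>x. x +o P" R] that
    by (auto simp: r_def)
  have "finite (r ` R)"
    using finite_imageI[OF fin, of "inv_into R (\<lambda>x. x +o P)"] by (simp add: image_image r_def)
  moreover have "x = y" if x: "x \<in> r ` R" and y: "y \<in> r ` R" and xy: "x - y \<in> P" for x y
  proof -
    obtain a b where ab: "a \<in> R" "b \<in> R" "x = r a" "y = r b"
      using x y by blast
    then have "a +o P = b +o P"
      using xy r eq by metis
    then show ?thesis
      using ab by (simp add: r_def)
  qed
  ultimately show thesis
  proof (intro that[of "r ` R" r])
    show "x - r x \<in> P" if "x \<in> R" for x
      using r[OF that] eq by metis
  qed (use r in auto)
qed

text \<open>When 2 lies in \<open>P\<close>, \<open>(x - y)^2\<close> and \<open>x^2 - y^2\<close>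
  agree modulo \<open>P\<close>, so squaring is injective on residue classes; finiteness makes it
  surjective.\<close>

lemma square_root_mod_P:
  assumes two: "2 \<in> P" and a: "a \<in> R"
  shows "\<exists>c\<in>R. c\<^sup>2 - a \<in> P"
proof -
  obtain T r where T: "finite T" "T \<subseteq> R" "\<And>x. x \<in> R \<Longrightarrow> r x \<in> T" "\<And>x. x \<in> R \<Longrightarrow> x - r x \<in> P"
    "\<And>x y. x \<in> T \<Longrightarrow> y \<in> T \<Longrightarrow> x - y \<in> P \<Longrightarrow> x = y"
    using residue_representatives by blast
  have "inj_on (\<lambda>x. r (x\<^sup>2)) T"
  proof (rule inj_onI)
    fix x y assume xy: "x \<in> T" "y \<in> T" "r (x\<^sup>2) = r (y\<^sup>2)"
    then have R: "x \<in> R" "y \<in> R" using T by auto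
    have "(x\<^sup>2 - r (x\<^sup>2)) - (y\<^sup>2 - r (y\<^sup>2)) \<in> P"
      using T(4) R by blast
    moreover have "(x - y) * (x - y) = (x\<^sup>2 - y\<^sup>2) - 2 * (y * (x - y))"
      by (simp add: power2_eq_square algebra_simps)
    moreover have "2 * (y * (x - y)) \<in> P"
      using two R by blast
    ultimately have "(x - y) * (x - y) \<in> P"
      using xy(3) by auto
    then have "x - y \<in> P"
      using P_prime R by blast
    then show "x = y" using T(5) xy by blast
  qed
  then have "(\<lambda>x. r (x\<^sup>2)) ` T = T"
    using T by (intro endo_inj_surj) auto
  then have "r a \<in> (\<lambda>x. r (x\<^sup>2)) ` T"
    using T(3)[OF a] by simp
  then obtain c where c: "c \<in> T" "r (c\<^sup>2) = r a"
    by auto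
  have "(c\<^sup>2 - r (c\<^sup>2)) - (a - r a) \<in> P"
    using T c a by blast
  then show ?thesis
    using c T by auto
qed

text \<open>Two arguments with the same value agree up to sign modulo \<open>P\<close>, so fibres
  have at most two points, and the fibre of the class of 0 has only one. The image therefore has at
  least (q + 1) / 2 elements, q being the size of \<open>T\<close>.\<close>

lemma card_scaled_squares:
  assumes "2 \<notin> P" "a \<in> R" "a \<notin> P" "c \<in> R"
    and T: "finite T" "T \<subseteq> R" "\<And>x. x \<in> R \<Longrightarrow> r x \<in> T" "\<And>x. x \<in> R \<Longrightarrow> x - r x \<in> P"
      "\<And>x y. x \<in> T \<Longrightarrow> y \<in> T \<Longrightarrow> x - y \<in> P \<Longrightarrow> x = y"
  shows "card T < 2 * card ((\<lambda>s. r (a * s\<^sup>2 + c)) ` T)"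
proof -
  let ?f = "\<lambda>s. r (a * s\<^sup>2 + c)"
  let ?A = "?f ` T"
  have R: "s \<in> R" "a * s\<^sup>2 + c \<in> R" if "s \<in> T" for s
    using that T(2) assms(2,4) by auto
  have fib: "s = t \<or> s + t \<in> P" if "s \<in> T" "t \<in> T" "?f s = ?f t" for s t
  proof -
    have "((a * s\<^sup>2 + c) - ?f s) - ((a * t\<^sup>2 + c) - ?f t) \<in> P"
      using T(4) R that by blast
    moreover have "((a * s\<^sup>2 + c) - ?f s) - ((a * t\<^sup>2 + c) - ?f t) = ((s - t) * (s + t)) * a"
      using that(3) by (simp add: power2_eq_square algebra_simps)
    ultimately have "(s - t) * (s + t) \<in> P"
      using P_divide_unit assms(2,3) by metis
    then have "s - t \<in> P \<or> s + t \<in> P"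
      using P_prime R that by blast
    then show ?thesis using T(5) that by blast
  qed
  \<comment> \<open>The transversal need not contain 0, so \<open>o'\<close> represents its class.
    That fibre is a single point because \<open>s + o'\<close> in \<open>P\<close> forces
    \<open>s - o'\<close> in \<open>P\<close>.\<close>
  define o' where "o' = r 0"
  have o': "o' \<in> T" "o' \<in> P"
    using T(3)[of 0] T(4)[of 0] P_uminus[of "- o'"] by (auto simp: o'_def)
  have fib0: "{s \<in> T. ?f s = ?f o'} \<subseteq> {o'}"
  proof
    fix s assume s: "s \<in> {s \<in> T. ?f s = ?f o'}"
    then have "s = o' \<or> s + o' \<in> P" using fib o' by blast
    then have "s = o' \<or> s - o' \<in> P"
      using P_diff[of "s + o'" "o' + o'"] o' P_add by (auto simp: algebra_simps)
    then show "s \<in> {o'}" using T(5) o' s by blast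
  qed
  have fib2: "card {s \<in> T. ?f s = y} \<le> 2" if y: "y \<in> ?A" for y
  proof -
    obtain t where t: "t \<in> T" "y = ?f t" using y by auto
    have "{s \<in> T. ?f s = y} \<subseteq> {t, r (- t)}"
    proof
      fix s assume s: "s \<in> {s \<in> T. ?f s = y}"
      then have "s = t \<or> s + t \<in> P" using fib t by auto
      moreover have "- t - r (- t) \<in> P" using T(4) R t by blast
      ultimately have "s = t \<or> s - r (- t) \<in> P"
        using P_add[of "s + t" "- t - r (- t)"] by auto
      then show "s \<in> {t, r (- t)}"
        using T(5) s T(3) R t by blast
    qed
    then have "card {s \<in> T. ?f s = y} \<le> card {t, r (- t)}"
      by (intro card_mono) auto
    also have "\<dots> \<le> 2" by (simp add: card_insert_if)
    finally show ?thesis .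
  qed
  have "card T = (\<Sum>y\<in>?A. card {s \<in> T. ?f s = y})"
    using sum.image_gen[OF T(1), of "\<lambda>_. 1::nat" ?f] by simp
  also have "\<dots> = card {s \<in> T. ?f s = ?f o'} + (\<Sum>y\<in>?A - {?f o'}. card {s \<in> T. ?f s = y})"
    using o' T(1) by (intro sum.remove) auto
  also have "\<dots> \<le> 1 + (\<Sum>y\<in>?A - {?f o'}. 2)"
  proof (intro add_mono sum_mono)
    show "card {s \<in> T. ?f s = ?f o'} \<le> 1"
      using card_mono[OF _ fib0] by simp
  qed (use fib2 in auto)
  also have "\<dots> = 1 + 2 * (card ?A - 1)"
    using o' T(1) by (simp add: card_Diff_singleton)
  \<comment> \<open>The subtraction is one of natural numbers: the image has to be nonempty for the
    left side to be one less than twice its size.\<close>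
  also have "\<dots> < 2 * card ?A"
  proof -
    have "card ?A > 0" using o' T(1) by (auto simp: card_gt_0_iff)
    then show ?thesis by simp
  qed
  finally show ?thesis .
qed

text \<open>\<open>a s^2\<close> and \<open>- b t^2 - c\<close> each take values in more than half
  of the residue classes, so the two sets of values meet.\<close>

lemma conic_mod_P:
  assumes "2 \<notin> P" "a \<in> R" "a \<notin> P" "b \<in> R" "b \<notin> P" "c \<in> R"
  shows "\<exists>s\<in>R. \<exists>t\<in>R. a * s\<^sup>2 + b * t\<^sup>2 + c \<in> P"
proof -
  obtain T r where T: "finite T" "T \<subseteq> R" "\<And>x. x \<in> R \<Longrightarrow> r x \<in> T" "\<And>x. x \<in> R \<Longrightarrow> x - r x \<in> P"
    "\<And>x y. x \<in> T \<Longrightarrow> y \<in> T \<Longrightarrow> x - y \<in> P \<Longrightarrow> x = y"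
    using residue_representatives by blast
  let ?A = "(\<lambda>s. r (a * s\<^sup>2 + 0)) ` T" and ?B = "(\<lambda>s. r (- b * s\<^sup>2 + - c)) ` T"
  have A: "card T < 2 * card ?A"
    by (rule card_scaled_squares[OF assms(1,2,3) R_zero T])
  have B: "card T < 2 * card ?B"
  proof (rule card_scaled_squares[OF assms(1) _ _ _ T])
    show "- b \<notin> P" using assms(5) P_uminus[of "- b"] by auto
  qed (use assms in auto)
  have AB: "?A \<subseteq> T" "?B \<subseteq> T"
    using T(2) assms by (auto intro!: T(3) R_diff R_uminus R_mult R_power)
  have "?A \<inter> ?B \<noteq> {}"
  proof
    assume "?A \<inter> ?B = {}"
    then have "card ?A + card ?B = card (?A \<union> ?B)"
      using T(1) by (intro card_Un_disjoint[symmetric]) auto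
    also have "\<dots> \<le> card T"
      using AB T(1) by (intro card_mono) auto
    finally show False using A B by linarith
  qed
  then obtain s t where st: "s \<in> T" "t \<in> T" "r (a * s\<^sup>2 + 0) = r (- b * t\<^sup>2 + - c)"
    by auto
  then have R: "a * s\<^sup>2 + 0 \<in> R" "- b * t\<^sup>2 + - c \<in> R" using T(2) assms by (auto intro!: R_diff R_uminus R_mult R_power)
  have "((a * s\<^sup>2 + 0) - r (a * s\<^sup>2 + 0)) - ((- b * t\<^sup>2 + - c) - r (- b * t\<^sup>2 + - c)) \<in> P"
    using T(4) R by blast
  then have "a * s\<^sup>2 + b * t\<^sup>2 + c \<in> P"
    using st(3) by (simp add: algebra_simps)
  then show ?thesis using st T(2) by blast
qed

end

section \<open>Semi-regular lattices over complete discrete valuation rings\<close>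

lemmas lin_add = module_hom.add[OF module_hom_linearI]
  and lin_scale = module_hom.scale[OF module_hom_linearI]
  and lin_zero = module_hom.zero[OF module_hom_linearI]
  and lin_neg = module_hom.neg[OF module_hom_linearI]
  and lin_diff = module_hom.diff[OF module_hom_linearI]
  and lin_sum = module_hom.sum[OF module_hom_linearI]

section \<open>Symmetric bilinear forms and their quadratic forms\<close>

locale bilinear_space = vector_space scale
  for scale :: "'k::field \<Rightarrow> 'v::ab_group_add \<Rightarrow> 'v" +
  fixes F :: "'v \<Rightarrow> 'v \<Rightarrow> 'k"
  assumes form: "symmetric_bilinear_form scale F" and two_nz: "(2::'k) \<noteq> 0"
begin

lemma F_commute: "F v w = F w v"
  and F_linear: "Vector_Spaces.linear scale (*) (F v)"
  using form by (auto simp: symmetric_bilinear_form_def)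

lemma F_right [simp]:
  "F v (x + y) = F v x + F v y" "F v (scale a x) = a * F v x" "F v 0 = 0" "F v (- x) = - F v x"
  "F v (x - y) = F v x - F v y" "F v (\<Sum>i\<in>I. h i) = (\<Sum>i\<in>I. F v (h i))"
  using lin_add[OF F_linear] lin_scale[OF F_linear] lin_zero[OF F_linear]
    lin_neg[OF F_linear] lin_diff[OF F_linear] lin_sum[OF F_linear] by auto

lemma F_left [simp]:
  "F (x + y) v = F x v + F y v" "F (scale a x) v = a * F x v" "F 0 v = 0" "F (- x) v = - F x v"
  "F (x - y) v = F x v - F y v"
  by (simp_all add: F_commute[of _ v])

abbreviation "Q \<equiv> quad F"

lemma F_self: "F v v = 2 * Q v"
  using two_nz by (simp add: quad_def)

lemma Q_add: "Q (v + w) = Q v + Q w + F v w"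
  using two_nz by (simp add: quad_def F_commute[of w v] field_simps)

lemma Q_scale: "Q (scale a v) = a\<^sup>2 * Q v"
  by (simp add: quad_def power2_eq_square)

end

section \<open>Semi-regular lattices and orthogonal splitting\<close>

locale quadratic_space = complete_valuation \<nu> R \<pi> + bilinear_space scale F +
  finite_dimensional_vector_space scale Basis
  for \<nu> :: "'k::field \<Rightarrow> int" and R \<pi> and scale :: "'k \<Rightarrow> 'v::ab_group_add \<Rightarrow> 'v" (infixr "*s" 75)
    and F Basis
begin

definition dual_in :: "'v set \<Rightarrow> 'v set \<Rightarrow> 'v set" where
  "dual_in W M = {y \<in> W. \<forall>x\<in>M. F y x \<in> R}"

text \<open>
  \<open>M\<close> is an even lattice in the nondegenerate subspace \<open>W\<close>, and \<open>r \<mapsto> r y0\<close> induces an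
  isomorphism from \<open>R / 2R\<close> to \<open>M\<^sup># / M\<close>.
\<close>

definition semireg :: "'v set \<Rightarrow> 'v set \<Rightarrow> 'v \<Rightarrow> bool" where
  "semireg W M y0 \<longleftrightarrow> subspace W \<and> M \<subseteq> W \<and> 0 \<in> M \<and> (\<forall>x\<in>M. \<forall>y\<in>M. x + y \<in> M) \<and>
     (\<forall>r\<in>R. \<forall>x\<in>M. r *s x \<in> M) \<and> (\<forall>x\<in>W. \<exists>r\<in>R. r \<noteq> 0 \<and> r *s x \<in> M) \<and>
     (\<forall>x\<in>M. Q x \<in> R) \<and> (\<forall>x\<in>W. (\<forall>y\<in>W. F x y = 0) \<longrightarrow> x = 0) \<and>
     y0 \<in> dual_in W M \<and> (\<forall>y\<in>dual_in W M. \<exists>r\<in>R. y - r *s y0 \<in> M) \<and>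
     (\<forall>r\<in>R. r *s y0 \<in> M \<longleftrightarrow> (\<exists>s\<in>R. r = 2 * s))"

context
  fixes W M y0
  assumes sr: "semireg W M y0"
begin

lemma sub_W: "subspace W"
  and M_W: "x \<in> M \<Longrightarrow> x \<in> W"
  and M_zero: "0 \<in> M"
  and M_add: "x \<in> M \<Longrightarrow> y \<in> M \<Longrightarrow> x + y \<in> M"
  and M_scale: "r \<in> R \<Longrightarrow> x \<in> M \<Longrightarrow> r *s x \<in> M"
  and M_full: "x \<in> W \<Longrightarrow> \<exists>r\<in>R. r \<noteq> 0 \<and> r *s x \<in> M"
  and M_even: "x \<in> M \<Longrightarrow> Q x \<in> R"
  and W_nondeg: "x \<in> W \<Longrightarrow> (\<And>y. y \<in> W \<Longrightarrow> F x y = 0) \<Longrightarrow> x = 0"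
  and y0_dual: "y0 \<in> dual_in W M"
  and dual_gen: "y \<in> dual_in W M \<Longrightarrow> \<exists>r\<in>R. y - r *s y0 \<in> M"
  and scale_y0_iff: "r \<in> R \<Longrightarrow> r *s y0 \<in> M \<longleftrightarrow> (\<exists>s\<in>R. r = 2 * s)"
  using sr unfolding semireg_def by (simp_all add: subset_iff)

lemma M_uminus: "x \<in> M \<Longrightarrow> - x \<in> M"
  using M_scale[of "-1" x] by auto

lemma M_diff: "x \<in> M \<Longrightarrow> y \<in> M \<Longrightarrow> x - y \<in> M"
  using M_add[of x "- y"] M_uminus by simp

lemma F_in_R: "x \<in> M \<Longrightarrow> y \<in> M \<Longrightarrow> F x y \<in> R"
  using R_diff[OF R_diff[OF M_even[OF M_add] M_even[of x]] M_even[of y], of x y] Q_add[of x y]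
  by simp

lemma M_dual: "x \<in> M \<Longrightarrow> x \<in> dual_in W M"
  using F_in_R M_W by (auto simp: dual_in_def)

lemma eq_zero_if_orthogonal: "x \<in> W \<Longrightarrow> (\<And>y. y \<in> M \<Longrightarrow> F x y = 0) \<Longrightarrow> x = 0"
proof (rule W_nondeg)
  fix y assume x: "x \<in> W" and o: "\<And>y. y \<in> M \<Longrightarrow> F x y = 0" and "y \<in> W"
  then obtain r where "r \<noteq> 0" "r *s y \<in> M" using M_full by blast
  then show "F x y = 0" using o[of "r *s y"] by simp
qed

text \<open>Pairing with \<open>M\<close> sends repeated quotients by \<open>\<pi>\<close> into
  \<open>R\<close>, so every value is infinitely divisible. The lemma serves to find primitive
  vectors: a nonzero subset of \<open>M\<close> cannot be stable under division by
  \<open>\<pi>\<close>.\<close>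

lemma divisible_eq_zero:
  assumes "A \<subseteq> M" "\<And>x. x \<in> A \<Longrightarrow> inverse \<pi> *s x \<in> A" "x \<in> A"
  shows "x = 0"
proof (rule eq_zero_if_orthogonal)
  have pow: "inverse \<pi> ^ n *s x \<in> A" for n
  proof (induction n)
    case (Suc n)
    then show ?case using assms(2) by fastforce
  qed (use assms in simp)
  fix y assume "y \<in> M"
  then have "inverse \<pi> ^ n * F x y \<in> R" for n
    using F_in_R[of "inverse \<pi> ^ n *s x" y] pow assms(1) by auto
  then show "F x y = 0" by (rule infinitely_divisible_zero)
qed (use assms M_W in auto)

text \<open>That \<open>p\<close> carries the dual into \<open>M\<close> means that the summand
  \<open>p M\<close> is unimodular. It contributes nothing to the discriminant group, so the kernel
  of \<open>p\<close> inherits that group, generated by the component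
  \<open>y0 - p y0\<close>.\<close>

lemma semireg_split:
  assumes p: "Vector_Spaces.linear scale scale p" and idem: "\<And>x. p (p x) = p x"
    and adj: "\<And>x y. F (p x) y = F x (p y)" and pD: "\<And>x. x \<in> dual_in W M \<Longrightarrow> p x \<in> M"
  shows "semireg {x \<in> W. p x = 0} {x \<in> M. p x = 0} (y0 - p y0)"
proof -
  note lin = lin_add[OF p] lin_scale[OF p] lin_zero[OF p] lin_diff[OF p]
  have pM: "p x \<in> M" if "x \<in> M" for x using pD M_dual that by blast
  have pW: "p x \<in> W" if x: "x \<in> W" for x
  proof -
    obtain r where r: "r \<noteq> 0" "r *s x \<in> M" using M_full x by blast
    then have "inverse r *s p (r *s x) \<in> W"
      using pM M_W subspace_scale[OF sub_W] by blast
    then show ?thesis using r by (simp add: lin)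
  qed
  have F0: "F x y = F x (y - p y)" if "p x = 0" for x y
    using that adj[of x y] by simp
  \<comment> \<open>A vector killed by \<open>p\<close> pairs with \<open>x\<close> as it pairs with
    \<open>x - p x\<close>, so integrality on the complement already gives integrality on all of
    \<open>M\<close>.\<close>
  have dual: "y \<in> dual_in W M" if yD: "y \<in> dual_in {x \<in> W. p x = 0} {x \<in> M. p x = 0}" for y
  proof -
    have y: "y \<in> W" "p y = 0" using yD by (auto simp: dual_in_def)
    have "F y x \<in> R" if x: "x \<in> M" for x
    proof -
      have "x - p x \<in> {x \<in> M. p x = 0}" using M_diff[OF x pM[OF x]] by (simp add: lin idem)
      then show ?thesis
        using yD unfolding F0[OF y(2), of x] dual_in_def by blast
    qed
    then show ?thesis using y by (auto simp: dual_in_def)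
  qed
  have py0: "p y0 \<in> M" using pD y0_dual by blast
  have y0W: "y0 \<in> W" using y0_dual by (auto simp: dual_in_def)
  show ?thesis
    unfolding semireg_def
  proof (intro conjI ballI impI)
    show "subspace {x \<in> W. p x = 0}"
      using sub_W unfolding subspace_def by (auto simp: lin)
    show "\<exists>r\<in>R. r \<noteq> 0 \<and> r *s x \<in> {x \<in> M. p x = 0}" if "x \<in> {x \<in> W. p x = 0}" for x
      using M_full[of x] that by (auto simp: lin)
    show "x = 0" if x: "x \<in> {x \<in> W. p x = 0}" and o: "\<forall>y\<in>{x \<in> W. p x = 0}. F x y = 0" for x
    proof (rule W_nondeg)
      fix y assume y: "y \<in> W"
      then have "y - p y \<in> {x \<in> W. p x = 0}"
        using pW subspace_diff[OF sub_W] by (auto simp: lin idem)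
      then show "F x y = 0" by (subst F0) (use x o in blast)+
    qed (use x in simp)
    show "y0 - p y0 \<in> dual_in {x \<in> W. p x = 0} {x \<in> M. p x = 0}"
      using y0_dual py0 F_in_R pW[OF y0W] y0W subspace_diff[OF sub_W]
      by (auto simp: dual_in_def lin idem)
    show "\<exists>r\<in>R. y - r *s (y0 - p y0) \<in> {x \<in> M. p x = 0}"
      if y: "y \<in> dual_in {x \<in> W. p x = 0} {x \<in> M. p x = 0}" for y
    proof -
      obtain r where r: "r \<in> R" "y - r *s y0 \<in> M" using dual_gen dual y by blast
      have py: "p y = 0" using y by (auto simp: dual_in_def)
      have "(y - r *s y0) + r *s p y0 \<in> M" using M_add M_scale r py0 by blast
      then have "y - r *s (y0 - p y0) \<in> M" by (simp add: algebra_simps)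
      then show ?thesis using r py by (auto simp: lin idem)
    qed
    show "r *s (y0 - p y0) \<in> {x \<in> M. p x = 0} \<longleftrightarrow> (\<exists>s\<in>R. r = 2 * s)" if r: "r \<in> R" for r
    proof -
      have "r *s (y0 - p y0) \<in> M \<longleftrightarrow> r *s y0 \<in> M"
        using M_add[of "r *s (y0 - p y0)" "r *s p y0"] M_diff[of "r *s y0" "r *s p y0"]
          M_scale[OF r py0] by (auto simp: scale_right_diff_distrib)
      then show ?thesis using scale_y0_iff[OF r] by (auto simp: lin idem)
    qed
  qed (use M_W M_zero M_add M_scale M_even in \<open>auto simp: lin\<close>)
qed

end

section \<open>Orthogonal projections onto planes and lines\<close>

definition dual_vec :: "'v \<Rightarrow> 'v \<Rightarrow> 'v" where
  "dual_vec u w = inverse (F u u * F w w - (F u w)\<^sup>2) *s (F w w *s u - F u w *s w)"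

definition plane_proj :: "'v \<Rightarrow> 'v \<Rightarrow> 'v \<Rightarrow> 'v" where
  "plane_proj u w v = F v (dual_vec u w) *s u + F v (dual_vec w u) *s w"

definition line_proj :: "'v \<Rightarrow> 'v \<Rightarrow> 'v" where
  "line_proj x v = (F v x / F x x) *s x"

lemma linear_plane_proj: "Vector_Spaces.linear scale scale (plane_proj u w)"
  unfolding Vector_Spaces.linear_iff plane_proj_def
  by (simp add: vector_space_axioms scale_left_distrib scale_right_distrib add_ac)

lemma linear_line_proj: "Vector_Spaces.linear scale scale (line_proj x)"
  unfolding Vector_Spaces.linear_iff line_proj_def
  by (simp add: vector_space_axioms add_divide_distrib scale_left_distrib)

context
  fixes W M y0 u w
  assumes sr: "semireg W M y0" and u: "u \<in> M" and w: "w \<in> M"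
    and D: "F u u * F w w - (F u w)\<^sup>2 \<notin> P"
begin

lemma dual_vec_swap:
  "dual_vec w u = inverse (F u u * F w w - (F u w)\<^sup>2) *s (F u u *s w - F u w *s u)"
  unfolding dual_vec_def by (simp only: F_commute[of w u] mult.commute[of "F w w" "F u u"])

text \<open>\<open>dual_vec\<close> is Cramer's rule for the Gram matrix of \<open>u\<close> and
  \<open>w\<close>: the two vectors form the basis of the plane dual to \<open>u\<close>,
  \<open>w\<close>.\<close>

lemma dual_vec_F:
  "F u (dual_vec u w) = 1" "F w (dual_vec w u) = 1" "F w (dual_vec u w) = 0" "F u (dual_vec w u) = 0"
proof -
  define i where "i = inverse (F u u * F w w - (F u w)\<^sup>2)"
  have i: "i * (F u u * F w w - F u w * F u w) = 1"
    using unit_nz[OF D] by (simp add: i_def power2_eq_square)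
  show "F u (dual_vec u w) = 1" "F w (dual_vec u w) = 0"
    using i by (simp_all add: dual_vec_def F_commute[of w u] mult.commute flip: i_def)
  show "F w (dual_vec w u) = 1" "F u (dual_vec w u) = 0"
    using i by (simp_all add: dual_vec_swap F_commute[of w u] mult.commute flip: i_def)
qed

lemma plane_proj_fixed: "plane_proj u w u = u" "plane_proj u w w = w"
  by (simp_all add: plane_proj_def dual_vec_F)

lemma plane_proj_idem: "plane_proj u w (plane_proj u w x) = plane_proj u w x"
  by (simp add: plane_proj_def dual_vec_F)

lemma plane_proj_adjoint: "F (plane_proj u w x) y = F x (plane_proj u w y)"
proof -
  define i where "i = inverse (F u u * F w w - (F u w)\<^sup>2)"
  have "F (plane_proj u w x) y =
      i * (F w w * F x u - F u w * F x w) * F y u + i * (F u u * F x w - F u w * F x u) * F y w"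
    by (simp add: plane_proj_def dual_vec_swap dual_vec_def[of u w] F_commute[of _ y] flip: i_def)
  also have "\<dots> =
      i * (F w w * F y u - F u w * F y w) * F x u + i * (F u u * F y w - F u w * F y u) * F x w"
    by (simp add: algebra_simps)
  also have "\<dots> = F x (plane_proj u w y)"
    by (simp add: plane_proj_def dual_vec_swap dual_vec_def[of u w] flip: i_def)
  finally show ?thesis .
qed

text \<open>A unit Gram determinant keeps the dual basis of the plane inside \<open>M\<close>, so
  the coefficients of the projection of a dual vector lie in \<open>R\<close>.\<close>

lemma plane_proj_dual: "x \<in> dual_in W M \<Longrightarrow> plane_proj u w x \<in> M"
proof -
  assume x: "x \<in> dual_in W M"
  have R: "F u u \<in> R" "F w w \<in> R" "F u w \<in> R" using F_in_R[OF sr] u w by auto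
  then have inv: "inverse (F u u * F w w - (F u w)\<^sup>2) \<in> R" using D by (intro unit_inverse) auto
  then have "dual_vec u w \<in> M"
    unfolding dual_vec_def using R u w by (intro M_diff[OF sr] M_scale[OF sr])
  moreover have "dual_vec w u \<in> M"
    unfolding dual_vec_swap using inv R u w by (intro M_diff[OF sr] M_scale[OF sr])
  ultimately have "F x (dual_vec u w) \<in> R" "F x (dual_vec w u) \<in> R"
    using x by (auto simp: dual_in_def)
  then show ?thesis
    unfolding plane_proj_def using u w by (intro M_add[OF sr] M_scale[OF sr])
qed

lemma plane_proj_split:
  "semireg {x \<in> W. plane_proj u w x = 0} {x \<in> M. plane_proj u w x = 0} (y0 - plane_proj u w y0)"
  by (rule semireg_split[OF sr linear_plane_proj plane_proj_idem plane_proj_adjoint plane_proj_dual])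

text \<open>The exact drop by two gives both the decrease of the induction measure and the
  preservation of parity.\<close>

lemma dim_plane_complement: "dim W = dim {x \<in> W. plane_proj u w x = 0} + 2"
proof -
  let ?p = "plane_proj u w"
  let ?W = "{x \<in> W. ?p x = 0}"
  have sub: "subspace ?W" using sub_W[OF plane_proj_split] .
  have uw: "u \<in> W" "w \<in> W" using M_W[OF sr] u w by auto
  have D0: "F u u * F w w - (F u w)\<^sup>2 \<noteq> 0" using unit_nz[OF D] .
  have ne: "u \<noteq> w" using D0 by (auto simp: power2_eq_square)
  have ind: "independent {u, w}"
  proof -
    have "u \<notin> span {w}"
    proof
      assume "u \<in> span {w}"
      then obtain k where "u = k *s w" by (auto simp: span_singleton)
      then show False using D0 by (simp add: power2_eq_square algebra_simps)
    qed
    moreover have "w \<noteq> 0" using D0 by auto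
    ultimately show ?thesis using ne by (simp add: independent_insert)
  qed
  have p_span: "?p x \<in> span {u, w}" for x
    unfolding plane_proj_def by (intro span_add span_scale) (auto intro: span_base)
  have p_id: "?p x = x" if x: "x \<in> span {u, w}" for x
  proof -
    obtain a b where "x = a *s u + b *s w"
      using x by (auto simp: span_insert span_singleton) (metis diff_add_cancel add.commute)
    then show ?thesis
      by (simp add: lin_add[OF linear_plane_proj] lin_scale[OF linear_plane_proj] plane_proj_fixed)
  qed
  have sW: "span {u, w} \<subseteq> W" using span_minimal[OF _ sub_W[OF sr]] uw by simp
  have "{x + y |x y. x \<in> ?W \<and> y \<in> span {u, w}} = W"
  proof (intro Set.set_eqI iffI)
    fix x assume x: "x \<in> W"
    then have "x - ?p x \<in> ?W"
      using p_span sW subspace_diff[OF sub_W[OF sr]]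
      by (auto simp: lin_diff[OF linear_plane_proj] plane_proj_idem)
    then have "(x - ?p x) + ?p x \<in> {x + y |x y. x \<in> ?W \<and> y \<in> span {u, w}}"
      using p_span by blast
    then show "x \<in> {x + y |x y. x \<in> ?W \<and> y \<in> span {u, w}}" by simp
  qed (use sW subspace_add[OF sub_W[OF sr]] in blast)
  moreover have "?W \<inter> span {u, w} = {0}"
    using p_id span_zero subspace_0[OF sub] by auto
  ultimately have "dim W + dim {0::'v} = dim ?W + dim (span {u, w})"
    using dim_sums_Int[OF sub subspace_span, of "{u, w}"] by simp
  then show ?thesis
    using ind ne by (simp add: dim_eq_card_independent)
qed

end

text \<open>Planes on which \<open>F\<close> takes a unit value are split off until \<open>F\<close>
  maps \<open>M\<close> times \<open>M\<close> into \<open>P\<close>. If \<open>Q (2 y0)\<close>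
  were then in \<open>P\<close>, the generator \<open>y0\<close> would be divisible by
  \<open>\<pi>\<close> in the dual, and a unit would annihilate its class; but
  \<open>R / 2 R\<close> is nonzero because 2 lies in \<open>P\<close>.\<close>

lemma Q_double_generator_unit:
  assumes two: "2 \<in> P" and "semireg W M y0"
  shows "Q (2 *s y0) \<notin> P"
  using assms(2)
proof (induction "dim W" arbitrary: W M y0 rule: less_induct)
  case (less W M y0)
  note sr = less.prems
  have z: "2 *s y0 \<in> M" using scale_y0_iff[OF sr, of 2] R_one by force
  show ?case
  proof (cases "\<exists>u\<in>M. \<exists>w\<in>M. F u w \<notin> P")
    case True
    then obtain u w where uw: "u \<in> M" "w \<in> M" "F u w \<notin> P" by blast
    have FR: "F u w \<in> R" using F_in_R[OF sr] uw by blast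
    \<comment> \<open>Since \<open>F u u = 2 Q u\<close> is in \<open>P\<close>, the determinant is
      congruent to \<open>- (F u w)^2\<close>.\<close>
    have D: "F u u * F w w - (F u w)\<^sup>2 \<notin> P"
    proof
      assume a: "F u u * F w w - (F u w)\<^sup>2 \<in> P"
      have "2 * (Q u * F w w) \<in> P"
        using two M_even[OF sr] F_in_R[OF sr] uw by blast
      then have "F u u * F w w \<in> P" by (simp add: F_self mult.assoc)
      from P_diff[OF this a] have "F u w * F u w \<in> P" by (simp add: power2_eq_square)
      then show False using P_prime FR uw(3) by blast
    qed
    let ?p = "plane_proj u w"
    note split = plane_proj_split[OF sr uw(1,2) D]
    have "Q (2 *s (y0 - ?p y0)) \<notin> P"
      by (rule less.hyps[OF _ split]) (simp add: dim_plane_complement[OF sr uw(1,2) D])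
    \<comment> \<open>The two components of \<open>y0\<close> are orthogonal, and
      \<open>?p y0\<close> lies in \<open>M\<close>; the plane therefore contributes four times an
      element of \<open>R\<close>, which is in \<open>P\<close>.\<close>
    moreover have "Q (2 *s y0) = Q (2 *s (y0 - ?p y0)) + 2 * (2 * Q (?p y0))"
    proof -
      have "F (y0 - ?p y0) (?p y0) = 0"
        using plane_proj_adjoint[OF sr uw(1,2) D, of y0 "?p y0"]
          plane_proj_idem[OF sr uw(1,2) D, of y0] by simp
      then show ?thesis
        using Q_add[of "y0 - ?p y0" "?p y0"]
        by (simp only: Q_scale) (simp add: algebra_simps)
    qed
    moreover have "2 * (2 * Q (?p y0)) \<in> P"
      using two M_even[OF sr] plane_proj_dual[OF sr uw(1,2) D y0_dual[OF sr]] by blast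
    ultimately show ?thesis
      using P_diff[of "Q (2 *s y0)" "2 * (2 * Q (?p y0))"] by auto
  next
    case False
    show ?thesis
    proof
      assume Qz: "Q (2 *s y0) \<in> P"
      \<comment> \<open>In this case \<open>x\<close> divided by \<open>\<pi>\<close> is in the
        dual, hence of the form \<open>m + r y0\<close>. Then \<open>\<pi> r y0\<close> is in
        \<open>M\<close>, so \<open>\<pi> r = 2 s\<close>, and pairing \<open>2 s y0\<close> with
        \<open>y0\<close> gives \<open>s Q (2 y0)\<close>.\<close>
      have "F y0 x \<in> P" if x: "x \<in> M" for x
      proof -
        have "inverse \<pi> *s x \<in> dual_in W M"
          using False x M_W[OF sr] subspace_scale[OF sub_W[OF sr]]
          by (auto simp: dual_in_def simp flip: P_iff)
        then obtain r where r: "r \<in> R" "inverse \<pi> *s x - r *s y0 \<in> M"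
          using dual_gen[OF sr] by blast
        define m where "m = inverse \<pi> *s x - r *s y0"
        have xeq: "x = \<pi> *s m + (\<pi> * r) *s y0"
          using pi_nz by (simp add: m_def scale_right_diff_distrib)
        have "(\<pi> * r) *s y0 = x - \<pi> *s m" using xeq by simp
        then have "(\<pi> * r) *s y0 \<in> M"
          using M_diff[OF sr x M_scale[OF sr]] r P_R[OF pi_P] by (simp add: m_def)
        then obtain s where s: "s \<in> R" "\<pi> * r = 2 * s"
          using scale_y0_iff[OF sr, of "\<pi> * r"] r P_R[OF pi_P] by blast
        have "F y0 x = \<pi> * F y0 m + s * Q (2 *s y0)"
          unfolding xeq s(2) by (simp add: Q_scale F_self power2_eq_square)
        moreover have "F y0 m \<in> R" using y0_dual[OF sr] r(2) unfolding dual_in_def m_def by blast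
        ultimately show ?thesis using pi_P s Qz by auto
      qed
      \<comment> \<open>Writing this vector as \<open>r y0\<close> modulo \<open>M\<close> shows
        that \<open>1 - \<pi> r\<close> annihilates the class of \<open>y0\<close> and hence lies in
        \<open>2 R\<close>, which would put 1 into \<open>P\<close>.\<close>
      then have "inverse \<pi> *s y0 \<in> dual_in W M"
        using y0_dual[OF sr] subspace_scale[OF sub_W[OF sr]]
        by (auto simp: dual_in_def simp flip: P_iff)
      then obtain r where r: "r \<in> R" "inverse \<pi> *s y0 - r *s y0 \<in> M"
        using dual_gen[OF sr] by blast
      have "\<pi> *s (inverse \<pi> *s y0 - r *s y0) \<in> M"
        using M_scale[OF sr] r P_R[OF pi_P] by blast
      then have "(1 - \<pi> * r) *s y0 \<in> M"
        using pi_nz by (simp add: scale_right_diff_distrib scale_left_diff_distrib)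
      then obtain s where s: "s \<in> R" "1 - \<pi> * r = 2 * s"
        using scale_y0_iff[OF sr, of "1 - \<pi> * r"] r P_R[OF pi_P] by blast
      have "2 * s + \<pi> * r \<in> P" using two s r pi_P by blast
      then show False using s(2) one_notin_P by (metis diff_add_cancel)
    qed
  qed
qed

end

text \<open>The basis property is expressed as an expansion whose coefficients are values of
  \<open>F\<close>. In this form it can be inserted directly into \<open>Q\<close> and into products
  in the Clifford algebra.\<close>

definition hyperbolic_basis ::
  "('k::field \<Rightarrow> 'v::ab_group_add \<Rightarrow> 'v) \<Rightarrow> ('v \<Rightarrow> 'v \<Rightarrow> 'k) \<Rightarrow> 'v set \<Rightarrow>
   nat \<Rightarrow> (nat \<Rightarrow> 'v) \<Rightarrow> (nat \<Rightarrow> 'v) \<Rightarrow> 'v \<Rightarrow> bool" where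
  "hyperbolic_basis scale F W m e f g \<longleftrightarrow>
     (\<forall>i<m. e i \<in> W \<and> f i \<in> W \<and> F (e i) g = 0 \<and> F (f i) g = 0) \<and> g \<in> W \<and> F g g \<noteq> 0 \<and>
     (\<forall>i<m. \<forall>j<m. F (e i) (e j) = 0 \<and> F (f i) (f j) = 0 \<and> F (e i) (f j) = (if i = j then 1 else 0)) \<and>
     (\<forall>v\<in>W. v = (\<Sum>i<m. scale (F v (f i)) (e i) + scale (F v (e i)) (f i)) + scale (F v g / F g g) g)"

section \<open>Nearly isotropic vectors and hyperbolic planes\<close>

context quadratic_space
begin

text \<open>With 2 invertible \<open>R / 2 R\<close> is trivial, so the lattice is
  unimodular.\<close>

lemma dual_subset_if_two_unit:
  assumes two: "2 \<notin> P" and sr: "semireg W M y0" and y: "y \<in> dual_in W M"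
  shows "y \<in> M"
proof -
  obtain r where r: "r \<in> R" "y - r *s y0 \<in> M" using dual_gen[OF sr y] by blast
  have "r = 2 * (inverse 2 * r)" using two_nz by simp
  moreover have "inverse 2 * r \<in> R" by (rule R_mult[OF unit_inverse[OF R_two two] r(1)])
  ultimately have "r *s y0 \<in> M" using scale_y0_iff[OF sr r(1)] by blast
  from M_add[OF sr r(2) this] show ?thesis by simp
qed

text \<open>If \<open>Q\<close> maps \<open>M\<close> into \<open>P\<close>, so does
  \<open>F\<close> by polarisation; then \<open>M\<close>, being its own dual, is stable under
  division by \<open>\<pi>\<close> and must vanish.\<close>

lemma exists_unit_vector:
  assumes two: "2 \<notin> P" and sr: "semireg W M y0" and "W \<noteq> {0}"
  shows "\<exists>x\<in>M. Q x \<notin> P"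
proof (rule ccontr)
  assume no: "\<not> (\<exists>x\<in>M. Q x \<notin> P)"
  have "inverse \<pi> *s x \<in> M" if x: "x \<in> M" for x
  proof (rule dual_subset_if_two_unit[OF two sr])
    have "F x y \<in> P" if y: "y \<in> M" for y
    proof -
      have "F x y = Q (x + y) - Q x - Q y" by (simp add: Q_add)
      moreover have "Q (x + y) - Q x - Q y \<in> P" using no M_add[OF sr x y] x y by blast
      ultimately show ?thesis by simp
    qed
    then show "inverse \<pi> *s x \<in> dual_in W M"
      using x M_W[OF sr] subspace_scale[OF sub_W[OF sr]]
      by (auto simp: dual_in_def simp flip: P_iff)
  qed
  then have M0: "x = 0" if "x \<in> M" for x
    using divisible_eq_zero[OF sr order_refl] that by blast
  have "x = 0" if x: "x \<in> W" for x
  proof -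
    obtain r where "r \<noteq> 0" "r *s x \<in> M" using M_full[OF sr x] by blast
    then show ?thesis using M0[of "r *s x"] by simp
  qed
  then show False using \<open>W \<noteq> {0}\<close> subspace_0[OF sub_W[OF sr]] by blast
qed

context
  fixes W M y0 x
  assumes two: "2 \<notin> P" and sr: "semireg W M y0" and x: "x \<in> M" "Q x \<notin> P"
begin

lemma F_self_unit: "F x x \<notin> P"
  unfolding F_self using unit_mult[OF R_two two M_even[OF sr x(1)] x(2)] .

lemma line_proj_zero_iff: "line_proj x v = 0 \<longleftrightarrow> F v x = 0"
  using unit_nz[OF F_self_unit] by (auto simp: line_proj_def)

lemma line_proj_split:
  "semireg {v \<in> W. line_proj x v = 0} {v \<in> M. line_proj x v = 0} (y0 - line_proj x y0)"
proof (rule semireg_split[OF sr linear_line_proj])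
  show "line_proj x (line_proj x v) = line_proj x v" for v
    using unit_nz[OF F_self_unit] by (simp add: line_proj_def)
  show "F (line_proj x v) w = F v (line_proj x w)" for v w
    by (simp add: line_proj_def F_commute[of x w])
  show "line_proj x v \<in> M" if "v \<in> dual_in W M" for v
  proof -
    have "F v x \<in> R" using that x by (auto simp: dual_in_def)
    moreover have "inverse (F x x) \<in> R"
      using unit_inverse[OF F_in_R[OF sr x(1) x(1)] F_self_unit] .
    ultimately show ?thesis
      unfolding line_proj_def divide_inverse using M_scale[OF sr] x by blast
  qed
qed

lemma dim_line_complement: "dim W \<le> Suc (dim {v \<in> W. line_proj x v = 0})"
proof -
  have "v \<in> span (insert x {v \<in> W. line_proj x v = 0})" if "v \<in> W" for v
  proof -
    have pW: "line_proj x v \<in> W"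
      unfolding line_proj_def using subspace_scale[OF sub_W[OF sr]] M_W[OF sr x(1)] by blast
    have "line_proj x (v - line_proj x v) = 0"
      using unit_nz[OF F_self_unit] by (simp add: line_proj_def)
    then have "v - line_proj x v \<in> span (insert x {v \<in> W. line_proj x v = 0})"
      using subspace_diff[OF sub_W[OF sr] that pW] by (intro span_base) auto
    moreover have "line_proj x v \<in> span (insert x {v \<in> W. line_proj x v = 0})"
      unfolding line_proj_def by (intro span_scale span_base) auto
    ultimately show ?thesis
      using span_add by fastforce
  qed
  then have "dim W \<le> dim (insert x {v \<in> W. line_proj x v = 0})"
    by (intro dim_mono) blast
  also have "\<dots> \<le> Suc (dim {v \<in> W. line_proj x v = 0})"
    by (simp add: dim_insert)
  finally show ?thesis .
qed

end

text \<open>Splitting off vectors of unit length three times gives an orthogonal triple, and a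
  ternary diagonal form with unit coefficients represents 0 modulo \<open>P\<close>.\<close>

lemma nearly_isotropic_odd:
  assumes two: "2 \<notin> P" and sr: "semireg W M y0" and dim: "dim W \<ge> 3"
  shows "\<exists>v\<in>M. \<exists>w\<in>M. Q v \<in> P \<and> F v w \<notin> P"
proof -
  have ne: "U \<noteq> {0}" if "dim U > 0" for U using that by auto
  obtain x where x: "x \<in> M" "Q x \<notin> P"
    using exists_unit_vector[OF two sr ne] dim by auto
  let ?W1 = "{v \<in> W. line_proj x v = 0}" and ?M1 = "{v \<in> M. line_proj x v = 0}"
  note sr1 = line_proj_split[OF two sr x]
  have dim1: "dim ?W1 \<ge> 2" using dim_line_complement[OF two sr x] dim by simp
  obtain y where y: "y \<in> ?M1" "Q y \<notin> P"
    using exists_unit_vector[OF two sr1 ne] dim1 by auto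
  let ?W2 = "{v \<in> ?W1. line_proj y v = 0}" and ?M2 = "{v \<in> ?M1. line_proj y v = 0}"
  note sr2 = line_proj_split[OF two sr1 y]
  have dim2: "dim ?W2 \<ge> 1" using dim_line_complement[OF two sr1 y] dim1 by simp
  obtain z where z: "z \<in> ?M2" "Q z \<notin> P"
    using exists_unit_vector[OF two sr2 ne] dim2 by auto
  have o: "F y x = 0" "F z x = 0" "F z y = 0"
    using y z line_proj_zero_iff[OF two sr x] line_proj_zero_iff[OF two sr1 y] by auto
  have M: "y \<in> M" "z \<in> M" using y z by auto
  obtain s t where st: "s \<in> R" "t \<in> R" "Q x * s\<^sup>2 + Q y * t\<^sup>2 + Q z \<in> P"
    using conic_mod_P[OF two M_even[OF sr x(1)] x(2) M_even[OF sr M(1)] y(2) M_even[OF sr M(2)]]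
    by blast
  \<comment> \<open>The coefficient of \<open>z\<close> is kept equal to 1, so that
    \<open>F v z = F z z\<close> is a unit.\<close>
  define v where "v = (s *s x + t *s y) + z"
  have "v \<in> M" unfolding v_def by (intro M_add[OF sr] M_scale[OF sr] st x M)
  moreover have "Q v = Q x * s\<^sup>2 + Q y * t\<^sup>2 + Q z"
    using o by (simp add: v_def Q_add Q_scale F_commute[of x] F_commute[of y z] mult.commute)
  moreover have "F v z = F z z" using o by (simp add: v_def F_commute[of x z] F_commute[of y z])
  moreover have "F z z \<notin> P" using F_self_unit[OF two sr2 z] .
  ultimately show ?thesis using st(3) M by metis
qed

text \<open>A vector \<open>u\<close> exactly orthogonal to \<open>z\<close> has no cross term in
  \<open>Q (u + c z)\<close>, so a square root modulo \<open>P\<close> is all that is required. As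
  \<open>F w z\<close> always lies in \<open>2 R\<close>, the correction by \<open>c z\<close>
  leaves \<open>F u w\<close> unchanged modulo \<open>P\<close>.\<close>

lemma nearly_isotropic_even:
  assumes two: "2 \<in> P" and sr: "semireg W M y0" and dim: "dim W \<ge> 2"
  shows "\<exists>v\<in>M. \<exists>w\<in>M. Q v \<in> P \<and> F v w \<notin> P"
proof -
  define z where "z = 2 *s y0"
  have z: "z \<in> M" using scale_y0_iff[OF sr, of 2] R_one unfolding z_def by force
  have Qz: "Q z \<notin> P" using Q_double_generator_unit[OF two sr] by (simp add: z_def)
  have QzR: "Q z \<in> R" using M_even[OF sr z] .
  have Qz_inv: "inverse (Q z) \<in> R" "Q z \<noteq> 0" using unit_inverse[OF QzR Qz] unit_nz[OF Qz] by auto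
  have Fz: "\<exists>s\<in>R. F x z = 2 * s" if "x \<in> M" for x
    using y0_dual[OF sr] that by (auto simp: dual_in_def z_def F_commute[of x])
  have Fy0z: "F y0 z = Q z" by (simp add: z_def Q_scale F_self power2_eq_square)
  define A where "A = {x \<in> M. F x z = 0}"
  have "\<exists>x\<in>A. x \<noteq> 0"
  proof (rule ccontr)
    assume A0: "\<not> (\<exists>x\<in>A. x \<noteq> 0)"
    have "x \<in> span {z}" if x: "x \<in> M" for x
    proof -
      obtain s where s: "s \<in> R" "F x z = 2 * s" using Fz x by blast
      \<comment> \<open>The projection away from \<open>z\<close> stays in \<open>M\<close>: the
        factor 2 in \<open>F x z = 2 s\<close> cancels that in \<open>F z z = 2 Q z\<close>, and
        \<open>Q z\<close> is a unit. If \<open>A\<close> were zero, \<open>W\<close> would be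
        contained in a line.\<close>
      have "x - (s * inverse (Q z)) *s z \<in> A"
        using M_diff[OF sr x] M_scale[OF sr _ z] s Qz_inv by (auto simp: A_def F_self)
      then have "x = (s * inverse (Q z)) *s z" using A0 by auto
      then show ?thesis by (auto simp: span_singleton)
    qed
    then have "x \<in> span {z}" if x: "x \<in> W" for x
      using M_full[OF sr x] span_scale by (metis scale_scale left_inverse scale_one)
    then have "dim W \<le> dim {z}" by (intro dim_mono) blast
    also have "\<dots> \<le> 1" by simp
    finally show False using dim by simp
  qed
  then obtain u where u: "u \<in> A" "inverse \<pi> *s u \<notin> A"
    using divisible_eq_zero[OF sr, of A] by (auto simp: A_def)
  have uM: "u \<in> M" and uz: "F u z = 0" using u by (auto simp: A_def)
  \<comment> \<open>Otherwise \<open>u\<close> divided by \<open>\<pi>\<close> is in the dual and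
    equals \<open>r y0\<close> modulo \<open>M\<close>. Pairing with \<open>z\<close> shows that
    \<open>r Q z\<close> is in \<open>2 R\<close>, hence so is \<open>r\<close>; the quotient then
    lies in \<open>M\<close>, still orthogonal to \<open>z\<close>, against the choice of
    \<open>u\<close>.\<close>
  have "\<exists>w\<in>M. F u w \<notin> P"
  proof (rule ccontr)
    assume "\<not> (\<exists>w\<in>M. F u w \<notin> P)"
    then have "inverse \<pi> *s u \<in> dual_in W M"
      using uM M_W[OF sr] subspace_scale[OF sub_W[OF sr]]
      by (auto simp: dual_in_def simp flip: P_iff)
    then obtain r where r: "r \<in> R" "inverse \<pi> *s u - r *s y0 \<in> M" using dual_gen[OF sr] by blast
    obtain s where s: "s \<in> R" "F (inverse \<pi> *s u - r *s y0) z = 2 * s" using Fz r(2) by blast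
    then have "- (r * Q z) = 2 * s" using uz Fy0z by simp
    then have "r * Q z = 2 * (- s)" by (metis minus_minus mult_minus_right)
    then have "r = 2 * (- s * inverse (Q z))" using Qz_inv by (simp add: field_simps)
    moreover have "- s * inverse (Q z) \<in> R" using s Qz_inv by blast
    ultimately have "r *s y0 \<in> M" using scale_y0_iff[OF sr r(1)] by blast
    from M_add[OF sr r(2) this] have "inverse \<pi> *s u \<in> M" by simp
    then show False using u uz by (auto simp: A_def)
  qed
  then obtain w where w: "w \<in> M" "F u w \<notin> P" by blast
  obtain c where c: "c \<in> R" "c\<^sup>2 - - Q u * inverse (Q z) \<in> P"
    using square_root_mod_P[OF two, of "- Q u * inverse (Q z)"] M_even[OF sr uM] Qz_inv by blast
  define v where "v = u + c *s z"
  have "v \<in> M" unfolding v_def by (intro M_add[OF sr uM] M_scale[OF sr _ z] c)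
  moreover have "Q v \<in> P"
  proof -
    have "Q v = Q z * (c\<^sup>2 - - Q u * inverse (Q z))"
      using uz Qz_inv by (simp add: v_def Q_add Q_scale field_simps)
    then show ?thesis using c QzR by auto
  qed
  moreover have "F v w \<notin> P"
  proof
    assume "F v w \<in> P"
    moreover obtain s where s: "s \<in> R" "F w z = 2 * s" using Fz w by blast
    moreover have "2 * (c * s) \<in> P" using two c s by blast
    ultimately have "F v w - 2 * (c * s) \<in> P" by blast
    then show False using w(2) s(2) by (simp add: v_def F_commute[of z w])
  qed
  ultimately show ?thesis using w by blast
qed

text \<open>After scaling to \<open>F v w = 1\<close>, the equation \<open>Q (v + t w) = 0\<close>
  has linear coefficient 1 in \<open>t\<close>, which is the shape solved by
  \<open>hensel_quadratic\<close> without dividing by 2.\<close>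

lemma hyperbolic_pair:
  assumes sr: "semireg W M y0" and dim: "dim W \<ge> 3"
  shows "\<exists>e\<in>M. \<exists>f\<in>M. F e e = 0 \<and> F f f = 0 \<and> F e f = 1"
proof -
  obtain v w0 where v: "v \<in> M" "Q v \<in> P" and w0: "w0 \<in> M" "F v w0 \<notin> P"
    using nearly_isotropic_odd[OF _ sr dim] nearly_isotropic_even[OF _ sr] dim by fastforce
  define w where "w = inverse (F v w0) *s w0"
  have w: "w \<in> M" "F v w = 1"
    using M_scale[OF sr unit_inverse[OF F_in_R[OF sr v(1) w0(1)] w0(2)] w0(1)] unit_nz[OF w0(2)]
    by (auto simp: w_def)
  have QwR: "Q w \<in> R" using M_even[OF sr w(1)] .
  obtain t where t: "t \<in> P" "Q v + t + Q w * t\<^sup>2 = 0"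
    using hensel_quadratic[OF v(2) QwR] by blast
  define e where "e = v + t *s w"
  have e: "e \<in> M" unfolding e_def using M_add[OF sr v(1) M_scale[OF sr P_R[OF t(1)] w(1)]] .
  have Qe: "Q e = 0" using t(2) w(2) by (simp add: e_def Q_add Q_scale algebra_simps)
  \<comment> \<open>\<open>F e w = 1 + 2 t Q w\<close> with \<open>t\<close> in
    \<open>P\<close>.\<close>
  have "F e w \<notin> P"
  proof
    assume "F e w \<in> P"
    moreover have "t * (2 * Q w) \<in> P" using t QwR by blast
    ultimately have "F e w - t * (2 * Q w) \<in> P" by blast
    then show False using w(2) one_notin_P by (simp add: e_def F_self)
  qed
  define f' where "f' = inverse (F e w) *s w"
  have f': "f' \<in> M" "F e f' = 1"
    using M_scale[OF sr unit_inverse[OF F_in_R[OF sr e w(1)] \<open>F e w \<notin> P\<close>] w(1)]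
      unit_nz[OF \<open>F e w \<notin> P\<close>] by (auto simp: f'_def)
  \<comment> \<open>Because \<open>Q e = 0\<close> and \<open>F e f' = 1\<close>, adding
    \<open>c e\<close> to \<open>f'\<close> changes \<open>Q f'\<close> by exactly
    \<open>c\<close>.\<close>
  define f where "f = f' + (- Q f') *s e"
  have "f \<in> M" unfolding f_def using M_add[OF sr f'(1) M_scale[OF sr _ e]] M_even[OF sr f'(1)] by blast
  moreover have "Q f = 0" using f'(2) Qe unfolding f_def Q_add Q_scale by (simp add: F_commute[of f'])
  moreover have "F e f = 1" using f'(2) Qe F_self[of e] by (simp add: f_def)
  ultimately show ?thesis using e Qe by (auto simp: F_self)
qed

lemma semireg_hyperbolic_basis:
  assumes "semireg W M y0" "odd (dim W)"
  shows "\<exists>m e f g. hyperbolic_basis scale F W m e f g"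
  using assms
proof (induction "dim W" arbitrary: W M y0 rule: less_induct)
  case (less W M y0)
  note sr = less.prems(1)
  have odd_lt3: "n = 1" if "\<not> n \<ge> 3" "odd n" for n :: nat using that by presburger
  show ?case
  proof (cases "dim W \<ge> 3")
    case False
    then have d1: "dim W = 1" using less.prems(2) odd_lt3 by blast
    obtain B where B: "B \<subseteq> W" "independent B" "W \<subseteq> span B" "card B = dim W"
      using basis_exists by blast
    then obtain g where "B = {g}" using d1 by (metis card_1_singletonE)
    then have g: "g \<in> W" "\<And>v. v \<in> W \<Longrightarrow> \<exists>k. v = k *s g" "g \<noteq> 0"
      using B by (auto simp: span_singleton)
    have Fg: "F g g \<noteq> 0"
    proof
      assume "F g g = 0"
      then have "F g v = 0" if "v \<in> W" for v using g(2)[OF that] by auto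
      then show False using W_nondeg[OF sr g(1)] g(3) by blast
    qed
    have "v = (F v g / F g g) *s g" if "v \<in> W" for v using g(2)[OF that] Fg by auto
    then have "hyperbolic_basis scale F W 0 (\<lambda>_. 0) (\<lambda>_. 0) g"
      using g Fg by (simp add: hyperbolic_basis_def)
    then show ?thesis by blast
  next
    case True
    obtain a b where ab: "a \<in> M" "b \<in> M" "F a a = 0" "F b b = 0" "F a b = 1"
      using hyperbolic_pair[OF sr True] by blast
    \<comment> \<open>The Gram determinant of a hyperbolic pair is -1.\<close>
    have D: "F a a * F b b - (F a b)\<^sup>2 \<notin> P" using ab P_uminus[of "-1"] one_notin_P by auto
    let ?p = "plane_proj a b"
    let ?W = "{x \<in> W. ?p x = 0}"
    have p: "?p v = F v b *s a + F v a *s b" for v using ab by (simp add: plane_proj_def dual_vec_def F_commute[of b a])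
    note dimW = dim_plane_complement[OF sr ab(1,2) D]
    obtain m e f g where h: "hyperbolic_basis scale F ?W m e f g"
      using less.hyps[OF _ plane_proj_split[OF sr ab(1,2) D]] dimW less.prems(2) by auto
    have orth: "F x a = 0" "F x b = 0" if "x \<in> ?W" for x
    proof -
      have "?p x = 0" using that by simp
      then have "F (?p x) a = 0" "F (?p x) b = 0" by simp_all
      then show "F x a = 0" "F x b = 0" using ab by (simp_all add: p F_commute[of b a])
    qed
    have W: "e i \<in> ?W" "f i \<in> ?W" if "i < m" for i using h that by (auto simp: hyperbolic_basis_def)
    have gW: "g \<in> ?W" using h by (auto simp: hyperbolic_basis_def)
    have "hyperbolic_basis scale F W (Suc m) (e(m := a)) (f(m := b)) g"
    proof -
      have exp: "v = (\<Sum>i<Suc m. F v ((f(m := b)) i) *s (e(m := a)) i + F v ((e(m := a)) i) *s (f(m := b)) i)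
          + (F v g / F g g) *s g" if v: "v \<in> W" for v
      proof -
        have pW: "?p v \<in> W" unfolding p
          by (intro subspace_add[OF sub_W[OF sr]] subspace_scale[OF sub_W[OF sr]] M_W[OF sr] ab)
        define x where "x = v - ?p v"
        have x: "x \<in> ?W"
          using subspace_diff[OF sub_W[OF sr] v pW]
          by (simp add: x_def lin_diff[OF linear_plane_proj] plane_proj_idem[OF sr ab(1,2) D])
        have Fx: "F x y = F v y" if "y \<in> ?W" for y
          using orth[OF that] by (simp add: x_def p F_commute[of _ y])
        have "x = (\<Sum>i<m. F x (f i) *s e i + F x (e i) *s f i) + (F x g / F g g) *s g"
          using h x unfolding hyperbolic_basis_def by blast
        also have "\<dots> = (\<Sum>i<m. F v (f i) *s e i + F v (e i) *s f i) + (F v g / F g g) *s g"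
          using Fx W gW by simp
        finally have "v = (\<Sum>i<m. F v (f i) *s e i + F v (e i) *s f i) + (F v g / F g g) *s g + ?p v"
          unfolding x_def by (rule diff_eq_eq[THEN iffD1])
        then show ?thesis by (simp add: p algebra_simps)
      qed
      have "F a y = 0" "F b y = 0" if "y \<in> ?W" for y using orth[OF that] by (simp_all add: F_commute[of _ y])
      then show ?thesis
        unfolding hyperbolic_basis_def using exp
        by (intro conjI) (use h W gW ab orth M_W[OF sr] in
          \<open>auto simp: hyperbolic_basis_def less_Suc_eq\<close>)
    qed
    then show ?thesis by blast
  qed
qed

end

section \<open>From the isomorphism of discriminant modules to a generator\<close>

lemma coset_scale_coset:
  fixes N :: "'a::ab_group_add set"
  assumes zero: "0 \<in> N" and diff: "\<And>x y. x \<in> N \<Longrightarrow> y \<in> N \<Longrightarrow> x - y \<in> N"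
    and s: "\<And>x y. s r (x + y) = s r x + s r y" and sN: "\<And>x. x \<in> N \<Longrightarrow> s r x \<in> N"
  shows "coset_scale s N r (x +o N) = s r x +o N"
proof -
  have "s r (x + n) +o N = s r x +o N" if "n \<in> N" for n
    using sN[OF that] by (simp add: coset_eq_iff[OF zero diff] s)
  moreover have "x +o N = (+) x ` N" by (auto simp: elt_set_plus_def)
  ultimately show ?thesis
    using zero unfolding coset_scale_def by auto
qed

text \<open>The isomorphism enters through a preimage \<open>y0\<close> of the class of 1. By
  \<open>R\<close>-linearity the class of \<open>r y0\<close> goes to the class of \<open>r\<close>;
  injectivity then shows that \<open>y0\<close> generates the dual modulo \<open>L\<close> and that
  its annihilator is \<open>2 R\<close>.\<close>

lemma semi_regular_hyperbolic_basis:
  fixes scale :: "'k::field \<Rightarrow> 'v::ab_group_add \<Rightarrow> 'v"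
  assumes R: "complete_dvr R" and fin: "finite_residue_field R"
    and vs: "vector_space scale" and fd: "finite_dimensional scale"
    and form: "symmetric_bilinear_form scale F" and nd: "nondegenerate F"
    and srL: "semi_regular scale F R L"
  shows "(2::'k) \<noteq> 0 \<and> (\<exists>m e f g. hyperbolic_basis scale F UNIV m e f g)"
proof -
  obtain \<nu> where \<nu>: "discrete_valuation \<nu>" "R = valuation_ring \<nu>"
    "\<And>u. (\<forall>n. u n \<in> R) \<and> val_cauchy \<nu> u \<Longrightarrow> \<exists>l\<in>R. val_tendsto \<nu> u l"
    using R unfolding complete_dvr_def by blast
  obtain \<pi> where \<pi>: "\<pi> \<noteq> 0" "\<nu> \<pi> = 1"
    using \<nu>(1) unfolding discrete_valuation_def by blast
  interpret V: complete_valuation \<nu> R \<pi>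
    using \<nu> \<pi> fin by unfold_locales auto
  obtain Basis where "finite_dimensional_vector_space scale Basis"
    using fd unfolding finite_dimensional_def by blast
  then interpret finite_dimensional_vector_space scale Basis .
  obtain S where S: "finite S" "L = span_over scale R S"
    using srL unfolding semi_regular_def even_lattice_def is_lattice_def by blast
  obtain B where B: "B \<subseteq> L" "span B = UNIV"
    using srL unfolding semi_regular_def even_lattice_def is_lattice_def by blast
  have even: "quad F x \<in> R" if "x \<in> L" for x
    using srL that unfolding semi_regular_def even_lattice_def by blast
  let ?D = "dual_lattice F R L" and ?N = "(*) 2 ` R"
  obtain h where h: "bij_betw h (cosets ?D L) (cosets R ?N)"
    "\<And>r C. r \<in> R \<Longrightarrow> C \<in> cosets ?D L \<Longrightarrow> h (coset_scale scale L r C) = coset_scale (*) ?N r (h C)"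
    using srL unfolding semi_regular_def quotient_modules_iso_def by blast
  have L0: "0 \<in> L"
    unfolding S(2) span_over_def by (rule CollectI, rule exI[of _ "\<lambda>_. 0"]) auto
  have Ladd: "x + y \<in> L" if x: "x \<in> L" and y: "y \<in> L" for x y
  proof -
    obtain a b where ab: "x = (\<Sum>s\<in>S. scale (a s) s)" "a ` S \<subseteq> R" "y = (\<Sum>s\<in>S. scale (b s) s)" "b ` S \<subseteq> R"
      using x y unfolding S(2) span_over_def by blast
    have "x + y = (\<Sum>s\<in>S. scale (a s + b s) s)"
      by (simp add: ab sum.distrib scale_left_distrib)
    moreover have "(\<lambda>s. a s + b s) ` S \<subseteq> R" using ab by blast
    ultimately show ?thesis
      unfolding S(2) span_over_def by (intro CollectI exI[of _ "\<lambda>s. a s + b s"]) simp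
  qed
  have Lscale: "scale r x \<in> L" if r: "r \<in> R" and x: "x \<in> L" for r x
  proof -
    obtain a where a: "x = (\<Sum>s\<in>S. scale (a s) s)" "a ` S \<subseteq> R"
      using x unfolding S(2) span_over_def by blast
    have "scale r x = (\<Sum>s\<in>S. scale (r * a s) s)" by (simp add: a scale_sum_right)
    moreover have "(\<lambda>s. r * a s) ` S \<subseteq> R" using a r by blast
    ultimately show ?thesis
      unfolding S(2) span_over_def by (intro CollectI exI[of _ "\<lambda>s. r * a s"]) simp
  qed
  have Ldiff: "x - y \<in> L" if "x \<in> L" "y \<in> L" for x y
    using Ladd[OF that(1) Lscale[of "-1", OF _ that(2)]] by auto
  have full: "\<exists>r\<in>R. r \<noteq> 0 \<and> scale r x \<in> L" for x
  proof -
    \<comment> \<open>The denominators of the coordinates of \<open>x\<close> are cleared one basis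
      vector at a time.\<close>
    have "x \<in> span B" using B by simp
    then show ?thesis
    proof (induction rule: span_induct_alt)
      case base
      show ?case using L0 by (intro bexI[of _ 1]) auto
    next
      case (step c b y)
      obtain r where r: "r \<in> R" "r \<noteq> 0" "scale r y \<in> L" using step by blast
      obtain p q where pq: "p \<in> R" "q \<in> R" "q \<noteq> 0" "c = p / q"
        using complete_dvr_fraction_field[OF R] by blast
      have "scale (r * q) (scale c b + y) = scale (r * p) b + scale q (scale r y)"
        using pq by (simp add: scale_right_distrib mult.commute)
      moreover have "\<dots> \<in> L" using r pq step B by (intro Ladd[OF Lscale Lscale]) auto
      ultimately have "scale (r * q) (scale c b + y) \<in> L" by simp
      then show ?case using r pq by (intro bexI[of _ "r * q"]) auto
    qed
  qed
  have N0: "0 \<in> ?N" by (rule image_eqI[of _ _ 0]) auto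
  have Ndiff: "x - y \<in> ?N" if xy: "x \<in> ?N" "y \<in> ?N" for x y
  proof -
    obtain a b where "a \<in> R" "b \<in> R" "x = 2 * a" "y = 2 * b" using xy by blast
    then show ?thesis by (intro image_eqI[of _ _ "a - b"]) (auto simp: right_diff_distrib)
  qed
  have Nscale: "r * x \<in> ?N" if r: "r \<in> R" and x: "x \<in> ?N" for r x
  proof -
    obtain a where "a \<in> R" "x = 2 * a" using x by blast
    then show ?thesis using r by (intro image_eqI[of _ _ "r * a"]) auto
  qed
  have F_lin: "Vector_Spaces.linear scale (*) (F v)" and F_comm: "F v w = F w v" for v w
    using form by (auto simp: symmetric_bilinear_form_def)
  have F_scale: "F (scale r x) w = r * F x w" for r x w
    using lin_scale[OF F_lin, of w r x] by (simp only: F_comm[of _ w])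
  have Dscale: "scale r x \<in> ?D" if r: "r \<in> R" and x: "x \<in> ?D" for r x
    using x V.R_mult[OF r] by (auto simp: dual_lattice_def F_scale)
  have scaleL: "coset_scale scale L r (x +o L) = scale r x +o L" if "r \<in> R" for r x
    using L0 Ldiff Lscale[OF that] by (intro coset_scale_coset) (auto simp: scale_right_distrib)
  have scaleN: "coset_scale (*) ?N r (x +o ?N) = r * x +o ?N" if "r \<in> R" for r x
    using N0 Ndiff Nscale[OF that] by (intro coset_scale_coset) (auto simp: distrib_left)
  have "1 +o ?N \<in> h ` cosets ?D L"
    using bij_betw_imp_surj_on[OF h(1)] by (auto simp: cosets_def)
  then obtain y0 where y0: "y0 \<in> ?D" "h (y0 +o L) = 1 +o ?N"
    by (auto simp: cosets_def)
  have hr: "h (scale r y0 +o L) = r +o ?N" if "r \<in> R" for r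
    using h(2)[OF that, of "y0 +o L"] y0 by (simp add: scaleL[OF that] scaleN[OF that] cosets_def)
  have inj: "x - y \<in> L" if "x \<in> ?D" "y \<in> ?D" "h (x +o L) = h (y +o L)" for x y
  proof -
    have "x +o L = y +o L"
      using bij_betw_imp_inj_on[OF h(1)] that by (auto simp: inj_on_def cosets_def)
    then show ?thesis using coset_eq_iff[of L, OF L0 Ldiff] by blast
  qed
  have gen: "\<exists>r\<in>R. y - scale r y0 \<in> L" if y: "y \<in> ?D" for y
  proof -
    have "h (y +o L) \<in> cosets R ?N"
      using bij_betw_imp_surj_on[OF h(1)] y by (auto simp: cosets_def)
    then obtain r where "r \<in> R" "h (y +o L) = r +o ?N" by (auto simp: cosets_def)
    then show ?thesis using inj[OF y Dscale[OF _ y0(1)], of r] hr by auto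
  qed
  have iff: "scale r y0 \<in> L \<longleftrightarrow> (\<exists>s\<in>R. r = 2 * s)" if r: "r \<in> R" for r
  proof -
    have "scale r y0 \<in> L \<longleftrightarrow> scale r y0 +o L = scale 0 y0 +o L"
      by (subst coset_eq_iff[of L, OF L0 Ldiff]) simp_all
    also have "\<dots> \<longleftrightarrow> r +o ?N = 0 +o ?N"
      using hr[OF r] hr[OF V.R_zero] inj[OF Dscale[OF r y0(1)] Dscale[OF V.R_zero y0(1)]]
        coset_eq_iff[of L, OF L0 Ldiff] by metis
    also have "\<dots> \<longleftrightarrow> r \<in> ?N"
      by (subst coset_eq_iff[of ?N, OF N0 Ndiff]) simp_all
    finally show ?thesis by blast
  qed
  \<comment> \<open>If 2 were 0, the annihilator \<open>2 R\<close> would vanish, although some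
    nonzero multiple of \<open>y0\<close> lies in the full lattice \<open>L\<close>.\<close>
  have two: "(2::'k) \<noteq> 0"
  proof
    assume "(2::'k) = 0"
    moreover obtain r where "r \<in> R" "r \<noteq> 0" "scale r y0 \<in> L" using full by blast
    ultimately show False using iff by auto
  qed
  interpret quadratic_space \<nu> R \<pi> scale F Basis
    by unfold_locales (fact form two)+
  have "dual_in UNIV L = ?D"
    by (auto simp: dual_in_def dual_lattice_def)
  then have "semireg UNIV L y0"
    unfolding semireg_def using L0 Ladd Lscale full even nd y0(1) gen iff
    by (auto simp: nondegenerate_def)
  moreover have "odd (dim UNIV)"
    using srL unfolding semi_regular_def by blast
  ultimately show ?thesis
    using semireg_hyperbolic_basis two by blast
qed

section \<open>Algebras and matrix units\<close>

lemma (in abelian_monoid) finsum_swap: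
  assumes "finite A" "finite B" "\<And>i j. i \<in> A \<Longrightarrow> j \<in> B \<Longrightarrow> f i j \<in> carrier G"
  shows "(\<Oplus>i\<in>A. \<Oplus>j\<in>B. f i j) = (\<Oplus>j\<in>B. \<Oplus>i\<in>A. f i j)"
  using assms(1,3)
proof (induction A rule: finite_induct)
  case (insert a A)
  have "(\<Oplus>j\<in>B. \<Oplus>i\<in>insert a A. f i j) = (\<Oplus>j\<in>B. f a j \<oplus> (\<Oplus>i\<in>A. f i j))"
    using insert by (intro finsum_cong') (auto simp: Pi_def)
  also have "\<dots> = (\<Oplus>j\<in>B. f a j) \<oplus> (\<Oplus>j\<in>B. \<Oplus>i\<in>A. f i j)"
    using insert by (intro finsum_addf) (auto simp: Pi_def)
  finally show ?case
    using insert by (simp add: Pi_def)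
qed simp

lemma (in abelian_monoid) finsum_single:
  assumes "finite A" "i \<in> A" "x \<in> carrier G" "\<And>j. j \<in> A \<Longrightarrow> f j = (if j = i then x else \<zero>)"
  shows "(\<Oplus>j\<in>A. f j) = x"
proof -
  have "(\<Oplus>j\<in>A. f j) = (\<Oplus>j\<in>A. if i = j then x else \<zero>)"
    using assms by (intro finsum_cong') auto
  then show ?thesis
    using add.finprod_singleton[of i A "\<lambda>_. x"] assms by simp
qed

text \<open>The index \<open>i * b + j\<close> is the block numbering used both for products of
  matrix units and for matrices of matrices.\<close>

lemma (in abelian_monoid) finsum_lessThan_mult:
  fixes f :: "nat \<Rightarrow> 'a"
  assumes "\<And>p. p < a * b \<Longrightarrow> f p \<in> carrier G"
  shows "(\<Oplus>p\<in>{..<a * b}. f p) = (\<Oplus>i\<in>{..<a}. \<Oplus>j\<in>{..<b}. f (i * b + j))"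
  using assms
proof (induction a)
  case (Suc a)
  have c: "f (i * b + j) \<in> carrier G" if "i \<le> a" "j < b" for i j
  proof (rule Suc.prems)
    have "i * b + j < i * b + b" using that by simp
    also have "\<dots> \<le> Suc a * b" using mult_le_mono1[of "Suc i" "Suc a" b] that by simp
    finally show "i * b + j < Suc a * b" .
  qed
  have un: "{..<Suc a * b} = {..<a * b} \<union> (\<lambda>j. a * b + j) ` {..<b}"
  proof (intro equalityI subsetI)
    fix p assume "p \<in> {..<Suc a * b}"
    then show "p \<in> {..<a * b} \<union> (\<lambda>j. a * b + j) ` {..<b}"
      by (cases "p < a * b") (auto intro!: image_eqI[of _ _ "p - a * b"])
  qed auto
  have "(\<Oplus>p\<in>{..<Suc a * b}. f p) = (\<Oplus>p\<in>{..<a * b}. f p) \<oplus> (\<Oplus>p\<in>(\<lambda>j. a * b + j) ` {..<b}. f p)"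
    unfolding un using Suc.prems c by (intro finsum_Un_disjoint) auto
  also have "(\<Oplus>p\<in>(\<lambda>j. a * b + j) ` {..<b}. f p) = (\<Oplus>j\<in>{..<b}. f (a * b + j))"
    using c by (subst finsum_reindex) (auto simp: inj_on_def)
  also have "(\<Oplus>p\<in>{..<a * b}. f p) = (\<Oplus>i\<in>{..<a}. \<Oplus>j\<in>{..<b}. f (i * b + j))"
    using Suc by simp
  also have "\<dots> \<oplus> (\<Oplus>j\<in>{..<b}. f (a * b + j)) = (\<Oplus>i\<in>{..<Suc a}. \<Oplus>j\<in>{..<b}. f (i * b + j))"
    using c by (subst lessThan_Suc, subst finsum_insert) (auto simp: Pi_def intro!: a_comm finsum_closed)
  finally show ?case .
qed simp

lemma type_ring_simps [simp]:
  "carrier (ring_of_type_algebra :: 'k::comm_ring_1 ring) = UNIV"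
  "monoid.mult (ring_of_type_algebra :: 'k ring) = (*)"
  "one (ring_of_type_algebra :: 'k ring) = 1"
  "add (ring_of_type_algebra :: 'k ring) = (+)"
  by (simp_all add: ring_of_type_algebra_def fun_eq_iff)

section \<open>Algebras over a field, subalgebras and commutation rules\<close>

locale kalg =
  fixes A :: "('k::field, 'a) module" (structure)
  assumes k_algebra: "k_algebra A"

sublocale kalg \<subseteq> ring A
  using k_algebra by (simp add: k_algebra_def)

context kalg
begin

lemma is_module: "Module.module (ring_of_type_algebra :: 'k ring) A"
  using k_algebra by (simp add: k_algebra_def)

lemma smult_closed [simp, intro]: "x \<in> carrier A \<Longrightarrow> a \<odot> x \<in> carrier A"
  using module.smult_closed[OF is_module] by simp

lemma smult_l_distr: "x \<in> carrier A \<Longrightarrow> (a + b) \<odot> x = a \<odot> x \<oplus> b \<odot> x"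
  using module.smult_l_distr[OF is_module] by simp

lemma smult_r_distr: "x \<in> carrier A \<Longrightarrow> y \<in> carrier A \<Longrightarrow> a \<odot> (x \<oplus> y) = a \<odot> x \<oplus> a \<odot> y"
  using module.smult_r_distr[OF is_module] by simp

lemma smult_smult: "x \<in> carrier A \<Longrightarrow> a \<odot> (b \<odot> x) = (a * b) \<odot> x"
  using module.smult_assoc1[OF is_module] by simp

lemma smult_one [simp]: "x \<in> carrier A \<Longrightarrow> 1 \<odot> x = x"
  using module.smult_one[OF is_module] by simp

lemma smult_mult_l: "x \<in> carrier A \<Longrightarrow> y \<in> carrier A \<Longrightarrow> (a \<odot> x) \<otimes> y = a \<odot> (x \<otimes> y)"
  and smult_mult_r: "x \<in> carrier A \<Longrightarrow> y \<in> carrier A \<Longrightarrow> x \<otimes> (a \<odot> y) = a \<odot> (x \<otimes> y)"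
  using k_algebra by (simp_all add: k_algebra_def)

lemma smult_zero_l [simp]: "x \<in> carrier A \<Longrightarrow> 0 \<odot> x = \<zero>"
  using smult_l_distr[of x 0 0] by (simp add: add.l_cancel_one')

lemma smult_zero_r [simp]: "a \<odot> \<zero> = \<zero>"
  using smult_smult[of \<zero> a 0] by simp

lemma smult_neg: "x \<in> carrier A \<Longrightarrow> (- a) \<odot> x = \<ominus> (a \<odot> x)"
  using smult_l_distr[of x "- a" a] by (simp add: minus_equality)

lemma finsum_smult:
  "finite I \<Longrightarrow> f \<in> I \<rightarrow> carrier A \<Longrightarrow> a \<odot> (\<Oplus>i\<in>I. f i) = (\<Oplus>i\<in>I. a \<odot> f i)"
  using module.finsum_smult_ldistr[OF is_module] by simp

lemma finsum_scalars:
  "finite I \<Longrightarrow> x \<in> carrier A \<Longrightarrow> (\<Sum>i\<in>I. a i) \<odot> x = (\<Oplus>i\<in>I. a i \<odot> x)"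
  by (induction I rule: finite_induct) (auto simp: smult_l_distr)

definition subalg :: "'a set \<Rightarrow> bool" where
  "subalg S \<longleftrightarrow> S \<subseteq> carrier A \<and> \<one> \<in> S \<and> (\<forall>x\<in>S. \<forall>y\<in>S. x \<oplus> y \<in> S) \<and>
     (\<forall>x\<in>S. \<forall>y\<in>S. x \<otimes> y \<in> S) \<and> (\<forall>a. \<forall>x\<in>S. a \<odot> x \<in> S)"

lemma subalgD:
  assumes "subalg S"
  shows "\<And>x. x \<in> S \<Longrightarrow> x \<in> carrier A" "\<one> \<in> S" "\<And>x y. x \<in> S \<Longrightarrow> y \<in> S \<Longrightarrow> x \<oplus> y \<in> S"
    "\<And>x y. x \<in> S \<Longrightarrow> y \<in> S \<Longrightarrow> x \<otimes> y \<in> S" "\<And>a x. x \<in> S \<Longrightarrow> a \<odot> x \<in> S" "\<zero> \<in> S"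
    "\<And>x. x \<in> S \<Longrightarrow> \<ominus> x \<in> S" "\<And>x y. x \<in> S \<Longrightarrow> y \<in> S \<Longrightarrow> x \<ominus> y \<in> S"
proof -
  show c: "\<And>x. x \<in> S \<Longrightarrow> x \<in> carrier A" and o: "\<one> \<in> S"
    and a: "\<And>x y. x \<in> S \<Longrightarrow> y \<in> S \<Longrightarrow> x \<oplus> y \<in> S"
    and "\<And>x y. x \<in> S \<Longrightarrow> y \<in> S \<Longrightarrow> x \<otimes> y \<in> S" and s: "\<And>a x. x \<in> S \<Longrightarrow> a \<odot> x \<in> S"
    using assms unfolding subalg_def by auto
  show "\<zero> \<in> S" using s[OF o, of 0] by simp
  show m: "\<And>x. x \<in> S \<Longrightarrow> \<ominus> x \<in> S" using s[of _ "-1"] c by (fastforce simp: smult_neg)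
  show "\<And>x y. x \<in> S \<Longrightarrow> y \<in> S \<Longrightarrow> x \<ominus> y \<in> S" using a m by (simp add: minus_eq)
qed

lemma subalg_finsum:
  assumes "subalg S" "finite I" "\<And>i. i \<in> I \<Longrightarrow> f i \<in> S"
  shows "(\<Oplus>i\<in>I. f i) \<in> S"
  using assms(2,3)
  by (induction I rule: finite_induct) (auto simp: Pi_def subalgD[OF assms(1)])

lemma subalg_k_algebra:
  assumes "subalg S"
  shows "k_algebra (A\<lparr>carrier := S\<rparr>)"
proof -
  note D = subalgD[OF assms]
  have "subring S A" using D by (intro subringI) auto
  then have r: "ring (A\<lparr>carrier := S\<rparr>)" by (rule subring_is_ring)
  then interpret S: ring "A\<lparr>carrier := S\<rparr>" .
  have "Module.module (ring_of_type_algebra :: 'k ring) (A\<lparr>carrier := S\<rparr>)"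
    by (rule moduleI[OF cring_from_type_algebra S.abelian_group_axioms])
      (use D in \<open>simp_all add: smult_l_distr smult_r_distr smult_smult\<close>)
  then show ?thesis
    unfolding k_algebra_def using r D by (simp add: smult_mult_l smult_mult_r)
qed

definition commutes :: "'a \<Rightarrow> 'a \<Rightarrow> bool" where
  "commutes x y \<longleftrightarrow> x \<otimes> y = y \<otimes> x"

definition anticommutes :: "'a \<Rightarrow> 'a \<Rightarrow> bool" where
  "anticommutes x y \<longleftrightarrow> x \<otimes> y = \<ominus> (y \<otimes> x)"

context
  fixes x y z
  assumes xyz: "x \<in> carrier A" "y \<in> carrier A" "z \<in> carrier A"
begin

lemma commutes_mult: "commutes x y \<Longrightarrow> commutes x z \<Longrightarrow> commutes x (y \<otimes> z)"
  unfolding commutes_def using xyz by (metis m_assoc)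

lemma commutes_mult_anti: "anticommutes x y \<Longrightarrow> anticommutes x z \<Longrightarrow> commutes x (y \<otimes> z)"
proof -
  assume a: "anticommutes x y" "anticommutes x z"
  have "x \<otimes> (y \<otimes> z) = \<ominus> (y \<otimes> x) \<otimes> z" using xyz a by (simp add: anticommutes_def flip: m_assoc)
  also have "\<dots> = \<ominus> (y \<otimes> (x \<otimes> z))" using xyz by (simp add: l_minus m_assoc)
  also have "\<dots> = (y \<otimes> z) \<otimes> x" using xyz a by (simp add: anticommutes_def r_minus m_assoc)
  finally show ?thesis by (simp add: commutes_def)
qed

lemma anticommutes_mult: "anticommutes x y \<Longrightarrow> commutes x z \<Longrightarrow> anticommutes x (y \<otimes> z)"
proof -
  assume a: "anticommutes x y" "commutes x z"
  have "x \<otimes> (y \<otimes> z) = \<ominus> (y \<otimes> x) \<otimes> z" using xyz a by (simp add: anticommutes_def flip: m_assoc)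
  also have "\<dots> = \<ominus> (y \<otimes> (x \<otimes> z))" using xyz by (simp add: l_minus m_assoc)
  also have "\<dots> = \<ominus> ((y \<otimes> z) \<otimes> x)" using xyz a by (simp add: commutes_def m_assoc)
  finally show ?thesis by (simp add: anticommutes_def)
qed

lemma commutes_mult_left: "commutes y x \<Longrightarrow> commutes z x \<Longrightarrow> commutes (y \<otimes> z) x"
  using commutes_mult by (simp add: commutes_def)

lemma commutes_diff: "commutes x y \<Longrightarrow> commutes x z \<Longrightarrow> commutes x (y \<ominus> z)"
  unfolding commutes_def using xyz by (simp add: minus_eq r_distr l_distr r_minus l_minus)

end

lemma commutes_smult: "x \<in> carrier A \<Longrightarrow> y \<in> carrier A \<Longrightarrow> commutes x y \<Longrightarrow> commutes x (a \<odot> y)"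
  by (simp add: commutes_def smult_mult_l smult_mult_r)

lemma commutes_sym: "commutes x y \<Longrightarrow> commutes y x"
  by (simp add: commutes_def)

text \<open>Vanishing units are still permitted here; they are excluded in
  \<open>unit_nonzero\<close>, once 1 is known to differ from 0.\<close>

definition matrix_units :: "nat \<Rightarrow> (nat \<Rightarrow> nat \<Rightarrow> 'a) \<Rightarrow> bool" where
  "matrix_units N E \<longleftrightarrow> (\<forall>i<N. \<forall>j<N. E i j \<in> carrier A) \<and>
     (\<forall>i<N. \<forall>j<N. \<forall>k<N. \<forall>l<N. E i j \<otimes> E k l = (if j = k then E i l else \<zero>)) \<and>
     (\<Oplus>i\<in>{..<N}. E i i) = \<one>"

text \<open>Commuting systems multiply independently, as in a Kronecker product: the index
  \<open>p\<close> stands for the pair \<open>(p div N, p mod N)\<close>.\<close>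

lemma matrix_units_tensor:
  assumes E: "matrix_units M E" and G: "matrix_units N G"
    and comm: "\<And>i j k l. i < M \<Longrightarrow> j < M \<Longrightarrow> k < N \<Longrightarrow> l < N \<Longrightarrow> commutes (E i j) (G k l)"
  shows "matrix_units (M * N) (\<lambda>p q. E (p div N) (q div N) \<otimes> G (p mod N) (q mod N))"
proof -
  have Ec: "E i j \<in> carrier A" if "i < M" "j < M" for i j using E that by (simp add: matrix_units_def)
  have Gc: "G i j \<in> carrier A" if "i < N" "j < N" for i j using G that by (simp add: matrix_units_def)
  have b: "p div N < M" "p mod N < N" if p: "p < M * N" for p
  proof -
    have "N > 0" using p by (cases N) auto
    then show "p div N < M" "p mod N < N" using p by (auto simp: less_mult_imp_div_less)
  qed
  have m: "(E i j \<otimes> G a b) \<otimes> (E k l \<otimes> G c d) = (if j = k \<and> b = c then E i l \<otimes> G a d else \<zero>)"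
    if "i < M" "j < M" "k < M" "l < M" "a < N" "b < N" "c < N" "d < N" for i j k l a b c d
  proof -
    have "(E i j \<otimes> G a b) \<otimes> (E k l \<otimes> G c d) = E i j \<otimes> (G a b \<otimes> E k l) \<otimes> G c d"
      using that Ec Gc by (simp add: m_assoc)
    also have "G a b \<otimes> E k l = E k l \<otimes> G a b" using comm[of k l a b] that by (simp add: commutes_def)
    also have "E i j \<otimes> (E k l \<otimes> G a b) \<otimes> G c d = (E i j \<otimes> E k l) \<otimes> (G a b \<otimes> G c d)"
      using that Ec Gc by (simp add: m_assoc)
    also have "\<dots> = (if j = k \<and> b = c then E i l \<otimes> G a d else \<zero>)"
      using E G that Ec Gc by (simp add: matrix_units_def)
    finally show ?thesis .
  qed
  have eq: "j div N = k div N \<and> j mod N = k mod N \<longleftrightarrow> j = k" for j k :: nat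
    by (metis div_mult_mod_eq)
  have "(\<Oplus>p\<in>{..<M * N}. E (p div N) (p div N) \<otimes> G (p mod N) (p mod N)) =
      (\<Oplus>i\<in>{..<M}. \<Oplus>j\<in>{..<N}. E ((i * N + j) div N) ((i * N + j) div N) \<otimes> G ((i * N + j) mod N) ((i * N + j) mod N))"
    by (rule finsum_lessThan_mult) (use b Ec Gc in auto)
  also have "\<dots> = (\<Oplus>i\<in>{..<M}. \<Oplus>j\<in>{..<N}. E i i \<otimes> G j j)"
    using Ec Gc by (intro finsum_cong') (auto intro!: finsum_cong' simp: Pi_def)
  also have "\<dots> = (\<Oplus>i\<in>{..<M}. E i i \<otimes> \<one>)"
    using Ec Gc G by (intro finsum_cong') (auto simp: Pi_def matrix_units_def simp flip: finsum_rdistr)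
  also have "\<dots> = \<one>"
    using Ec E by (simp add: matrix_units_def flip: finsum_ldistr cong: finsum_cong')
  finally show ?thesis
    unfolding matrix_units_def using b Ec Gc by (auto simp: m eq)
qed

end

section \<open>Matrix units from commuting pairs\<close>

context kalg
begin

text \<open>These are the relations of the 2 x 2 matrix units \<open>E 0 1\<close> and
  \<open>E 1 0\<close>, and also those of two isotropic vectors with pairing 1 in a Clifford
  algebra.\<close>

definition unit_pair :: "'a \<Rightarrow> 'a \<Rightarrow> bool" where
  "unit_pair x y \<longleftrightarrow> x \<in> carrier A \<and> y \<in> carrier A \<and> x \<otimes> x = \<zero> \<and> y \<otimes> y = \<zero> \<and>
     x \<otimes> y \<oplus> y \<otimes> x = \<one>"

definition pair_units :: "'a \<Rightarrow> 'a \<Rightarrow> nat \<Rightarrow> nat \<Rightarrow> 'a" where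
  "pair_units x y i j = (if i = 0 then if j = 0 then x \<otimes> y else x else if j = 0 then y else y \<otimes> x)"

text \<open>Multiplying \<open>x y + y x = 1\<close> by \<open>x\<close> or by \<open>y\<close> on
  the left removes one of the two terms.\<close>

lemma unit_pair_absorb:
  assumes "unit_pair x y"
  shows "x \<otimes> (y \<otimes> x) = x" "y \<otimes> (x \<otimes> y) = y"
proof -
  have c: "x \<in> carrier A" "y \<in> carrier A" "x \<otimes> x = \<zero>" "y \<otimes> y = \<zero>" "x \<otimes> y \<oplus> y \<otimes> x = \<one>"
    using assms unfolding unit_pair_def by blast+
  have "x \<otimes> (x \<otimes> y \<oplus> y \<otimes> x) = x" "y \<otimes> (x \<otimes> y \<oplus> y \<otimes> x) = y"
    using c by simp_all
  moreover have "x \<otimes> (x \<otimes> y) = \<zero>" "y \<otimes> (y \<otimes> x) = \<zero>"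
    using c by (metis m_assoc l_null)+
  ultimately show "x \<otimes> (y \<otimes> x) = x" "y \<otimes> (x \<otimes> y) = y"
    using c(1,2) by (simp_all add: r_distr)
qed

lemma matrix_units_pair:
  assumes "unit_pair x y"
  shows "matrix_units 2 (pair_units x y)"
proof -
  have c: "x \<in> carrier A" "y \<in> carrier A" "x \<otimes> x = \<zero>" "y \<otimes> y = \<zero>" "x \<otimes> y \<oplus> y \<otimes> x = \<one>"
    using assms unfolding unit_pair_def by blast+
  have z: "x \<otimes> (x \<otimes> w) = \<zero>" "y \<otimes> (y \<otimes> w) = \<zero>" if "w \<in> carrier A" for w
    using c that by (metis m_assoc l_null)+
  have a: "x \<otimes> (y \<otimes> (x \<otimes> w)) = x \<otimes> w" "y \<otimes> (x \<otimes> (y \<otimes> w)) = y \<otimes> w" if "w \<in> carrier A" for w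
    using unit_pair_absorb[OF assms] c that by (metis m_assoc m_closed)+
  have 2: "{..<2::nat} = {0, 1}" by auto
  show ?thesis
    unfolding matrix_units_def
    using c unit_pair_absorb[OF assms]
    by (auto simp: pair_units_def less_2_cases_iff m_assoc z a 2)
qed

text \<open>The clause on elements \<open>z\<close> is what carries the induction: it makes the next
  pair commute with the units built so far, so that the two systems can be multiplied. The clause on
  subalgebras records that the pairs can be recovered from the units.\<close>

lemma units_of_commuting_pairs:
  fixes u v :: "nat \<Rightarrow> 'a"
  assumes pairs: "\<And>i. i < m \<Longrightarrow> unit_pair (u i) (v i)"
    and comm: "\<And>i j. i < m \<Longrightarrow> j < m \<Longrightarrow> i \<noteq> j \<Longrightarrow>
      commutes (u i) (u j) \<and> commutes (u i) (v j) \<and> commutes (v i) (v j)"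
    and "k \<le> m"
  shows "\<exists>E. matrix_units (2 ^ k) E \<and>
    (\<forall>z\<in>carrier A. (\<forall>i<k. commutes z (u i) \<and> commutes z (v i)) \<longrightarrow>
       (\<forall>i<2 ^ k. \<forall>j<2 ^ k. commutes z (E i j))) \<and>
    (\<forall>S. subalg S \<longrightarrow> (\<forall>i<2 ^ k. \<forall>j<2 ^ k. E i j \<in> S) \<longrightarrow> (\<forall>i<k. u i \<in> S \<and> v i \<in> S))"
  using \<open>k \<le> m\<close>
proof (induction k)
  case 0
  show ?case
    by (rule exI[of _ "\<lambda>_ _. \<one>"]) (simp add: matrix_units_def commutes_def lessThan_Suc)
next
  case (Suc k)
  from Suc.IH[OF Suc_leD[OF Suc.prems]] obtain E where E: "matrix_units (2 ^ k) E"
    and cent': "\<forall>z\<in>carrier A. (\<forall>i<k. commutes z (u i) \<and> commutes z (v i)) \<longrightarrow>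
       (\<forall>i<2 ^ k. \<forall>j<2 ^ k. commutes z (E i j))"
    and gen': "\<forall>S. subalg S \<longrightarrow> (\<forall>i<2 ^ k. \<forall>j<2 ^ k. E i j \<in> S) \<longrightarrow> (\<forall>i<k. u i \<in> S \<and> v i \<in> S)"
    by (elim exE conjE)
  have cent: "commutes z (E i j)"
    if "z \<in> carrier A" "\<forall>i<k. commutes z (u i) \<and> commutes z (v i)" "i < 2 ^ k" "j < 2 ^ k" for z i j
    using cent' that by simp
  have gen: "u i \<in> S \<and> v i \<in> S" if "subalg S" "\<forall>i<2 ^ k. \<forall>j<2 ^ k. E i j \<in> S" "i < k" for S i
    using gen' that by simp
  define G where "G = pair_units (u k) (v k)"
  have p: "unit_pair (u k) (v k)" using pairs Suc.prems by simp
  have uv: "u i \<in> carrier A" "v i \<in> carrier A" if "i < m" for i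
    using pairs[OF that] by (simp_all add: unit_pair_def)
  have km: "k < m" using Suc.prems by simp
  have G: "matrix_units 2 G" unfolding G_def by (rule matrix_units_pair[OF p])
  have Ec: "E i j \<in> carrier A" if "i < 2 ^ k" "j < 2 ^ k" for i j
    using E that by (simp add: matrix_units_def)
  have Gc: "G i j \<in> carrier A" if "i < 2" "j < 2" for i j
    using G that by (simp add: matrix_units_def)
  have zG: "commutes z (G a b)" if "z \<in> carrier A" "commutes z (u k)" "commutes z (v k)" for z a b
    using that uv[OF km] by (simp add: G_def pair_units_def commutes_mult)
  have EG: "commutes (E i j) (G a b)" if "i < 2 ^ k" "j < 2 ^ k" "a < 2" "b < 2" for i j a b
  proof -
    have "commutes (G a b) (u l) \<and> commutes (G a b) (v l)" if l: "l < k" for l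
    proof -
      have lm: "l < m" "l \<noteq> k" using l km by auto
      have "commutes (u l) (G a b)" "commutes (v l) (G a b)"
        using zG[OF uv(1)[OF lm(1)]] zG[OF uv(2)[OF lm(1)]] comm[OF lm(1) km lm(2)]
          comm[OF km lm(1) lm(2)[symmetric]] commutes_sym by blast+
      then show ?thesis by (auto intro: commutes_sym)
    qed
    then show ?thesis using cent[OF Gc] that by (auto intro: commutes_sym)
  qed
  define E' where "E' p q = E (p div 2) (q div 2) \<otimes> G (p mod 2) (q mod 2)" for p q
  have E': "matrix_units (2 ^ Suc k) E'"
    using matrix_units_tensor[OF E G EG] by (simp add: E'_def[abs_def] mult.commute)
  have bound: "p div 2 < 2 ^ k" if "p < 2 ^ Suc k" for p :: nat
    using that by (simp add: less_mult_imp_div_less mult.commute)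
  show ?case
  proof (intro exI[of _ E'] conjI E' ballI allI impI)
    fix z and i j :: nat assume z: "z \<in> carrier A" "\<forall>i<Suc k. commutes z (u i) \<and> commutes z (v i)"
      and ij: "i < 2 ^ Suc k" "j < 2 ^ Suc k"
    show "commutes z (E' i j)"
      unfolding E'_def using z ij bound Ec Gc
      by (intro commutes_mult cent zG) auto
  next
    fix S i assume S: "subalg S" "\<forall>i<2 ^ Suc k. \<forall>j<2 ^ Suc k. E' i j \<in> S" and i: "i < Suc k"
    \<comment> \<open>The diagonal units of each factor add up to 1. Summing products over the
      diagonal of one factor gives back the other, here \<open>E\<close> and afterwards
      \<open>G\<close>.\<close>
    have ES: "E i j \<in> S" if "i < 2 ^ k" "j < 2 ^ k" for i j
    proof -
      have "E i j = E i j \<otimes> (G 0 0 \<oplus> G 1 1)"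
        using p Ec[OF that] by (simp add: G_def pair_units_def unit_pair_def)
      also have "\<dots> = E' (2 * i) (2 * j) \<oplus> E' (2 * i + 1) (2 * j + 1)"
        using Ec[OF that] Gc by (simp add: E'_def r_distr)
      also have "\<dots> \<in> S" using S that by (intro subalgD(3)[OF S(1)]) auto
      finally show ?thesis .
    qed
    have GS: "G a b \<in> S" if "a < 2" "b < 2" for a b
    proof -
      have "G a b = (\<Oplus>i\<in>{..<2 ^ k}. E i i) \<otimes> G a b"
        using E Gc[OF that] by (simp add: matrix_units_def)
      also have "\<dots> = (\<Oplus>i\<in>{..<2 ^ k}. E i i \<otimes> G a b)"
        using Ec Gc[OF that] by (intro finsum_ldistr) auto
      also have "\<dots> = (\<Oplus>i\<in>{..<2 ^ k}. E' (2 * i + a) (2 * i + b))"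
        using that Ec Gc by (intro finsum_cong') (auto simp: E'_def)
      also have "\<dots> \<in> S" using S that by (intro subalg_finsum) auto
      finally show ?thesis .
    qed
    show "u i \<in> S" "v i \<in> S"
      using gen[OF S(1), of i] ES GS[of 0 1] GS[of 1 0] i
      by (auto simp: less_Suc_eq G_def pair_units_def)
  qed
qed

definition lincomb :: "nat \<Rightarrow> (nat \<Rightarrow> nat \<Rightarrow> 'a) \<Rightarrow> (nat \<Rightarrow> nat \<Rightarrow> 'k) \<Rightarrow> 'a" where
  "lincomb N E c = (\<Oplus>i\<in>{..<N}. \<Oplus>j\<in>{..<N}. c i j \<odot> E i j)"

context
  fixes N E
  assumes mu: "matrix_units N E"
begin

lemma unit_closed [simp]: "i < N \<Longrightarrow> j < N \<Longrightarrow> E i j \<in> carrier A"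
  and unit_mult: "i < N \<Longrightarrow> j < N \<Longrightarrow> k < N \<Longrightarrow> l < N \<Longrightarrow> E i j \<otimes> E k l = (if j = k then E i l else \<zero>)"
  and unit_sum: "(\<Oplus>i\<in>{..<N}. E i i) = \<one>"
  using mu by (auto simp: matrix_units_def)

lemma row_closed [simp]: "i < N \<Longrightarrow> (\<Oplus>j\<in>{..<N}. c j \<odot> E i j) \<in> carrier A"
  by (rule finsum_closed) auto

lemma lincomb_closed [simp]: "lincomb N E c \<in> carrier A"
  unfolding lincomb_def by (rule finsum_closed) auto

lemma lincomb_add: "lincomb N E (\<lambda>i j. c i j + d i j) = lincomb N E c \<oplus> lincomb N E d"
proof -
  have "lincomb N E (\<lambda>i j. c i j + d i j) =
      (\<Oplus>i\<in>{..<N}. (\<Oplus>j\<in>{..<N}. c i j \<odot> E i j) \<oplus> (\<Oplus>j\<in>{..<N}. d i j \<odot> E i j))"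
    unfolding lincomb_def
  proof (intro finsum_cong')
    fix i assume "i \<in> {..<N}"
    then have i: "i < N" by simp
    have "(\<Oplus>j\<in>{..<N}. (c i j + d i j) \<odot> E i j) = (\<Oplus>j\<in>{..<N}. c i j \<odot> E i j \<oplus> d i j \<odot> E i j)"
      using i by (intro finsum_cong') (auto simp: smult_l_distr)
    also have "\<dots> = (\<Oplus>j\<in>{..<N}. c i j \<odot> E i j) \<oplus> (\<Oplus>j\<in>{..<N}. d i j \<odot> E i j)"
      using i by (intro finsum_addf) auto
    finally show "(\<Oplus>j\<in>{..<N}. (c i j + d i j) \<odot> E i j) =
      (\<Oplus>j\<in>{..<N}. c i j \<odot> E i j) \<oplus> (\<Oplus>j\<in>{..<N}. d i j \<odot> E i j)" .
  qed auto
  also have "\<dots> = lincomb N E c \<oplus> lincomb N E d"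
    unfolding lincomb_def by (intro finsum_addf) auto
  finally show ?thesis .
qed

lemma lincomb_smult: "lincomb N E (\<lambda>i j. a * c i j) = a \<odot> lincomb N E c"
proof -
  have "a \<odot> lincomb N E c = (\<Oplus>i\<in>{..<N}. a \<odot> (\<Oplus>j\<in>{..<N}. c i j \<odot> E i j))"
    unfolding lincomb_def by (intro finsum_smult) auto
  also have "\<dots> = (\<Oplus>i\<in>{..<N}. \<Oplus>j\<in>{..<N}. (a * c i j) \<odot> E i j)"
  proof (intro finsum_cong')
    fix i assume "i \<in> {..<N}"
    then have i: "i < N" by simp
    have "a \<odot> (\<Oplus>j\<in>{..<N}. c i j \<odot> E i j) = (\<Oplus>j\<in>{..<N}. a \<odot> (c i j \<odot> E i j))"
      using i by (intro finsum_smult) auto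
    also have "\<dots> = (\<Oplus>j\<in>{..<N}. (a * c i j) \<odot> E i j)"
      using i by (intro finsum_cong') (auto simp: smult_smult)
    finally show "a \<odot> (\<Oplus>j\<in>{..<N}. c i j \<odot> E i j) = (\<Oplus>j\<in>{..<N}. (a * c i j) \<odot> E i j)" .
  qed auto
  finally show ?thesis by (simp add: lincomb_def)
qed

lemma unit_lincomb:
  assumes "k < N" "l < N"
  shows "E k l \<otimes> lincomb N E c = (\<Oplus>j\<in>{..<N}. c l j \<odot> E k j)"
proof -
  have "E k l \<otimes> lincomb N E c = (\<Oplus>i\<in>{..<N}. E k l \<otimes> (\<Oplus>j\<in>{..<N}. c i j \<odot> E i j))"
    unfolding lincomb_def using assms by (intro finsum_rdistr) auto
  also have "\<dots> = (\<Oplus>j\<in>{..<N}. c l j \<odot> E k j)"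
  proof (rule finsum_single[of _ l])
    fix i assume "i \<in> {..<N}"
    then have i: "i < N" by simp
    have "E k l \<otimes> (\<Oplus>j\<in>{..<N}. c i j \<odot> E i j) = (\<Oplus>j\<in>{..<N}. E k l \<otimes> (c i j \<odot> E i j))"
      using assms i by (intro finsum_rdistr) auto
    also have "\<dots> = (\<Oplus>j\<in>{..<N}. if i = l then c i j \<odot> E k j else \<zero>)"
      using assms i by (intro finsum_cong') (auto simp: smult_mult_r unit_mult)
    also have "\<dots> = (if i = l then \<Oplus>j\<in>{..<N}. c l j \<odot> E k j else \<zero>)"
      by (cases "i = l") auto
    finally show "E k l \<otimes> (\<Oplus>j\<in>{..<N}. c i j \<odot> E i j) = (if i = l then \<Oplus>j\<in>{..<N}. c l j \<odot> E k j else \<zero>)" .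
  qed (use assms in auto)
  finally show ?thesis .
qed

text \<open>Sandwiching between two units isolates a single coefficient; injectivity of
  \<open>lincomb\<close>, simplicity and the determination of the centre all rest on this.\<close>

lemma lincomb_coefficient:
  assumes "a < N" "i < N" "j < N" "b < N"
  shows "E a i \<otimes> lincomb N E c \<otimes> E j b = c i j \<odot> E a b"
proof -
  have "E a i \<otimes> lincomb N E c \<otimes> E j b = (\<Oplus>l\<in>{..<N}. (c i l \<odot> E a l) \<otimes> E j b)"
    using assms by (simp only: unit_lincomb) (intro finsum_ldistr, auto)
  also have "\<dots> = c i j \<odot> E a b"
    using assms by (intro finsum_single[of _ j]) (auto simp: smult_mult_l unit_mult)
  finally show ?thesis .
qed

lemma lincomb_mult: "lincomb N E (\<lambda>i l. \<Sum>j<N. c i j * d j l) = lincomb N E c \<otimes> lincomb N E d"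
proof -
  have "lincomb N E c \<otimes> lincomb N E d = (\<Oplus>i\<in>{..<N}. (\<Oplus>j\<in>{..<N}. c i j \<odot> E i j) \<otimes> lincomb N E d)"
    by (subst lincomb_def, rule finsum_ldistr) auto
  also have "\<dots> = (\<Oplus>i\<in>{..<N}. \<Oplus>l\<in>{..<N}. (\<Sum>j<N. c i j * d j l) \<odot> E i l)"
  proof (intro finsum_cong')
    fix i assume "i \<in> {..<N}"
    then have i: "i < N" by simp
    have "(\<Oplus>j\<in>{..<N}. c i j \<odot> E i j) \<otimes> lincomb N E d = (\<Oplus>j\<in>{..<N}. (c i j \<odot> E i j) \<otimes> lincomb N E d)"
      using i by (intro finsum_ldistr) auto
    also have "\<dots> = (\<Oplus>j\<in>{..<N}. \<Oplus>l\<in>{..<N}. (c i j * d j l) \<odot> E i l)"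
    proof (intro finsum_cong')
      fix j assume "j \<in> {..<N}"
      then have j: "j < N" by simp
      have "(c i j \<odot> E i j) \<otimes> lincomb N E d = c i j \<odot> (\<Oplus>l\<in>{..<N}. d j l \<odot> E i l)"
        using i j by (simp add: smult_mult_l unit_lincomb)
      also have "\<dots> = (\<Oplus>l\<in>{..<N}. c i j \<odot> (d j l \<odot> E i l))"
        using i by (intro finsum_smult) auto
      also have "\<dots> = (\<Oplus>l\<in>{..<N}. (c i j * d j l) \<odot> E i l)"
        using i by (intro finsum_cong') (auto simp: smult_smult)
      finally show "(c i j \<odot> E i j) \<otimes> lincomb N E d = (\<Oplus>l\<in>{..<N}. (c i j * d j l) \<odot> E i l)" .
    qed (use i in auto)
    also have "\<dots> = (\<Oplus>l\<in>{..<N}. \<Oplus>j\<in>{..<N}. (c i j * d j l) \<odot> E i l)"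
      using i by (intro finsum_swap) auto
    also have "\<dots> = (\<Oplus>l\<in>{..<N}. (\<Sum>j<N. c i j * d j l) \<odot> E i l)"
      using i by (intro finsum_cong') (auto simp: finsum_scalars)
    finally show "(\<Oplus>j\<in>{..<N}. c i j \<odot> E i j) \<otimes> lincomb N E d =
      (\<Oplus>l\<in>{..<N}. (\<Sum>j<N. c i j * d j l) \<odot> E i l)" .
  qed auto
  finally show ?thesis by (simp add: lincomb_def)
qed

lemma lincomb_unit:
  assumes "k < N" "l < N"
  shows "lincomb N E (\<lambda>i j. if i = k \<and> j = l then 1 else 0) = E k l"
  unfolding lincomb_def
proof (rule finsum_single[of _ k])
  fix i assume "i \<in> {..<N}"
  then have i: "i < N" by simp
  show "(\<Oplus>j\<in>{..<N}. (if i = k \<and> j = l then 1 else 0) \<odot> E i j) = (if i = k then E k l else \<zero>)"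
  proof (cases "i = k")
    case True
    then show ?thesis using assms by (auto intro!: finsum_single[of _ l])
  next
    case False
    then have "(\<Oplus>j\<in>{..<N}. (if i = k \<and> j = l then 1 else 0) \<odot> E i j) = (\<Oplus>j\<in>{..<N}. \<zero>)"
      using i by (intro finsum_cong') auto
    then show ?thesis using False by simp
  qed
qed (use assms in auto)

lemma lincomb_one: "lincomb N E (\<lambda>i j. if i = j then 1 else 0) = \<one>"
proof -
  have "lincomb N E (\<lambda>i j. if i = j then 1 else 0) = (\<Oplus>i\<in>{..<N}. E i i)"
    unfolding lincomb_def
  proof (intro finsum_cong')
    fix i assume "i \<in> {..<N}"
    then show "(\<Oplus>j\<in>{..<N}. (if i = j then 1 else 0) \<odot> E i j) = E i i"
      by (intro finsum_single[of _ i]) auto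
  qed auto
  then show ?thesis by (simp add: unit_sum)
qed

lemma subalg_lincomb: "subalg (range (lincomb N E))"
proof -
  have "\<one> \<in> range (lincomb N E)"
    unfolding lincomb_one[symmetric] by (rule rangeI)
  moreover have "lincomb N E c \<oplus> lincomb N E d \<in> range (lincomb N E)" for c d
    unfolding lincomb_add[symmetric] by (rule rangeI)
  moreover have "lincomb N E c \<otimes> lincomb N E d \<in> range (lincomb N E)" for c d
    unfolding lincomb_mult[symmetric] by (rule rangeI)
  moreover have "a \<odot> lincomb N E c \<in> range (lincomb N E)" for a c
    unfolding lincomb_smult[symmetric] by (rule rangeI)
  ultimately show ?thesis unfolding subalg_def by auto
qed

end

end

section \<open>Algebras generated by matrix units are central simple\<close>

context kalg
begin

context
  fixes N E
  assumes mu: "matrix_units N E" and nontriv: "\<one> \<noteq> \<zero>"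
    and gen: "\<And>S. subalg S \<Longrightarrow> (\<forall>i<N. \<forall>j<N. E i j \<in> S) \<Longrightarrow> S = carrier A"
begin

text \<open>The linear span of the units is itself a subalgebra, so generation already implies
  spanning.\<close>

lemma carrier_lincomb: "carrier A = range (lincomb N E)"
proof (rule gen[symmetric, OF subalg_lincomb[OF mu]], intro allI impI)
  fix i j assume "i < N" "j < N"
  then have "lincomb N E (\<lambda>i' j'. if i' = i \<and> j' = j then 1 else 0) = E i j"
    by (rule lincomb_unit[OF mu])
  then show "E i j \<in> range (lincomb N E)" by (metis rangeI)
qed

text \<open>Every diagonal unit factors through \<open>E i j\<close>; if this one vanished, so would
  their sum 1.\<close>

lemma unit_nonzero:
  assumes ij: "i < N" "j < N"
  shows "E i j \<noteq> \<zero>"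
proof
  assume 0: "E i j = \<zero>"
  have "E k k = \<zero>" if "k < N" for k
  proof -
    have "E k k = E k i \<otimes> E i j \<otimes> E j k" using ij that by (simp add: unit_mult[OF mu])
    then show ?thesis using 0 ij that unit_closed[OF mu] by simp
  qed
  then have "(\<Oplus>k\<in>{..<N}. E k k) = (\<Oplus>k\<in>{..<N}. \<zero>)" by (intro finsum_cong') auto
  then show False using unit_sum[OF mu] nontriv by simp
qed

lemma N_pos: "N > 0"
  using unit_sum[OF mu] nontriv by (cases N) auto

lemma smult_unit_inj:
  assumes ij: "i < N" "j < N" and eq: "a \<odot> E i j = b \<odot> E i j"
  shows "a = b"
proof (rule ccontr)
  assume "a \<noteq> b"
  have c: "E i j \<in> carrier A" using unit_closed[OF mu] ij by simp
  have "(a - b) \<odot> E i j = \<zero>"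
    using smult_l_distr[OF c, of a "- b"] c eq by (simp add: smult_neg r_neg)
  then have "inverse (a - b) \<odot> ((a - b) \<odot> E i j) = \<zero>" by simp
  then have "E i j = \<zero>" using c \<open>a \<noteq> b\<close> by (simp add: smult_smult)
  then show False using unit_nonzero ij by blast
qed

lemma lincomb_inj:
  assumes "lincomb N E c = lincomb N E d" "i < N" "j < N"
  shows "c i j = d i j"
  using lincomb_coefficient[OF mu, of i i j j c] lincomb_coefficient[OF mu, of i i j j d]
    smult_unit_inj[of i j] assms by simp

text \<open>Sandwiching a nonzero element of the ideal puts a nonzero multiple of every diagonal
  unit into it, hence the units themselves and their sum 1.\<close>

lemma simple:
  assumes I: "ideal I A" "I \<noteq> {\<zero>}"
  shows "I = carrier A"
proof -
  interpret I: ideal I A by (rule I)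
  obtain a where a: "a \<in> I" "a \<noteq> \<zero>"
    using I(2) I.zero_closed by blast
  obtain c where c: "a = lincomb N E c"
    using carrier_lincomb I.Icarr[OF a(1)] by blast
  have "\<exists>i<N. \<exists>j<N. c i j \<noteq> 0"
  proof (rule ccontr)
    assume "\<not> ?thesis"
    then have "(\<Oplus>j\<in>{..<N}. c i j \<odot> E i j) = (\<Oplus>j\<in>{..<N}. \<zero>)" if "i < N" for i
      using that unit_closed[OF mu] by (intro finsum_cong') auto
    then have "a = (\<Oplus>i\<in>{..<N}. \<zero>)"
      unfolding c lincomb_def by (intro finsum_cong') auto
    then show False using a by simp
  qed
  then obtain i j where ij: "i < N" "j < N" "c i j \<noteq> 0" by blast
  have E: "E k k \<in> I" if k: "k < N" for k
  proof -
    have Ec: "E k i \<in> carrier A" "E j k \<in> carrier A" "E k k \<in> carrier A"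
      using unit_closed[OF mu] ij k by auto
    have "c i j \<odot> E k k \<in> I"
      using lincomb_coefficient[OF mu k ij(1,2) k, of c] a(1) Ec
      unfolding c[symmetric] by (metis I.I_l_closed I.I_r_closed)
    then have "(inverse (c i j) \<odot> \<one>) \<otimes> (c i j \<odot> E k k) \<in> I"
      by (intro I.I_l_closed) auto
    then show ?thesis using Ec ij by (simp add: smult_mult_l smult_smult)
  qed
  have "(\<Oplus>k\<in>J. E k k) \<in> I" if "finite J" "J \<subseteq> {..<N}" for J
    using that
  proof (induction J rule: finite_induct)
    case (insert k J)
    then show ?case
      using unit_closed[OF mu] E I.a_closed by (simp add: Pi_def subset_iff)
  qed (simp add: I.zero_closed)
  then have "\<one> \<in> I" using unit_sum[OF mu] by (metis finite_lessThan order_refl)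
  then show ?thesis by (rule I.one_imp_carrier)
qed

lemma center:
  assumes z: "z \<in> carrier A" "\<And>x. x \<in> carrier A \<Longrightarrow> z \<otimes> x = x \<otimes> z"
  shows "\<exists>a. z = a \<odot> \<one>"
proof -
  obtain c where c: "z = lincomb N E c" using carrier_lincomb z by blast
  \<comment> \<open>The sandwich of \<open>z\<close> between \<open>E k 0\<close> and
    \<open>E 0 k\<close> is \<open>c 0 0\<close> times \<open>E k k\<close>; as \<open>z\<close> is
    central, it is also \<open>z\<close> times \<open>E k k\<close>. So \<open>c 0 0\<close> is the
    required scalar for every \<open>k\<close>.\<close>
  have zE: "z \<otimes> E k k = c 0 0 \<odot> E k k" if k: "k < N" for k
  proof -
    have Ec: "E k 0 \<in> carrier A" "E 0 k \<in> carrier A"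
      using unit_closed[OF mu] N_pos k by auto
    have "c 0 0 \<odot> E k k = E k 0 \<otimes> z \<otimes> E 0 k"
      using lincomb_coefficient[OF mu k N_pos N_pos k, of c] c by simp
    also have "\<dots> = z \<otimes> (E k 0 \<otimes> E 0 k)"
      using z Ec by (metis m_assoc)
    also have "E k 0 \<otimes> E 0 k = E k k" using k N_pos by (simp add: unit_mult[OF mu])
    finally show ?thesis by simp
  qed
  have "z = z \<otimes> (\<Oplus>k\<in>{..<N}. E k k)" using z unit_sum[OF mu] by simp
  also have "\<dots> = (\<Oplus>k\<in>{..<N}. z \<otimes> E k k)"
    using z unit_closed[OF mu] by (intro finsum_rdistr) auto
  also have "\<dots> = (\<Oplus>k\<in>{..<N}. c 0 0 \<odot> E k k)"
    using zE unit_closed[OF mu] by (intro finsum_cong') auto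
  also have "\<dots> = c 0 0 \<odot> \<one>"
    using finsum_smult[of "{..<N}" "\<lambda>k. E k k" "c 0 0"] unit_closed[OF mu] unit_sum[OF mu] by simp
  finally show ?thesis by blast
qed

text \<open>The coefficients have to be indexed by the elements of a set, not by pairs of indices.
  Showing that the combinations \<open>U\<close> over the set \<open>S\<close> are closed under
  addition spares a proof that distinct index pairs give distinct units.\<close>

lemma finite_spanning:
  "\<exists>S\<subseteq>carrier A. finite S \<and> (\<forall>x\<in>carrier A. \<exists>c. x = (\<Oplus>s\<in>S. c s \<odot> s))"
proof -
  define S where "S = (\<lambda>(i, j). E i j) ` ({..<N} \<times> {..<N})"
  define U where "U = {\<Oplus>s\<in>S. c s \<odot> s | c. True}"
  have fin: "finite S" and Sc: "S \<subseteq> carrier A"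
    using unit_closed[OF mu] by (auto simp: S_def)
  have U0: "\<zero> \<in> U"
  proof -
    have "(\<Oplus>s\<in>S. 0 \<odot> s) = (\<Oplus>s\<in>S. \<zero>)" using Sc by (intro finsum_cong') auto
    then show ?thesis unfolding U_def by (intro CollectI exI[of _ "\<lambda>_. 0"]) simp
  qed
  have Uc: "x \<in> carrier A" if "x \<in> U" for x
    using that Sc unfolding U_def by (auto intro!: finsum_closed)
  have Uadd: "x \<oplus> y \<in> U" if x: "x \<in> U" and y: "y \<in> U" for x y
  proof -
    obtain c d where cd: "x = (\<Oplus>s\<in>S. c s \<odot> s)" "y = (\<Oplus>s\<in>S. d s \<odot> s)"
      using x y unfolding U_def by blast
    have "x \<oplus> y = (\<Oplus>s\<in>S. c s \<odot> s \<oplus> d s \<odot> s)"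
      unfolding cd using Sc by (intro finsum_addf[symmetric]) auto
    also have "\<dots> = (\<Oplus>s\<in>S. (c s + d s) \<odot> s)"
      using Sc by (intro finsum_cong') (auto simp: smult_l_distr)
    finally show ?thesis unfolding U_def by (intro CollectI exI[of _ "\<lambda>s. c s + d s"]) simp
  qed
  have UE: "a \<odot> E i j \<in> U" if "i < N" "j < N" for a i j
  proof -
    have E: "E i j \<in> S" unfolding S_def by (rule image_eqI[of _ _ "(i, j)"]) (use that in auto)
    then have "(\<Oplus>s\<in>S. (if s = E i j then a else 0) \<odot> s) = a \<odot> E i j"
      using Sc fin by (intro finsum_single[of _ "E i j"]) auto
    then show ?thesis unfolding U_def by (intro CollectI exI[of _ "\<lambda>s. if s = E i j then a else 0"]) simp
  qed
  have Usum: "(\<Oplus>i\<in>J. f i) \<in> U" if "finite J" "\<And>i. i \<in> J \<Longrightarrow> f i \<in> U" for J :: "nat set" and f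
    using that
  proof (induction J rule: finite_induct)
    case (insert k J)
    then have "f \<in> J \<rightarrow> carrier A" "f k \<in> carrier A" using Uc by auto
    then show ?case using insert Uadd by simp
  qed (simp add: U0)
  have "lincomb N E c \<in> U" for c
    unfolding lincomb_def by (intro Usum UE) auto
  then have "\<exists>c. x = (\<Oplus>s\<in>S. c s \<odot> s)" if "x \<in> carrier A" for x
    using that unfolding carrier_lincomb U_def by blast
  then show ?thesis using fin Sc by blast
qed

lemma csa: "central_simple_algebra A"
  unfolding central_simple_algebra_def
proof (intro conjI)
  show "carrier A \<noteq> {\<zero>}" using nontriv one_closed by blast
  show "\<forall>I. ideal I A \<longrightarrow> I = {\<zero>} \<or> I = carrier A" using simple by blast
  show "{z \<in> carrier A. \<forall>x\<in>carrier A. z \<otimes> x = x \<otimes> z} = {a \<odot> \<one> |a. True}"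
  proof (intro equalityI subsetI)
    fix z assume "z \<in> {z \<in> carrier A. \<forall>x\<in>carrier A. z \<otimes> x = x \<otimes> z}"
    then show "z \<in> {a \<odot> \<one> |a. True}" using center[of z] by blast
  qed (auto simp: smult_mult_l smult_mult_r)
qed (rule k_algebra finite_spanning)+

end

end

section \<open>The ground field and matrix algebras over it\<close>

lemma self_algebra_simps [simp]:
  "carrier self_algebra = UNIV" "monoid.mult self_algebra = (*)" "one self_algebra = 1"
  "ring.zero self_algebra = 0" "add self_algebra = (+)" "module.smult self_algebra = (*)"
  by (simp_all add: self_algebra_def)

lemma kalg_self: "kalg (self_algebra :: ('k::field, 'k) module)"
proof
  have r: "ring (self_algebra :: ('k, 'k) module)"
  proof (rule ringI)
    show "abelian_group (self_algebra :: ('k, 'k) module)"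
      by (rule abelian_groupI) (auto simp: algebra_simps intro: exI[of _ "- _"] left_minus)
    show "Group.monoid (self_algebra :: ('k, 'k) module)"
      by (rule monoidI) auto
  qed (auto simp: algebra_simps)
  then interpret ring "self_algebra :: ('k, 'k) module" .
  have "Module.module (ring_of_type_algebra :: 'k ring) (self_algebra :: ('k, 'k) module)"
    by (rule moduleI[OF cring_from_type_algebra abelian_group_axioms]) (auto simp: algebra_simps)
  then show "k_algebra (self_algebra :: ('k, 'k) module)"
    using r by (simp add: k_algebra_def)
qed

lemma finsum_self:
  fixes f :: "'i \<Rightarrow> 'k::field"
  shows "finite I \<Longrightarrow> finsum self_algebra f I = sum f I"
proof (induction I rule: finite_induct)
  interpret kalg "self_algebra :: ('k, 'k) module" by (rule kalg_self)
  case empty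
  show ?case by simp
next
  interpret kalg "self_algebra :: ('k, 'k) module" by (rule kalg_self)
  case (insert x I)
  then show ?case using finsum_insert[of I x f] by simp
qed

text \<open>The field is its own algebra of 1 x 1 matrices, with 1 as the only matrix unit.\<close>

lemma csa_self: "central_simple_algebra (self_algebra :: ('k::field, 'k) module)"
proof -
  interpret kalg "self_algebra :: ('k, 'k) module" by (rule kalg_self)
  show ?thesis
  proof (rule csa[of 1 "\<lambda>_ _. 1"])
    show "matrix_units 1 (\<lambda>_ _. 1)"
      by (simp add: matrix_units_def finsum_self)
    fix S :: "'k set" assume "subalg S"
    then have "a * 1 \<in> S" for a using subalgD(5)[of S 1 a] subalgD(2)[of S] by simp
    then show "S = carrier self_algebra" by auto
  qed auto
qed

lemma matrix_algebra_simps [simp]: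
  "monoid.mult (matrix_algebra n A) = (\<lambda>M N i j.
     if i < n \<and> j < n then (\<Oplus>\<^bsub>A\<^esub>k\<in>{..<n}. M i k \<otimes>\<^bsub>A\<^esub> N k j) else \<zero>\<^bsub>A\<^esub>)"
  "one (matrix_algebra n A) = (\<lambda>i j. if i < n \<and> i = j then \<one>\<^bsub>A\<^esub> else \<zero>\<^bsub>A\<^esub>)"
  "ring.zero (matrix_algebra n A) = (\<lambda>i j. \<zero>\<^bsub>A\<^esub>)"
  "add (matrix_algebra n A) = (\<lambda>M N i j. M i j \<oplus>\<^bsub>A\<^esub> N i j)"
  "module.smult (matrix_algebra n A) = (\<lambda>a M i j. a \<odot>\<^bsub>A\<^esub> M i j)"
  by (simp_all add: matrix_algebra_def)

lemma matrix_carrier: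
  "M \<in> carrier (matrix_algebra n A) \<longleftrightarrow>
     (\<forall>i j. (i < n \<and> j < n \<longrightarrow> M i j \<in> carrier A) \<and> (\<not> (i < n \<and> j < n) \<longrightarrow> M i j = \<zero>\<^bsub>A\<^esub>))"
  by (simp add: matrix_algebra_def)

lemma (in kalg) matrix_iso:
  assumes mu: "matrix_units N E" and nontriv: "\<one> \<noteq> \<zero>"
    and gen: "\<And>S. subalg S \<Longrightarrow> (\<forall>i<N. \<forall>j<N. E i j \<in> S) \<Longrightarrow> S = carrier A"
  shows "algebra_iso (matrix_algebra N self_algebra) A"
  unfolding algebra_iso_def
proof (intro bexI[of _ "lincomb N E"] ring_iso_memI allI ballI)
  fix M M' :: "nat \<Rightarrow> nat \<Rightarrow> 'k"
  \<comment> \<open>Matrix product and unit matrix are cut off outside the index range, while the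
    coefficient functions in \<open>lincomb_mult\<close> and \<open>lincomb_one\<close> are not;
    only the entries inside the range matter.\<close>
  have c: "lincomb N E c = lincomb N E d" if "\<And>i j. i < N \<Longrightarrow> j < N \<Longrightarrow> c i j = d i j" for c d
    unfolding lincomb_def using that unit_closed[OF mu]
    by (intro finsum_cong') (auto intro!: finsum_cong')
  show "lincomb N E (M \<otimes>\<^bsub>matrix_algebra N self_algebra\<^esub> M') = lincomb N E M \<otimes> lincomb N E M'"
    unfolding lincomb_mult[OF mu, symmetric] by (rule c) (simp add: finsum_self)
  show "lincomb N E (M \<oplus>\<^bsub>matrix_algebra N self_algebra\<^esub> M') = lincomb N E M \<oplus> lincomb N E M'"
    unfolding lincomb_add[OF mu, symmetric] by simp
  show "lincomb N E (a \<odot>\<^bsub>matrix_algebra N self_algebra\<^esub> M) = a \<odot> lincomb N E M" for a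
    unfolding lincomb_smult[OF mu, symmetric] by simp
  show "lincomb N E \<one>\<^bsub>matrix_algebra N self_algebra\<^esub> = \<one>"
    unfolding lincomb_one[OF mu, symmetric] by (rule c) simp
  show "bij_betw (lincomb N E) (carrier (matrix_algebra N self_algebra)) (carrier A)"
    unfolding bij_betw_def
  proof
    show "inj_on (lincomb N E) (carrier (matrix_algebra N self_algebra))"
    proof (rule inj_onI, intro ext)
      fix M M' :: "nat \<Rightarrow> nat \<Rightarrow> 'k" and i j
      assume *: "M \<in> carrier (matrix_algebra N self_algebra)" "M' \<in> carrier (matrix_algebra N self_algebra)"
        "lincomb N E M = lincomb N E M'"
      show "M i j = M' i j"
      proof (cases "i < N \<and> j < N")
        case True
        then show ?thesis using lincomb_inj[OF mu nontriv gen *(3)] by blast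
      next
        case False
        then show ?thesis using *(1,2) by (auto simp: matrix_carrier)
      qed
    qed
    show "lincomb N E ` carrier (matrix_algebra N self_algebra) = carrier A"
    proof
      show "carrier A \<subseteq> lincomb N E ` carrier (matrix_algebra N self_algebra)"
      proof
        fix x assume "x \<in> carrier A"
        then obtain d where d: "x = lincomb N E d" using carrier_lincomb[OF mu nontriv gen] by blast
        have "x = lincomb N E (\<lambda>i j. if i < N \<and> j < N then d i j else 0)"
          unfolding d by (rule c) simp
        then show "x \<in> lincomb N E ` carrier (matrix_algebra N self_algebra)"
          by (intro image_eqI[of _ _ "\<lambda>i j. if i < N \<and> j < N then d i j else 0"])
            (simp_all add: matrix_carrier)
      qed
    qed (use lincomb_closed[OF mu] in auto)
  qed
qed (use lincomb_closed[OF mu] in auto)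

section \<open>Brauer classes of split algebras\<close>

text \<open>
  The part of the algebra axioms which is needed to handle matrix algebras; it is inherited by
  matrix algebras without having to check the ring laws for matrix multiplication.
\<close>

locale prealg = abelian_group A for A :: "('k, 'a) module" (structure) +
  assumes one_closed: "\<one> \<in> carrier A"
    and mult_closed: "x \<in> carrier A \<Longrightarrow> y \<in> carrier A \<Longrightarrow> x \<otimes> y \<in> carrier A"
    and smult_closed: "x \<in> carrier A \<Longrightarrow> a \<odot> x \<in> carrier A"
    and smult_zero: "a \<odot> \<zero> = \<zero>"

lemma (in kalg) prealg: "prealg A"
  by unfold_locales auto

context prealg
begin

lemma abelian_group_matrix: "abelian_group (matrix_algebra n A)"
proof -
  let ?M = "matrix_algebra n A"
  show "abelian_group ?M"
  proof (rule abelian_groupI)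
    fix M assume M: "M \<in> carrier (?M)"
    have c: "M i j \<in> carrier A" for i j
      using M by (cases "i < n \<and> j < n") (auto simp: matrix_carrier)
    have "(\<lambda>i j. \<ominus> M i j) \<in> carrier (?M)"
      using M by (auto simp: matrix_carrier)
    moreover have "(\<lambda>i j. \<ominus> M i j) \<oplus>\<^bsub>?M\<^esub> M = \<zero>\<^bsub>?M\<^esub>"
      using c by (simp add: l_neg)
    ultimately show "\<exists>y\<in>carrier (?M). y \<oplus>\<^bsub>?M\<^esub> M = \<zero>\<^bsub>?M\<^esub>"
      by blast
    show "\<zero>\<^bsub>?M\<^esub> \<oplus>\<^bsub>?M\<^esub> M = M"
      using c by simp
  next
    fix M M' assume MM': "M \<in> carrier (?M)" "M' \<in> carrier (?M)"
    have c: "M i j \<in> carrier A" "M' i j \<in> carrier A" for i j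
      using MM' by (cases "i < n \<and> j < n"; auto simp: matrix_carrier)+
    show "M \<oplus>\<^bsub>?M\<^esub> M' \<in> carrier (?M)"
      using MM' by (auto simp: matrix_carrier)
    show "M \<oplus>\<^bsub>?M\<^esub> M' = M' \<oplus>\<^bsub>?M\<^esub> M"
      using c by (simp add: a_comm)
    fix M'' assume "M'' \<in> carrier (?M)"
    then have "M'' i j \<in> carrier A" for i j
      by (cases "i < n \<and> j < n") (auto simp: matrix_carrier)
    then show "(M \<oplus>\<^bsub>?M\<^esub> M') \<oplus>\<^bsub>?M\<^esub> M'' =
        M \<oplus>\<^bsub>?M\<^esub> (M' \<oplus>\<^bsub>?M\<^esub> M'')"
      using c by (simp add: a_assoc)
  qed (simp add: matrix_carrier)
qed

lemma prealg_matrix: "prealg (matrix_algebra n A)"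
proof (intro prealg.intro abelian_group_matrix prealg_axioms.intro)
  let ?M = "matrix_algebra n A"
  fix M M' a assume M: "M \<in> carrier (?M)"
  show "a \<odot>\<^bsub>?M\<^esub> M \<in> carrier (?M)"
    using M by (auto simp: matrix_carrier smult_closed smult_zero)
  assume M': "M' \<in> carrier (?M)"
  show "M \<otimes>\<^bsub>?M\<^esub> M' \<in> carrier (?M)"
    using M M' by (auto simp: matrix_carrier intro!: finsum_closed mult_closed)
qed (auto simp: matrix_carrier one_closed smult_zero)

lemma finsum_matrix:
  assumes "finite I" "\<And>x. x \<in> I \<Longrightarrow> f x \<in> carrier (matrix_algebra n A)"
  shows "finsum (matrix_algebra n A) f I = (\<lambda>i j. \<Oplus>x\<in>I. f x i j)"
  using assms
proof (induction I rule: finite_induct)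
  interpret M: abelian_group "matrix_algebra n A" by (rule abelian_group_matrix)
  case empty
  show ?case by simp
next
  interpret M: abelian_group "matrix_algebra n A" by (rule abelian_group_matrix)
  case (insert x I)
  have c: "f y i j \<in> carrier A" if "y \<in> insert x I" for y i j
    using insert.prems[OF that] by (cases "i < n \<and> j < n") (auto simp: matrix_carrier)
  have "finsum (matrix_algebra n A) f (insert x I) =
      f x \<oplus>\<^bsub>matrix_algebra n A\<^esub> finsum (matrix_algebra n A) f I"
    using insert by (intro M.finsum_insert) auto
  also have "\<dots> = (\<lambda>i j. f x i j \<oplus> (\<Oplus>x\<in>I. f x i j))"
    using insert by simp
  also have "\<dots> = (\<lambda>i j. \<Oplus>x\<in>insert x I. f x i j)"
    using insert.hyps c by (intro ext, subst finsum_insert) (auto simp: Pi_def)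
  finally show ?case .
qed

end

lemma algebra_iso_trans:
  assumes "algebra_iso A B" "algebra_iso B C"
  shows "algebra_iso A C"
proof -
  obtain f g where f: "f \<in> ring_iso A B" "\<And>a x. x \<in> carrier A \<Longrightarrow> f (a \<odot>\<^bsub>A\<^esub> x) = a \<odot>\<^bsub>B\<^esub> f x"
    and g: "g \<in> ring_iso B C" "\<And>a x. x \<in> carrier B \<Longrightarrow> g (a \<odot>\<^bsub>B\<^esub> x) = a \<odot>\<^bsub>C\<^esub> g x"
    using assms unfolding algebra_iso_def by blast
  have "g \<circ> f \<in> ring_iso A C" using ring_iso_set_trans[OF f(1) g(1)] .
  moreover have "(g \<circ> f) (a \<odot>\<^bsub>A\<^esub> x) = a \<odot>\<^bsub>C\<^esub> (g \<circ> f) x" if "x \<in> carrier A" for a x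
    using f g that ring_iso_memE(1)[OF f(1)] by simp
  ultimately show ?thesis unfolding algebra_iso_def by blast
qed

lemma algebra_iso_sym:
  assumes A: "prealg A" and iso: "algebra_iso A B"
  shows "algebra_iso B A"
proof -
  interpret prealg A by (rule A)
  obtain f where f: "f \<in> ring_iso A B" "\<And>a x. x \<in> carrier A \<Longrightarrow> f (a \<odot>\<^bsub>A\<^esub> x) = a \<odot>\<^bsub>B\<^esub> f x"
    using iso unfolding algebra_iso_def by blast
  note fE = ring_iso_memE[OF f(1)]
  define g where "g = inv_into (carrier A) f"
  have g: "g y \<in> carrier A" "f (g y) = y" if "y \<in> carrier B" for y
    using fE(5) that by (auto simp: g_def bij_betw_def inv_into_into f_inv_into_f)
  have gf: "g (f x) = x" if "x \<in> carrier A" for x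
    using fE(5) that by (simp add: g_def bij_betw_def)
  have eq: "g y = x" if "x \<in> carrier A" "y = f x" for x y using gf that by simp
  have "g \<in> ring_iso B A"
  proof (rule ring_iso_memI)
    show "bij_betw g (carrier B) (carrier A)"
      unfolding g_def using fE(5) by (rule bij_betw_inv_into)
    show "g (x \<otimes>\<^bsub>B\<^esub> y) = g x \<otimes>\<^bsub>A\<^esub> g y" if "x \<in> carrier B" "y \<in> carrier B" for x y
      using that g fE(2) by (intro eq) (auto simp: mult_closed)
    show "g (x \<oplus>\<^bsub>B\<^esub> y) = g x \<oplus>\<^bsub>A\<^esub> g y" if "x \<in> carrier B" "y \<in> carrier B" for x y
      using that g fE(3) by (intro eq) auto
    show "g \<one>\<^bsub>B\<^esub> = \<one>\<^bsub>A\<^esub>" using fE(4) by (intro eq) (auto simp: one_closed)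
  qed (use g in auto)
  moreover have "g (a \<odot>\<^bsub>B\<^esub> x) = a \<odot>\<^bsub>A\<^esub> g x" if "x \<in> carrier B" for a x
    using that g f(2) by (intro eq) (auto simp: smult_closed)
  ultimately show ?thesis unfolding algebra_iso_def by blast
qed

lemma algebra_iso_matrix:
  assumes A: "prealg A" and B: "prealg B" and iso: "algebra_iso A B"
  shows "algebra_iso (matrix_algebra n A) (matrix_algebra n B)"
proof -
  let ?M = "matrix_algebra n A" and ?N = "matrix_algebra n B"
  interpret A: prealg A by (rule A)
  interpret B: prealg B by (rule B)
  obtain f where f: "f \<in> ring_iso A B" "\<And>a x. x \<in> carrier A \<Longrightarrow> f (a \<odot>\<^bsub>A\<^esub> x) = a \<odot>\<^bsub>B\<^esub> f x"
    using iso unfolding algebra_iso_def by blast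
  note fE = ring_iso_memE[OF f(1)]
  have f0: "f \<zero>\<^bsub>A\<^esub> = \<zero>\<^bsub>B\<^esub>"
    using fE(3)[of "\<zero>\<^bsub>A\<^esub>" "\<zero>\<^bsub>A\<^esub>"] fE(1)[of "\<zero>\<^bsub>A\<^esub>"] by (simp add: B.add.l_cancel_one')
  have fsum: "f (finsum A h I) = finsum B (\<lambda>x. f (h x)) I"
    if "finite I" "h \<in> I \<rightarrow> carrier A" for h and I :: "nat set"
    using that
  proof (induction I rule: finite_induct)
    case (insert x I)
    then have "finsum A h I \<in> carrier A" by (intro A.finsum_closed) auto
    then show ?case using insert fE(1,3) by (simp add: Pi_def)
  qed (simp add: f0)
  define \<phi> where "\<phi> M i j = f (M i j)" for M :: "nat \<Rightarrow> nat \<Rightarrow> _" and i j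
  have c: "M i j \<in> carrier A" if "M \<in> carrier ?M" for M i j
    using that by (cases "i < n \<and> j < n") (auto simp: matrix_carrier)
  have "\<phi> \<in> ring_iso ?M ?N"
  proof (rule ring_iso_memI)
    fix M assume M: "M \<in> carrier ?M"
    show "\<phi> M \<in> carrier ?N"
      using M fE(1) by (auto simp: matrix_carrier \<phi>_def f0)
    fix M' assume M': "M' \<in> carrier ?M"
    show "\<phi> (M \<oplus>\<^bsub>?M\<^esub> M') = \<phi> M \<oplus>\<^bsub>?N\<^esub> \<phi> M'"
      using c[OF M] c[OF M'] fE(3) by (simp add: \<phi>_def fun_eq_iff)
    have "f (finsum A (\<lambda>k. M i k \<otimes>\<^bsub>A\<^esub> M' k j) {..<n}) =
        finsum B (\<lambda>k. f (M i k) \<otimes>\<^bsub>B\<^esub> f (M' k j)) {..<n}" for i j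
    proof -
      have "f (finsum A (\<lambda>k. M i k \<otimes>\<^bsub>A\<^esub> M' k j) {..<n}) =
          finsum B (\<lambda>k. f (M i k \<otimes>\<^bsub>A\<^esub> M' k j)) {..<n}"
        using c[OF M] c[OF M'] by (intro fsum) (auto intro: A.mult_closed)
      also have "\<dots> = finsum B (\<lambda>k. f (M i k) \<otimes>\<^bsub>B\<^esub> f (M' k j)) {..<n}"
        using c[OF M] c[OF M'] fE(1,2) by (intro B.finsum_cong') (auto intro: B.mult_closed)
      finally show ?thesis .
    qed
    then show "\<phi> (M \<otimes>\<^bsub>?M\<^esub> M') = \<phi> M \<otimes>\<^bsub>?N\<^esub> \<phi> M'"
      by (simp add: \<phi>_def fun_eq_iff f0)
  next
    show "\<phi> \<one>\<^bsub>?M\<^esub> = \<one>\<^bsub>?N\<^esub>"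
      using fE(4) f0 by (simp add: \<phi>_def fun_eq_iff)
    have inj: "inj_on f (carrier A)" and surj: "f ` carrier A = carrier B"
      using fE(5) by (auto simp: bij_betw_def)
    show "bij_betw \<phi> (carrier ?M) (carrier ?N)"
      unfolding bij_betw_def
    proof
      show "inj_on \<phi> (carrier ?M)"
      proof (rule inj_onI, intro ext)
        fix M M' i j assume M: "M \<in> carrier ?M" "M' \<in> carrier ?M"
          "\<phi> M = \<phi> M'"
        then have "f (M i j) = f (M' i j)" by (metis \<phi>_def)
        then show "M i j = M' i j" using inj c M(1,2) by (simp add: inj_on_def)
      qed
      show "\<phi> ` carrier ?M = carrier ?N"
      proof (intro equalityI subsetI)
        fix M assume M: "M \<in> carrier ?N"
        define M' where "M' i j = (if i < n \<and> j < n then inv_into (carrier A) f (M i j) else \<zero>\<^bsub>A\<^esub>)" for i j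
        have inv: "inv_into (carrier A) f y \<in> carrier A" "f (inv_into (carrier A) f y) = y"
          if "y \<in> carrier B" for y
          using that surj by (auto simp: inv_into_into f_inv_into_f)
        have "M' \<in> carrier ?M" "M = \<phi> M'"
          using M inv by (auto simp: matrix_carrier M'_def \<phi>_def f0 fun_eq_iff)
        then show "M \<in> \<phi> ` carrier ?M" by blast
      next
        fix M assume "M \<in> \<phi> ` carrier ?M"
        then show "M \<in> carrier ?N"
          using fE(1) by (auto simp: matrix_carrier \<phi>_def f0)
      qed
    qed
  qed
  moreover have "\<phi> (a \<odot>\<^bsub>?M\<^esub> M) = a \<odot>\<^bsub>?N\<^esub> \<phi> M"
    if "M \<in> carrier ?M" for a M
    using c[OF that] f(2) by (simp add: \<phi>_def fun_eq_iff)
  ultimately show ?thesis unfolding algebra_iso_def by blast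
qed

text \<open>The isomorphism flattens block matrices: position \<open>r\<close> inside block
  \<open>i\<close> becomes position \<open>i * b + r\<close>.\<close>

lemma algebra_iso_matrix_matrix:
  fixes A :: "('k, 'a) module" (structure)
  assumes A: "prealg A" and b: "b > 0"
  shows "algebra_iso (matrix_algebra n (matrix_algebra b A)) (matrix_algebra (n * b) A)"
proof -
  interpret prealg A by (rule A)
  let ?M = "matrix_algebra n (matrix_algebra b A)" and ?N = "matrix_algebra (n * b) A"
  define \<phi> where "\<phi> M p q = (if p < n * b \<and> q < n * b
    then M (p div b) (q div b) (p mod b) (q mod b) else \<zero>\<^bsub>A\<^esub>)" for M :: "nat \<Rightarrow> nat \<Rightarrow> nat \<Rightarrow> nat \<Rightarrow> _" and p q
  have bd: "p div b < n" "p mod b < b" if "p < n * b" for p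
    using that b by (auto simp: less_mult_imp_div_less)
  have bd': "i * b + r < n * b" if "i < n" "r < b" for i r
  proof -
    have "i * b + r < Suc i * b" using that by simp
    also have "\<dots> \<le> n * b" using that by (intro mult_le_mono1) simp
    finally show ?thesis .
  qed
  have cM: "M i j \<in> carrier (matrix_algebra b A)" if "M \<in> carrier ?M" for M i j
    using that by (cases "i < n \<and> j < n") (auto simp: matrix_carrier)
  have c: "M i j r s \<in> carrier A" if "M \<in> carrier ?M" for M i j r s
    using cM[OF that, of i j] by (cases "r < b \<and> s < b") (auto simp: matrix_carrier)
  have "\<phi> \<in> ring_iso ?M ?N"
  proof (rule ring_iso_memI)
    fix M assume M: "M \<in> carrier ?M"
    show "\<phi> M \<in> carrier ?N" using c[OF M] by (auto simp: matrix_carrier \<phi>_def)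
    fix M' assume M': "M' \<in> carrier ?M"
    show "\<phi> (M \<oplus>\<^bsub>?M\<^esub> M') = \<phi> M \<oplus>\<^bsub>?N\<^esub> \<phi> M'" by (simp add: \<phi>_def fun_eq_iff)
    show "\<phi> (M \<otimes>\<^bsub>?M\<^esub> M') = \<phi> M \<otimes>\<^bsub>?N\<^esub> \<phi> M'"
    proof (intro ext)
      fix p q
      show "\<phi> (M \<otimes>\<^bsub>?M\<^esub> M') p q = (\<phi> M \<otimes>\<^bsub>?N\<^esub> \<phi> M') p q"
      proof (cases "p < n * b \<and> q < n * b")
        case True
        let ?i = "p div b" and ?r = "p mod b" and ?j = "q div b" and ?s = "q mod b"
        have pq: "?i < n" "?r < b" "?j < n" "?s < b" using bd True by auto
        have "(\<phi> M \<otimes>\<^bsub>?N\<^esub> \<phi> M') p q = (\<Oplus>x\<in>{..<n * b}. \<phi> M p x \<otimes> \<phi> M' x q)"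
          using True by simp
        also have "\<dots> = (\<Oplus>k\<in>{..<n}. \<Oplus>t\<in>{..<b}. \<phi> M p (k * b + t) \<otimes> \<phi> M' (k * b + t) q)"
          by (rule finsum_lessThan_mult) (use True c M M' in \<open>auto simp: \<phi>_def intro: mult_closed\<close>)
        also have "\<dots> = (\<Oplus>k\<in>{..<n}. \<Oplus>t\<in>{..<b}. M ?i k ?r t \<otimes> M' k ?j t ?s)"
        proof (rule finsum_cong')
          fix k assume "k \<in> {..<n}"
          then show "(\<Oplus>t\<in>{..<b}. \<phi> M p (k * b + t) \<otimes> \<phi> M' (k * b + t) q) =
              (\<Oplus>t\<in>{..<b}. M ?i k ?r t \<otimes> M' k ?j t ?s)"
            using True c[OF M] c[OF M'] bd' by (intro finsum_cong') (auto simp: \<phi>_def intro: mult_closed)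
        qed (use c[OF M] c[OF M'] in \<open>auto intro!: finsum_closed mult_closed\<close>)
        also have "\<dots> = (\<Oplus>k\<in>{..<n}. (M ?i k \<otimes>\<^bsub>matrix_algebra b A\<^esub> M' k ?j) ?r ?s)"
          using pq c[OF M] c[OF M'] by (intro finsum_cong') (auto intro!: finsum_closed mult_closed)
        also have "\<dots> = finsum (matrix_algebra b A) (\<lambda>k. M ?i k \<otimes>\<^bsub>matrix_algebra b A\<^esub> M' k ?j) {..<n} ?r ?s"
          by (subst finsum_matrix) (use cM[OF M] cM[OF M'] prealg.mult_closed[OF prealg_matrix] in auto)
        also have "\<dots> = \<phi> (M \<otimes>\<^bsub>?M\<^esub> M') p q"
          using True pq by (simp add: \<phi>_def del: matrix_algebra_simps) (simp only: matrix_algebra_simps(1), simp)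
        finally show ?thesis ..
      qed (auto simp: \<phi>_def)
    qed
  next
    show "\<phi> \<one>\<^bsub>?M\<^esub> = \<one>\<^bsub>?N\<^esub>"
    proof (intro ext)
      fix p q
      have "p = q \<longleftrightarrow> p div b = q div b \<and> p mod b = q mod b" by (metis div_mult_mod_eq)
      then show "\<phi> \<one>\<^bsub>?M\<^esub> p q = \<one>\<^bsub>?N\<^esub> p q"
        using bd[of p] by (auto simp: \<phi>_def)
    qed
    show "bij_betw \<phi> (carrier ?M) (carrier ?N)"
      unfolding bij_betw_def
    proof
      show "inj_on \<phi> (carrier ?M)"
      proof (rule inj_onI, intro ext)
        fix M M' i j r s assume MM: "M \<in> carrier ?M" "M' \<in> carrier ?M" "\<phi> M = \<phi> M'"
        show "M i j r s = M' i j r s"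
        proof (cases "i < n \<and> j < n \<and> r < b \<and> s < b")
          case True
          then have "\<phi> M (i * b + r) (j * b + s) = M i j r s" "\<phi> M' (i * b + r) (j * b + s) = M' i j r s"
            using bd' by (auto simp: \<phi>_def)
          then show ?thesis using MM(3) by simp
        next
          case False
          \<comment> \<open>Normalisation acts on two levels: outside the outer range the whole
            block is the zero matrix, and inside it the entries beyond the block size
            vanish.\<close>
          have zero: "K i j r s = \<zero>" if "K \<in> carrier ?M" for K
          proof (cases "i < n \<and> j < n")
            case True
            then show ?thesis using that False by (auto simp: matrix_carrier)
          next
            case False
            then have "K i j = \<zero>\<^bsub>matrix_algebra b A\<^esub>" using that by (auto simp: matrix_carrier)
            then show ?thesis by simp
          qed
          show ?thesis unfolding zero[OF MM(1)] zero[OF MM(2)] ..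
        qed
      qed
      show "\<phi> ` carrier ?M = carrier ?N"
      proof (intro equalityI subsetI)
        fix M assume M: "M \<in> carrier ?N"
        define M' where "M' i j r s = (if i < n \<and> j < n \<and> r < b \<and> s < b then M (i * b + r) (j * b + s) else \<zero>)" for i j r s
        have "M' \<in> carrier ?M"
          using M bd' by (auto simp: matrix_carrier M'_def fun_eq_iff)
        moreover have "M = \<phi> M'"
          using M bd by (auto simp: matrix_carrier M'_def \<phi>_def fun_eq_iff)
        ultimately show "M \<in> \<phi> ` carrier ?M" by blast
      next
        fix M assume "M \<in> \<phi> ` carrier ?M"
        then obtain M' where M': "M' \<in> carrier ?M" "M = \<phi> M'" by blast
        show "M \<in> carrier ?N"
          unfolding M'(2) matrix_carrier \<phi>_def using c[OF M'(1)] by simp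
      qed
    qed
  qed
  moreover have "\<phi> (a \<odot>\<^bsub>?M\<^esub> M) = a \<odot>\<^bsub>?N\<^esub> \<phi> M" for a M
    by (simp add: \<phi>_def fun_eq_iff smult_zero)
  ultimately show ?thesis unfolding algebra_iso_def by blast
qed

text \<open>The members \<open>B\<close> are transported directly. From M_a(A) = M_b(B) one gets
  M_(aN)(K) = M_b(B) by inserting A = M_N(K). Conversely M_a(K) = M_b(B) yields M_a(A) = M_(Na)(K) =
  M_N(M_a(K)) = M_(Nb)(B), where equality means isomorphism.\<close>

lemma brauer_class_split:
  fixes A :: "('k::field, 'a) module"
  assumes csa: "central_simple_algebra A" and N: "N > 0"
    and iso: "algebra_iso (matrix_algebra N self_algebra) A"
  shows "brauer_class A = brauer_one"
proof -
  let ?K = "self_algebra :: ('k, 'k) module"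
  have csaD: "prealg B" if "central_simple_algebra B" for B :: "('k, 'b) module"
    using that by (intro kalg.prealg kalg.intro) (simp add: central_simple_algebra_def)
  have K: "prealg ?K" by (rule kalg.prealg[OF kalg_self])
  note A = csaD[OF csa]
  note mK = prealg.prealg_matrix[OF K]
  have "brauer_equivalent A B \<longleftrightarrow> brauer_equivalent ?K B"
    for B :: "('k, nat \<Rightarrow> 'k) module"
  proof
    assume AB: "brauer_equivalent A B"
    then obtain a b where ab: "a > 0" "b > 0" "algebra_iso (matrix_algebra a A) (matrix_algebra b B)"
      unfolding brauer_equivalent_def by blast
    have "algebra_iso (matrix_algebra (a * N) ?K)
        (matrix_algebra a (matrix_algebra N ?K))"
      by (rule algebra_iso_sym[OF prealg.prealg_matrix[OF mK] algebra_iso_matrix_matrix[OF K N]])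
    from algebra_iso_trans[OF this algebra_iso_trans[OF algebra_iso_matrix[OF mK A iso] ab(3)]]
    show "brauer_equivalent ?K B"
      using AB csa_self ab N unfolding brauer_equivalent_def by (metis mult_pos_pos)
  next
    assume KB: "brauer_equivalent ?K B"
    then obtain a b where ab: "a > 0" "b > 0"
      "algebra_iso (matrix_algebra a ?K) (matrix_algebra b B)"
      unfolding brauer_equivalent_def by blast
    have B: "prealg B" using KB csaD unfolding brauer_equivalent_def by blast
    have 1: "algebra_iso (matrix_algebra a A) (matrix_algebra a (matrix_algebra N ?K))"
      by (rule algebra_iso_matrix[OF A mK algebra_iso_sym[OF mK iso]])
    have 2: "algebra_iso (matrix_algebra a (matrix_algebra N ?K)) (matrix_algebra (N * a) ?K)"
      using algebra_iso_matrix_matrix[OF K N, of a] by (simp add: mult.commute)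
    have 3: "algebra_iso (matrix_algebra (N * a) ?K) (matrix_algebra N (matrix_algebra a ?K))"
      by (rule algebra_iso_sym[OF prealg.prealg_matrix[OF mK] algebra_iso_matrix_matrix[OF K ab(1)]])
    have 4: "algebra_iso (matrix_algebra N (matrix_algebra a ?K)) (matrix_algebra N (matrix_algebra b B))"
      by (rule algebra_iso_matrix[OF mK prealg.prealg_matrix[OF B] ab(3)])
    have 5: "algebra_iso (matrix_algebra N (matrix_algebra b B)) (matrix_algebra (N * b) B)"
      by (rule algebra_iso_matrix_matrix[OF B ab(2)])
    have "algebra_iso (matrix_algebra a A) (matrix_algebra (N * b) B)"
      by (rule algebra_iso_trans[OF 1 algebra_iso_trans[OF 2 algebra_iso_trans[OF 3 algebra_iso_trans[OF 4 5]]]])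
    then show "brauer_equivalent A B"
      using KB csa ab N unfolding brauer_equivalent_def by (metis mult_pos_pos)
  qed
  then show ?thesis by (simp add: brauer_class_def brauer_one_def)
qed

section \<open>The free algebra and quotient algebras\<close>

text \<open>The axioms are equations, except for additive inverses, which are supplied by images of
  inverses; so they pass to every surjective image respecting the operations.\<close>

lemma k_algebra_image:
  fixes A :: "('k::field, 'a) module" and B :: "('k, 'b) module"
  assumes A: "k_algebra A" and surj: "carrier B = h ` carrier A"
    and add: "\<And>x y. x \<in> carrier A \<Longrightarrow> y \<in> carrier A \<Longrightarrow> h x \<oplus>\<^bsub>B\<^esub> h y = h (x \<oplus>\<^bsub>A\<^esub> y)"
    and mult: "\<And>x y. x \<in> carrier A \<Longrightarrow> y \<in> carrier A \<Longrightarrow> h x \<otimes>\<^bsub>B\<^esub> h y = h (x \<otimes>\<^bsub>A\<^esub> y)"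
    and one: "\<one>\<^bsub>B\<^esub> = h \<one>\<^bsub>A\<^esub>" and zero: "\<zero>\<^bsub>B\<^esub> = h \<zero>\<^bsub>A\<^esub>"
    and smult: "\<And>a x. x \<in> carrier A \<Longrightarrow> a \<odot>\<^bsub>B\<^esub> h x = h (a \<odot>\<^bsub>A\<^esub> x)"
  shows "k_algebra B"
proof -
  interpret A: kalg A using A by (rule kalg.intro)
  have ag: "abelian_group B"
  proof (rule abelian_groupI)
    fix x assume "x \<in> carrier B"
    then obtain a where a: "a \<in> carrier A" "x = h a" using surj by blast
    then have "h (\<ominus>\<^bsub>A\<^esub> a) \<in> carrier B" "h (\<ominus>\<^bsub>A\<^esub> a) \<oplus>\<^bsub>B\<^esub> x = \<zero>\<^bsub>B\<^esub>"
      by (auto simp: surj add zero A.l_neg)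
    then show "\<exists>y\<in>carrier B. y \<oplus>\<^bsub>B\<^esub> x = \<zero>\<^bsub>B\<^esub>" by blast
  qed (auto simp: surj add zero A.a_ac)
  have r: "ring B"
  proof (rule ringI[OF ag])
    show "Group.monoid B" by (rule monoidI) (auto simp: surj mult one A.m_assoc)
  qed (auto simp: surj add mult A.l_distr A.r_distr)
  have "Module.module (ring_of_type_algebra :: 'k ring) B"
    by (rule moduleI[OF cring_from_type_algebra ag])
      (auto simp: surj add smult A.smult_l_distr A.smult_r_distr A.smult_smult)
  then show ?thesis
    unfolding k_algebra_def using r
    by (auto simp: surj mult smult A.smult_mult_l A.smult_mult_r)
qed

section \<open>Quotients by ideals\<close>

context kalg
begin

context
  fixes I
  assumes I: "ideal I A"
begin

lemma quotient_carrier: "carrier (quotient_algebra A I) = (\<lambda>x. I +> x) ` carrier A"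
  by (auto simp: quotient_algebra_def FactRing_def A_RCOSETS_def')

lemma quotient_add:
  "x \<in> carrier A \<Longrightarrow> y \<in> carrier A \<Longrightarrow> (I +> x) \<oplus>\<^bsub>quotient_algebra A I\<^esub> (I +> y) = I +> (x \<oplus> y)"
proof -
  interpret I: ideal I A by (rule I)
  show "x \<in> carrier A \<Longrightarrow> y \<in> carrier A \<Longrightarrow> ?thesis"
    by (simp add: quotient_algebra_def FactRing_def I.a_rcos_sum)
qed

lemma quotient_mult:
  "x \<in> carrier A \<Longrightarrow> y \<in> carrier A \<Longrightarrow> (I +> x) \<otimes>\<^bsub>quotient_algebra A I\<^esub> (I +> y) = I +> (x \<otimes> y)"
  by (simp add: quotient_algebra_def FactRing_def ideal.rcoset_mult_add[OF I])

lemma quotient_one: "\<one>\<^bsub>quotient_algebra A I\<^esub> = I +> \<one>"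
  by (simp add: quotient_algebra_def FactRing_def)

lemma quotient_eq_iff: "x \<in> carrier A \<Longrightarrow> y \<in> carrier A \<Longrightarrow> I +> x = I +> y \<longleftrightarrow> x \<ominus> y \<in> I"
  using quotient_eq_iff_same_a_r_cos[OF I] by simp

lemma quotient_zero: "\<zero>\<^bsub>quotient_algebra A I\<^esub> = I +> \<zero>"
proof -
  interpret I: ideal I A by (rule I)
  show ?thesis
    by (simp add: quotient_algebra_def FactRing_def a_coset_add_zero I.a_subset)
qed

lemma quotient_smult: "x \<in> carrier A \<Longrightarrow> a \<odot>\<^bsub>quotient_algebra A I\<^esub> (I +> x) = I +> (a \<odot> x)"
proof -
  assume x: "x \<in> carrier A"
  interpret I: ideal I A by (rule I)
  have "I +> (a \<odot> z) = I +> (a \<odot> x)" if "z \<in> I +> x" for z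
  proof -
    obtain i where i: "i \<in> I" "z = i \<oplus> x" using \<open>z \<in> I +> x\<close> by (auto simp: a_r_coset_def')
    then have ic: "i \<in> carrier A" using I.Icarr by blast
    \<comment> \<open>A ring ideal is stable under scalars because multiplying by \<open>a\<close>
      is the same as multiplying by the ring element \<open>a \<odot> \<one>\<close>.\<close>
    have "a \<odot> z \<ominus> a \<odot> x = (a \<odot> \<one>) \<otimes> i"
      using x ic i(2) by (simp add: smult_r_distr smult_mult_l minus_eq a_assoc r_neg)
    then have "a \<odot> z \<ominus> a \<odot> x \<in> I" using I.I_l_closed[OF i(1)] by simp
    then show ?thesis using quotient_eq_iff x ic i(2) by simp
  qed
  moreover have "x \<in> I +> x" using x by (rule I.a_rcos_self)
  ultimately have "(\<Union>z\<in>I +> x. I +> (a \<odot> z)) = I +> (a \<odot> x)" by blast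
  then show ?thesis by (simp add: quotient_algebra_def)
qed

lemma quotient_k_algebra: "k_algebra (quotient_algebra A I)"
  by (rule k_algebra_image[OF k_algebra quotient_carrier])
    (simp_all add: quotient_add quotient_mult quotient_one quotient_zero quotient_smult)

lemma quotient_hom: "(\<lambda>x. I +> x) \<in> ring_hom A (quotient_algebra A I)"
  by (rule ring_hom_memI) (simp_all add: quotient_carrier quotient_add quotient_mult quotient_one)

lemma quotient_ideal:
  assumes J: "ideal J A"
  shows "ideal ((\<lambda>x. I +> x) ` J) (quotient_algebra A I)"
proof -
  interpret Q: kalg "quotient_algebra A I" by (rule kalg.intro[OF quotient_k_algebra])
  interpret J: ideal J A by (rule J)
  interpret h: ring_hom_ring A "quotient_algebra A I" "\<lambda>x. I +> x"
    by (rule ring_hom_ringI2[OF ring_axioms Q.ring_axioms quotient_hom])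
  show ?thesis
  proof (rule idealI[OF Q.ring_axioms])
    show "subgroup ((\<lambda>x. I +> x) ` J) (add_monoid (quotient_algebra A I))"
      by (rule h.img_is_add_subgroup[OF J.a_subgroup])
  next
    fix a x assume "a \<in> (\<lambda>x. I +> x) ` J" "x \<in> carrier (quotient_algebra A I)"
    then obtain j y where j: "j \<in> J" "a = I +> j" and y: "y \<in> carrier A" "x = I +> y"
      unfolding quotient_carrier by blast
    have "x \<otimes>\<^bsub>quotient_algebra A I\<^esub> a = I +> (y \<otimes> j)" "a \<otimes>\<^bsub>quotient_algebra A I\<^esub> x = I +> (j \<otimes> y)"
      unfolding j(2) y(2) by (intro quotient_mult y(1) J.Icarr[OF j(1)])+
    then show "x \<otimes>\<^bsub>quotient_algebra A I\<^esub> a \<in> (\<lambda>x. I +> x) ` J"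
      and "a \<otimes>\<^bsub>quotient_algebra A I\<^esub> x \<in> (\<lambda>x. I +> x) ` J"
      using J.I_l_closed[OF j(1) y(1)] J.I_r_closed[OF j(1) y(1)] by simp_all
  qed
qed

end

end

section \<open>Convolution of functions on words\<close>

definition conv :: "('v list \<Rightarrow> 'k::field) \<Rightarrow> ('v list \<Rightarrow> 'k) \<Rightarrow> 'v list \<Rightarrow> 'k" where
  "conv f g w = (\<Sum>i\<le>length w. f (take i w) * g (drop i w))"

lemma free_algebra_simps [simp]:
  "carrier free_algebra = {f. finite {w. f w \<noteq> 0}}" "monoid.mult free_algebra = conv"
  "one free_algebra = word []" "ring.zero free_algebra = (\<lambda>w. 0)"
  "add free_algebra = (\<lambda>f g w. f w + g w)" "module.smult free_algebra = (\<lambda>a f w. a * f w)"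
  by (simp_all add: free_algebra_def conv_def word_def fun_eq_iff)

lemma conv_Nil: "conv f g [] = f [] * g []"
  by (simp add: conv_def)

lemma conv_Cons: "conv f g (x # w) = f [] * g (x # w) + conv (\<lambda>u. f (x # u)) g w"
  unfolding conv_def length_Cons sum.atMost_Suc_shift by simp

lemma conv_add_left: "conv (\<lambda>u. f u + f' u) g w = conv f g w + conv f' g w"
  by (simp add: conv_def algebra_simps sum.distrib)

lemma conv_add_right: "conv f (\<lambda>u. g u + g' u) w = conv f g w + conv f g' w"
  by (simp add: conv_def algebra_simps sum.distrib)

lemma conv_smult_left: "conv (\<lambda>u. a * f u) g w = a * conv f g w"
  by (simp add: conv_def algebra_simps sum_distrib_left)

lemma conv_smult_right: "conv f (\<lambda>u. a * g u) w = a * conv f g w"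
  by (simp add: conv_def algebra_simps sum_distrib_left)

text \<open>By \<open>conv_Cons\<close>, removing the first letter \<open>x\<close> replaces
  \<open>f\<close> by the function \<open>\<lambda>u. f (x # u)\<close>; the induction therefore has
  to run over all \<open>f\<close>.\<close>

lemma conv_assoc: "conv (conv f g) h w = conv f (conv g h) w"
proof (induction w arbitrary: f)
  case (Cons x w)
  have "conv (conv f g) h (x # w) = f [] * g [] * h (x # w) +
      conv (\<lambda>u. f [] * g (x # u) + conv (\<lambda>u. f (x # u)) g u) h w"
    by (simp add: conv_Cons conv_Nil)
  also have "\<dots> = f [] * conv g h (x # w) + conv (\<lambda>u. f (x # u)) (conv g h) w"
    by (simp add: conv_add_left conv_smult_left Cons.IH conv_Cons[of g] algebra_simps)
  finally show ?case by (simp add: conv_Cons)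
qed (simp add: conv_Nil)

lemma conv_word_Nil_left: "conv (word []) g w = g w"
proof (cases w)
  case (Cons x v)
  have "conv (\<lambda>u. word [] (x # u)) g v = 0" by (simp add: conv_def word_def)
  then show ?thesis by (simp add: Cons conv_Cons word_def)
qed (simp add: conv_Nil word_def)

lemma conv_word_Nil_right: "conv f (word []) w = f w"
  by (induction w arbitrary: f) (simp_all add: conv_Nil conv_Cons, simp_all add: word_def)

lemma conv_word_Cons: "conv (word [v]) (word u) = (word (v # u) :: 'v list \<Rightarrow> 'k::field)"
proof
  fix w
  show "conv (word [v]) (word u) w = (word (v # u) w :: 'k)"
  proof (cases w)
    case (Cons x w')
    have "(\<lambda>u. word [v] (x # u)) = (\<lambda>u. (if x = v then 1 else 0 :: 'k) * word [] u)"
      by (auto simp: word_def)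
    then show ?thesis
      by (simp add: Cons conv_Cons conv_smult_left conv_word_Nil_left) (simp add: word_def)
  qed (simp add: conv_Nil word_def)
qed

lemma conv_nonzero:
  assumes "conv f g w \<noteq> 0"
  obtains u v where "w = u @ v" "f u \<noteq> 0" "g v \<noteq> 0"
proof -
  obtain i where "f (take i w) * g (drop i w) \<noteq> 0"
    using assms unfolding conv_def by (meson sum.neutral)
  then show ?thesis using that[of "take i w" "drop i w"] by auto
qed

lemma finite_support_conv:
  assumes "finite {w. f w \<noteq> 0}" "finite {w. g w \<noteq> 0}"
  shows "finite {w. conv f g w \<noteq> 0}"
proof (rule finite_subset)
  show "{w. conv f g w \<noteq> 0} \<subseteq> (\<lambda>(u, v). u @ v) ` ({w. f w \<noteq> 0} \<times> {w. g w \<noteq> 0})"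
    by (auto elim!: conv_nonzero)
qed (use assms in auto)

lemma finite_support_add:
  assumes "finite {w. f w \<noteq> 0}" "finite {w. g w \<noteq> 0}"
  shows "finite {w. f w + g w \<noteq> (0::'k::field)}"
  by (rule finite_subset[OF _ finite_UnI[OF assms]]) auto

lemma finite_support_smult:
  assumes "finite {w. f w \<noteq> 0}"
  shows "finite {w. a * f w \<noteq> (0::'k::field)}"
  by (rule finite_subset[OF _ assms]) auto

lemma finite_support_word [simp]: "finite {w. word u w \<noteq> (0::'k::field)}"
  by (rule finite_subset[of _ "{u}"]) (auto simp: word_def)

lemma kalg_free: "kalg (free_algebra :: ('k::field, 'v list \<Rightarrow> 'k) module)"
proof
  let ?A = "free_algebra :: ('k, 'v list \<Rightarrow> 'k) module"
  have ag: "abelian_group ?A"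
  proof (rule abelian_groupI)
    fix f assume f: "f \<in> carrier ?A"
    then have "(\<lambda>w. - f w) \<in> carrier ?A" "(\<lambda>w. - f w) \<oplus>\<^bsub>?A\<^esub> f = \<zero>\<^bsub>?A\<^esub>" by auto
    then show "\<exists>g\<in>carrier ?A. g \<oplus>\<^bsub>?A\<^esub> f = \<zero>\<^bsub>?A\<^esub>" by blast
  qed (auto simp: finite_support_add add_ac)
  have r: "ring ?A"
  proof (rule ringI[OF ag])
    show "Group.monoid ?A"
      by (rule monoidI)
        (auto simp: finite_support_conv conv_assoc[abs_def] conv_word_Nil_left[abs_def]
          conv_word_Nil_right[abs_def] fun_eq_iff conv_assoc)
  qed (auto simp: conv_add_left conv_add_right fun_eq_iff)
  have "Module.module (ring_of_type_algebra :: 'k ring) ?A"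
    by (rule moduleI[OF cring_from_type_algebra ag]) (auto simp: finite_support_smult algebra_simps)
  then show "k_algebra ?A"
    unfolding k_algebra_def using r by (simp add: conv_smult_left conv_smult_right fun_eq_iff)
qed

section \<open>The Clifford algebra\<close>

context bilinear_space
begin

abbreviation "Fr \<equiv> free_algebra :: ('k, 'v list \<Rightarrow> 'k) module"
abbreviation "LI \<equiv> linearity_ideal scale"
abbreviation "T \<equiv> tensor_algebra scale"
abbreviation "CI \<equiv> clifford_ideal scale F"
abbreviation "Cl \<equiv> clifford_algebra scale F"

sublocale Fr: kalg Fr by (rule kalg_free)

lemma lin_gens:
  "{word [v + w] - word [v] - word [w] | v w. True} \<union>
   {word [scale a v] - (\<lambda>u. a * word [v] u) | a v. True} \<subseteq> carrier Fr"
proof -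
  have "finite {u. (word [v + w] - word [v] - word [w]) u \<noteq> (0::'k)}" for v w :: 'v
    by (rule finite_subset[of _ "{[v + w], [v], [w]}"]) (auto simp: word_def split: if_splits)
  moreover have "finite {u. (word [scale a v] - (\<lambda>u. a * word [v] u)) u \<noteq> (0::'k)}" for a v
    by (rule finite_subset[of _ "{[scale a v], [v]}"]) (auto simp: word_def split: if_splits)
  ultimately show ?thesis by auto
qed

lemma ideal_LI: "ideal LI Fr"
  unfolding linearity_ideal_def by (rule Fr.genideal_ideal[OF lin_gens])

sublocale T: kalg T
  unfolding tensor_algebra_def by (rule kalg.intro[OF Fr.quotient_k_algebra[OF ideal_LI]])

lemma T_carrier: "carrier T = tensor_class scale ` carrier Fr"
  unfolding tensor_algebra_def tensor_class_def by (rule Fr.quotient_carrier[OF ideal_LI])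

lemma T_ops:
  assumes "f \<in> carrier Fr" "g \<in> carrier Fr"
  shows "tensor_class scale f \<oplus>\<^bsub>T\<^esub> tensor_class scale g = tensor_class scale (f \<oplus>\<^bsub>Fr\<^esub> g)"
    "tensor_class scale f \<otimes>\<^bsub>T\<^esub> tensor_class scale g = tensor_class scale (f \<otimes>\<^bsub>Fr\<^esub> g)"
    "a \<odot>\<^bsub>T\<^esub> tensor_class scale f = tensor_class scale (a \<odot>\<^bsub>Fr\<^esub> f)"
  unfolding tensor_algebra_def tensor_class_def
  by (intro Fr.quotient_add[OF ideal_LI] Fr.quotient_mult[OF ideal_LI] Fr.quotient_smult[OF ideal_LI] assms)+

lemma T_one: "\<one>\<^bsub>T\<^esub> = tensor_class scale \<one>\<^bsub>Fr\<^esub>" and T_zero: "\<zero>\<^bsub>T\<^esub> = tensor_class scale \<zero>\<^bsub>Fr\<^esub>"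
  unfolding tensor_algebra_def tensor_class_def
  by (rule Fr.quotient_one[OF ideal_LI], rule Fr.quotient_zero[OF ideal_LI])

abbreviation cliff_gen :: "'v \<Rightarrow> ('v list \<Rightarrow> 'k) set" where
  "cliff_gen v \<equiv> (vec_tensor scale v \<otimes>\<^bsub>T\<^esub> vec_tensor scale v) \<ominus>\<^bsub>T\<^esub> (Q v \<odot>\<^bsub>T\<^esub> \<one>\<^bsub>T\<^esub>)"

lemma word_carrier: "word u \<in> carrier Fr"
  by simp

lemma vec_tensor_carrier: "vec_tensor scale v \<in> carrier T"
  unfolding T_carrier by (rule imageI) (rule word_carrier)

lemma cliff_gens: "{cliff_gen v | v. True} \<subseteq> carrier T"
  using vec_tensor_carrier by auto

lemma CI_eq: "CI = Idl\<^bsub>T\<^esub> {cliff_gen v | v. True}"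
  by (simp add: clifford_ideal_def Let_def)

lemma ideal_CI: "ideal CI T"
  unfolding CI_eq by (rule T.genideal_ideal[OF cliff_gens])

sublocale C: kalg Cl
  unfolding clifford_algebra_def by (rule kalg.intro[OF T.quotient_k_algebra[OF ideal_CI]])

text \<open>This composite of the two quotient maps allows computation with words directly in the
  Clifford algebra, past the intermediate tensor algebra.\<close>

definition cl :: "('v list \<Rightarrow> 'k) \<Rightarrow> ('v list \<Rightarrow> 'k) set set" where
  "cl f = CI +>\<^bsub>T\<^esub> tensor_class scale f"

lemma tc_carrier: "f \<in> carrier Fr \<Longrightarrow> tensor_class scale f \<in> carrier T"
  unfolding T_carrier by (rule imageI)

lemma cl_carrier: "f \<in> carrier Fr \<Longrightarrow> cl f \<in> carrier Cl"
  unfolding clifford_algebra_def T.quotient_carrier[OF ideal_CI] cl_def by (intro imageI tc_carrier)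

lemma cl_ops:
  assumes "f \<in> carrier Fr" "g \<in> carrier Fr"
  shows "cl (f \<oplus>\<^bsub>Fr\<^esub> g) = cl f \<oplus>\<^bsub>Cl\<^esub> cl g" "cl (f \<otimes>\<^bsub>Fr\<^esub> g) = cl f \<otimes>\<^bsub>Cl\<^esub> cl g"
    "cl (a \<odot>\<^bsub>Fr\<^esub> f) = a \<odot>\<^bsub>Cl\<^esub> cl f"
  unfolding clifford_algebra_def cl_def T_ops[OF assms, symmetric]
  by (intro T.quotient_add[OF ideal_CI, symmetric] T.quotient_mult[OF ideal_CI, symmetric]
      T.quotient_smult[OF ideal_CI, symmetric] tc_carrier assms)+

lemma cl_one: "cl (word []) = \<one>\<^bsub>Cl\<^esub>"
  unfolding clifford_algebra_def T.quotient_one[OF ideal_CI] T_one cl_def by simp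

lemma cl_LI: "f \<in> LI \<Longrightarrow> cl f = \<zero>\<^bsub>Cl\<^esub>"
proof -
  assume f: "f \<in> LI"
  interpret LI: ideal LI Fr by (rule ideal_LI)
  have fc: "f \<in> carrier Fr" using LI.Icarr[OF f] .
  have "f \<ominus>\<^bsub>Fr\<^esub> \<zero>\<^bsub>Fr\<^esub> = f" using fc by (simp only: Fr.minus_eq Fr.minus_zero Fr.r_zero)
  then have "tensor_class scale f = tensor_class scale \<zero>\<^bsub>Fr\<^esub>"
    unfolding tensor_class_def using Fr.quotient_eq_iff[OF ideal_LI fc Fr.zero_closed] f by simp
  then show ?thesis
    unfolding cl_def clifford_algebra_def T.quotient_zero[OF ideal_CI] T_zero by simp
qed

definition \<iota> :: "'v \<Rightarrow> ('v list \<Rightarrow> 'k) set set" where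
  "\<iota> v = cl (word [v])"

lemma \<iota>_carrier [simp]: "\<iota> v \<in> carrier Cl"
  unfolding \<iota>_def by (rule cl_carrier[OF word_carrier])

lemma \<iota>_add: "\<iota> (v + w) = \<iota> v \<oplus>\<^bsub>Cl\<^esub> \<iota> w"
proof -
  let ?r = "word [v + w] - word [v] - word [w] :: 'v list \<Rightarrow> 'k"
  have r: "?r \<in> LI"
    unfolding linearity_ideal_def by (rule subsetD[OF Fr.genideal_self[OF lin_gens]]) blast
  have rc: "?r \<in> carrier Fr" using lin_gens by blast
  have "word [v + w] = ?r \<oplus>\<^bsub>Fr\<^esub> (word [v] \<oplus>\<^bsub>Fr\<^esub> word [w])" by (simp add: fun_eq_iff)
  then have "\<iota> (v + w) = cl ?r \<oplus>\<^bsub>Cl\<^esub> (\<iota> v \<oplus>\<^bsub>Cl\<^esub> \<iota> w)"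
    unfolding \<iota>_def
    by (metis cl_ops(1) rc word_carrier Fr.a_closed)
  then show ?thesis by (simp add: cl_LI[OF r])
qed

lemma \<iota>_scale: "\<iota> (scale a v) = a \<odot>\<^bsub>Cl\<^esub> \<iota> v"
proof -
  let ?r = "word [scale a v] - (\<lambda>u. a * word [v] u) :: 'v list \<Rightarrow> 'k"
  have r: "?r \<in> LI"
    unfolding linearity_ideal_def by (rule subsetD[OF Fr.genideal_self[OF lin_gens]]) blast
  have rc: "?r \<in> carrier Fr" using lin_gens by blast
  have "word [scale a v] = ?r \<oplus>\<^bsub>Fr\<^esub> (a \<odot>\<^bsub>Fr\<^esub> word [v])" by (simp add: fun_eq_iff)
  then have "\<iota> (scale a v) = cl ?r \<oplus>\<^bsub>Cl\<^esub> (a \<odot>\<^bsub>Cl\<^esub> \<iota> v)"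
    unfolding \<iota>_def
    by (metis cl_ops(1,3) rc word_carrier Fr.smult_closed)
  then show ?thesis by (simp add: cl_LI[OF r])
qed

lemma \<iota>_square: "\<iota> v \<otimes>\<^bsub>Cl\<^esub> \<iota> v = Q v \<odot>\<^bsub>Cl\<^esub> \<one>\<^bsub>Cl\<^esub>"
proof -
  let ?v = "vec_tensor scale v"
  have "cliff_gen v \<in> CI"
    unfolding CI_eq by (rule subsetD[OF T.genideal_self[OF cliff_gens]]) blast
  then have "CI +>\<^bsub>T\<^esub> (?v \<otimes>\<^bsub>T\<^esub> ?v) = CI +>\<^bsub>T\<^esub> (Q v \<odot>\<^bsub>T\<^esub> \<one>\<^bsub>T\<^esub>)"
    using vec_tensor_carrier by (subst T.quotient_eq_iff[OF ideal_CI]) auto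
  moreover have "CI +>\<^bsub>T\<^esub> (?v \<otimes>\<^bsub>T\<^esub> ?v) = \<iota> v \<otimes>\<^bsub>Cl\<^esub> \<iota> v"
    unfolding clifford_algebra_def \<iota>_def cl_def
    by (rule T.quotient_mult[OF ideal_CI vec_tensor_carrier vec_tensor_carrier, symmetric])
  moreover have "CI +>\<^bsub>T\<^esub> (Q v \<odot>\<^bsub>T\<^esub> \<one>\<^bsub>T\<^esub>) = Q v \<odot>\<^bsub>Cl\<^esub> \<one>\<^bsub>Cl\<^esub>"
    unfolding clifford_algebra_def T.quotient_one[OF ideal_CI]
    by (rule T.quotient_smult[OF ideal_CI T.one_closed, symmetric])
  ultimately show ?thesis by simp
qed

lemma \<iota>_polar: "\<iota> v \<otimes>\<^bsub>Cl\<^esub> \<iota> w \<oplus>\<^bsub>Cl\<^esub> \<iota> w \<otimes>\<^bsub>Cl\<^esub> \<iota> v = F v w \<odot>\<^bsub>Cl\<^esub> \<one>\<^bsub>Cl\<^esub>"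
proof -
  let ?a = "\<iota> v \<otimes>\<^bsub>Cl\<^esub> \<iota> v" and ?b = "\<iota> w \<otimes>\<^bsub>Cl\<^esub> \<iota> w"
    and ?m = "\<iota> v \<otimes>\<^bsub>Cl\<^esub> \<iota> w \<oplus>\<^bsub>Cl\<^esub> \<iota> w \<otimes>\<^bsub>Cl\<^esub> \<iota> v"
  have Qa: "Q (v + w) = F v w + (Q v + Q w)"
    by (simp add: Q_add)
  have "?m \<oplus>\<^bsub>Cl\<^esub> (?a \<oplus>\<^bsub>Cl\<^esub> ?b) = \<iota> (v + w) \<otimes>\<^bsub>Cl\<^esub> \<iota> (v + w)"
    unfolding \<iota>_add by (simp add: C.l_distr C.r_distr C.a_ac)
  also have "\<dots> = F v w \<odot>\<^bsub>Cl\<^esub> \<one>\<^bsub>Cl\<^esub> \<oplus>\<^bsub>Cl\<^esub> (?a \<oplus>\<^bsub>Cl\<^esub> ?b)"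
    unfolding \<iota>_square Qa by (simp add: C.smult_l_distr)
  finally show ?thesis by simp
qed

lemma \<iota>_anticommute: "F v w = 0 \<Longrightarrow> C.anticommutes (\<iota> v) (\<iota> w)"
  using \<iota>_polar[of v w] unfolding C.anticommutes_def by (simp add: C.minus_equality)

section \<open>The even part and its generation by products of two vectors\<close>

definition even_part :: "('v list \<Rightarrow> 'k) set set set" where
  "even_part = cl ` {f \<in> carrier Fr. \<forall>w. f w \<noteq> 0 \<longrightarrow> even (length w)}"

lemma even_clifford_eq: "even_clifford_algebra scale F = Cl\<lparr>carrier := even_part\<rparr>"
  unfolding even_clifford_algebra_def even_part_def even_tensors_def cl_def image_image ..

lemma even_partI: "f \<in> carrier Fr \<Longrightarrow> (\<And>w. f w \<noteq> 0 \<Longrightarrow> even (length w)) \<Longrightarrow> cl f \<in> even_part"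
  unfolding even_part_def by blast

lemma even_partE:
  assumes "x \<in> even_part"
  obtains f where "f \<in> carrier Fr" "\<forall>w. f w \<noteq> 0 \<longrightarrow> even (length w)" "x = cl f"
  using assms unfolding even_part_def by blast

lemma subalg_even: "C.subalg even_part"
  unfolding C.subalg_def
proof (intro conjI ballI allI subsetI)
  show "x \<in> carrier Cl" if "x \<in> even_part" for x
    using that cl_carrier by (elim even_partE) simp
  show "\<one>\<^bsub>Cl\<^esub> \<in> even_part"
    unfolding cl_one[symmetric] by (rule even_partI) (auto simp: word_def split: if_splits)
next
  fix a x assume "x \<in> even_part"
  then show "a \<odot>\<^bsub>Cl\<^esub> x \<in> even_part"
  proof (rule even_partE)
    fix f assume f: "f \<in> carrier Fr" "\<forall>w. f w \<noteq> 0 \<longrightarrow> even (length w)" "x = cl f"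
    show ?thesis
      unfolding f(3) cl_ops(3)[OF f(1) f(1), symmetric]
      by (rule even_partI[OF Fr.smult_closed[OF f(1)]]) (use f(2) in auto)
  qed
next
  fix x y assume x: "x \<in> even_part" and y: "y \<in> even_part"
  from x obtain f where f: "f \<in> carrier Fr" "\<forall>w. f w \<noteq> 0 \<longrightarrow> even (length w)" "x = cl f"
    by (rule even_partE)
  from y obtain g where g: "g \<in> carrier Fr" "\<forall>w. g w \<noteq> 0 \<longrightarrow> even (length w)" "y = cl g"
    by (rule even_partE)
  show "x \<oplus>\<^bsub>Cl\<^esub> y \<in> even_part"
    unfolding f(3) g(3) cl_ops(1)[OF f(1) g(1), symmetric]
  proof (rule even_partI[OF Fr.a_closed[OF f(1) g(1)]])
    fix w assume "(f \<oplus>\<^bsub>Fr\<^esub> g) w \<noteq> 0"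
    then show "even (length w)" using f(2) g(2) by (cases "f w = 0") auto
  qed
  show "x \<otimes>\<^bsub>Cl\<^esub> y \<in> even_part"
    unfolding f(3) g(3) cl_ops(2)[OF f(1) g(1), symmetric]
  proof (rule even_partI[OF Fr.m_closed[OF f(1) g(1)]])
    fix w assume "(f \<otimes>\<^bsub>Fr\<^esub> g) w \<noteq> 0"
    then have "conv f g w \<noteq> 0" by simp
    then show "even (length w)"
    proof (rule conv_nonzero)
      fix u v assume "w = u @ v" "f u \<noteq> 0" "g v \<noteq> 0"
      then show ?thesis using f(2) g(2) by simp
    qed
  qed
qed

lemma \<iota>_mult_even: "\<iota> v \<otimes>\<^bsub>Cl\<^esub> \<iota> w \<in> even_part"
  unfolding even_part_def
proof (rule image_eqI[of _ _ "word [v, w]"])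
  show "\<iota> v \<otimes>\<^bsub>Cl\<^esub> \<iota> w = cl (word [v, w])"
    unfolding \<iota>_def conv_word_Cons[symmetric, of v "[w]"]
    using cl_ops(2)[OF word_carrier word_carrier, of "[v]" "[w]"] by simp
qed (auto simp: word_def[of "[v, w]"])

lemma cl_word_Cons: "cl (word (v # u)) = \<iota> v \<otimes>\<^bsub>Cl\<^esub> cl (word u)"
  using cl_ops(2)[OF word_carrier word_carrier, of "[v]" u] by (simp add: conv_word_Cons \<iota>_def)

text \<open>A word of even length is a product of pairs of letters, and an even element is a finite
  linear combination of such words, built up along its support.\<close>

lemma even_part_generated:
  assumes S: "C.subalg S" and gen: "\<And>v w. \<iota> v \<otimes>\<^bsub>Cl\<^esub> \<iota> w \<in> S"
  shows "even_part \<subseteq> S"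
proof -
  have word: "even (length u) \<Longrightarrow> cl (word u) \<in> S" for u
  proof (induction u rule: induct_list012)
    case 1
    show ?case using C.subalgD(2)[OF S] by (simp add: cl_one)
  next
    case (3 v w u)
    have "cl (word (v # w # u)) = (\<iota> v \<otimes>\<^bsub>Cl\<^esub> \<iota> w) \<otimes>\<^bsub>Cl\<^esub> cl (word u)"
      by (simp add: cl_word_Cons C.m_assoc cl_carrier)
    then show ?case using 3 gen C.subalgD(4)[OF S] by simp
  qed simp
  have "cl f \<in> S" if "finite W" "{w. f w \<noteq> 0} \<subseteq> W" "\<And>w. f w \<noteq> 0 \<Longrightarrow> even (length w)" for W f
    using that
  proof (induction W arbitrary: f rule: finite_induct)
    case empty
    then have f: "f = 0 \<odot>\<^bsub>Fr\<^esub> word []" by (auto simp: fun_eq_iff)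
    have "cl f = 0 \<odot>\<^bsub>Cl\<^esub> \<one>\<^bsub>Cl\<^esub>"
      unfolding f cl_ops(3)[OF word_carrier word_carrier] cl_one ..
    then show ?case using C.subalgD(6)[OF S] by simp
  next
    case (insert u W)
    define g where "g = f(u := 0)"
    have gW: "{w. g w \<noteq> 0} \<subseteq> W" using insert.prems(1) by (auto simp: g_def)
    have gc: "g \<in> carrier Fr" using finite_subset[OF gW insert.hyps(1)] by simp
    have "cl g \<in> S"
      by (rule insert.IH[OF gW]) (use insert.prems(2) in \<open>auto simp: g_def split: if_splits\<close>)
    moreover have "f u \<odot>\<^bsub>Cl\<^esub> cl (word u) \<in> S"
    proof (cases "f u = 0")
      case True
      then show ?thesis using C.subalgD(6)[OF S] cl_carrier[OF word_carrier] by simp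
    next
      case False
      then show ?thesis using word[OF insert.prems(2)] C.subalgD(5)[OF S] by blast
    qed
    moreover have "f = g \<oplus>\<^bsub>Fr\<^esub> (f u \<odot>\<^bsub>Fr\<^esub> word u)" by (auto simp: g_def fun_eq_iff word_def)
    then have "cl f = cl g \<oplus>\<^bsub>Cl\<^esub> (f u \<odot>\<^bsub>Cl\<^esub> cl (word u))"
      using cl_ops(1)[OF gc Fr.smult_closed[OF word_carrier]] cl_ops(3)[OF word_carrier word_carrier]
      by metis
    ultimately show ?case using C.subalgD(3)[OF S] by simp
  qed
  then show ?thesis unfolding even_part_def by auto
qed

end

section \<open>The Clifford algebra is nonzero\<close>

text \<open>A word \<open>w\<close> with a cut at \<open>i\<close> corresponds to the pair
  \<open>(take i w, drop i w)\<close>. Cuts that yield pairs outside the two supports contribute 0,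
  which accounts for the difference between the index sets.\<close>

lemma sum_conv:
  fixes f g :: "'v list \<Rightarrow> 'k::field"
  assumes f: "finite {w. f w \<noteq> 0}" and g: "finite {w. g w \<noteq> 0}"
  shows "(\<Sum>w | conv f g w \<noteq> 0. conv f g w * h w) =
    (\<Sum>u | f u \<noteq> 0. \<Sum>v | g v \<noteq> 0. f u * g v * h (u @ v))"
proof -
  let ?A = "{w. f w \<noteq> 0}" and ?B = "{w. g w \<noteq> 0}"
  let ?W = "(\<lambda>(u, v). u @ v) ` (?A \<times> ?B)"
  let ?S = "Sigma ?W (\<lambda>w. {..length w})"
  let ?t = "\<lambda>(w, i). (take i w, drop i w)"
  have W: "finite ?W" using f g by simp
  have "(\<Sum>w | conv f g w \<noteq> 0. conv f g w * h w) = (\<Sum>w\<in>?W. conv f g w * h w)"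
    using W by (intro sum.mono_neutral_left) (auto elim!: conv_nonzero)
  also have "\<dots> = (\<Sum>w\<in>?W. \<Sum>i\<le>length w. f (take i w) * g (drop i w) * h w)"
    by (simp add: conv_def sum_distrib_right)
  also have "\<dots> = (\<Sum>(w, i)\<in>?S. f (take i w) * g (drop i w) * h w)"
    using W by (subst sum.Sigma) auto
  also have "\<dots> = (\<Sum>x\<in>?S. (\<lambda>(u, v). f u * g v * h (u @ v)) (?t x))"
    by (rule sum.cong) (auto simp del: take_append drop_append)
  also have "\<dots> = (\<Sum>x\<in>?t ` ?S. (\<lambda>(u, v). f u * g v * h (u @ v)) x)"
  proof (rule sum.reindex[symmetric, unfolded comp_def])
    show "inj_on ?t ?S"
    proof (rule inj_onI)
      fix a b assume ab: "a \<in> ?S" "b \<in> ?S" "?t a = ?t b"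
      obtain w i w' j where eq: "a = (w, i)" "b = (w', j)" by (cases a, cases b)
      have len: "i \<le> length w" "j \<le> length w'" using ab(1,2) unfolding eq by auto
      have t: "take i w = take j w'" "drop i w = drop j w'" using ab(3) unfolding eq by auto
      have "w = w'" using t append_take_drop_id by metis
      moreover have "i = j" using arg_cong[OF t(1), of length] len by simp
      ultimately show "a = b" by (simp add: eq)
    qed
  qed
  also have "\<dots> = (\<Sum>(u, v)\<in>?A \<times> ?B. f u * g v * h (u @ v))"
  proof (rule sum.mono_neutral_right)
    show "finite (?t ` ?S)" using f g by (intro finite_imageI finite_SigmaI) auto
    show "?A \<times> ?B \<subseteq> ?t ` ?S"
    proof
      fix x assume x: "x \<in> ?A \<times> ?B"
      then obtain u v where uv: "x = (u, v)" "u \<in> ?A" "v \<in> ?B" by blast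
      have "(u @ v, length u) \<in> ?S" using uv by auto
      moreover have "x = ?t (u @ v, length u)" using uv by simp
      ultimately show "x \<in> ?t ` ?S" by (rule rev_image_eqI)
    qed
  qed auto
  also have "\<dots> = (\<Sum>u | f u \<noteq> 0. \<Sum>v | g v \<noteq> 0. f u * g v * h (u @ v))"
    by (rule sum.cartesian_product[symmetric])
  finally show ?thesis .
qed

text \<open>
  The Clifford algebra of a diagonal form \<open>\<Sum>d\<^sub>j x\<^sub>j\<^sup>2\<close> acts on functions on sets of natural numbers:
  the \<open>j\<close>-th basis vector toggles the membership of \<open>j\<close>, with a sign counting the smaller elements.
\<close>

definition toggle :: "nat \<Rightarrow> nat set \<Rightarrow> nat set" where
  "toggle j S = (if j \<in> S then S - {j} else insert j S)"

definition coef :: "(nat \<Rightarrow> 'k::field) \<Rightarrow> nat \<Rightarrow> nat set \<Rightarrow> 'k" where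
  "coef d j S = (\<Prod>i<j. if i \<in> S then -1 else 1) * (if j \<in> S then d j else 1)"

lemma toggle_commute: "toggle j (toggle k S) = toggle k (toggle j S)"
  by (auto simp: toggle_def)

lemma toggle_toggle: "toggle j (toggle j S) = S"
  by (auto simp: toggle_def)

lemma toggle_iff: "i \<in> toggle j S \<longleftrightarrow> (if i = j then i \<notin> S else i \<in> S)"
  by (auto simp: toggle_def)

text \<open>Exactly one of \<open>S\<close> and \<open>toggle j S\<close> contains \<open>j\<close>,
  so the factor \<open>d j\<close> occurs once; the signs see only indices below \<open>j\<close>
  and square to 1.\<close>

lemma coef_same: "coef d j S * coef d j (toggle j S) = d j"
proof -
  have "(\<Prod>i<j. if i \<in> S then -1 else (1::'a)) * (\<Prod>i<j. if i \<in> S then -1 else 1) = 1"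
    by (simp add: prod.distrib[symmetric] if_distrib cong: if_cong)
  moreover have "(\<Prod>i<j. if i \<in> toggle j S then -1 else (1::'a)) = (\<Prod>i<j. if i \<in> S then -1 else 1)"
    by (intro prod.cong) (auto simp: toggle_iff)
  ultimately show ?thesis
    by (auto simp: coef_def toggle_iff mult_ac)
qed

lemma coef_toggle_less:
  assumes "j < k"
  shows "coef d j (toggle k S) = coef d j S" "coef d k (toggle j S) = - coef d k S"
proof -
  show "coef d j (toggle k S) = coef d j S"
    using assms by (auto simp: coef_def toggle_iff intro!: prod.cong)
  have "(\<Prod>i<k. if i \<in> toggle j S then -1 else (1::'a)) =
      (if j \<in> toggle j S then -1 else 1) * (\<Prod>i\<in>{..<k} - {j}. if i \<in> toggle j S then -1 else 1)"
    using assms by (intro prod.remove) auto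
  also have "(\<Prod>i\<in>{..<k} - {j}. if i \<in> toggle j S then -1 else (1::'a)) =
      (\<Prod>i\<in>{..<k} - {j}. if i \<in> S then -1 else 1)"
    by (intro prod.cong) (auto simp: toggle_iff)
  also have "(if j \<in> toggle j S then -1 else 1) * \<dots> =
      - ((if j \<in> S then -1 else 1) * (\<Prod>i\<in>{..<k} - {j}. if i \<in> S then -1 else 1))"
    by (simp add: toggle_iff)
  also have "(if j \<in> S then -1 else 1) * (\<Prod>i\<in>{..<k} - {j}. if i \<in> S then -1 else (1::'a)) =
      (\<Prod>i<k. if i \<in> S then -1 else 1)"
    using assms by (intro prod.remove[symmetric]) auto
  finally show "coef d k (toggle j S) = - coef d k S"
    using assms by (simp add: coef_def toggle_iff)
qed

text \<open>Toggling the smaller index flips the sign seen by the larger one but not conversely, so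
  exchanging the order costs precisely one sign.\<close>

lemma coef_anti:
  assumes "j \<noteq> k"
  shows "coef d j S * coef d k (toggle j S) = - (coef d k S * coef d j (toggle k S))"
  using assms coef_toggle_less[of j k d S] coef_toggle_less[of k j d S]
  by (cases j k rule: linorder_cases) (auto simp: mult.commute)

section \<open>A module over the Clifford algebra of a diagonal form\<close>

context bilinear_space
begin

context
  fixes n :: nat and l :: "nat \<Rightarrow> 'v \<Rightarrow> 'k" and d :: "nat \<Rightarrow> 'k"
  assumes l_add: "\<And>j v w. l j (v + w) = l j v + l j w"
    and l_scale: "\<And>j a v. l j (scale a v) = a * l j v"
    and diag: "\<And>v. Q v = (\<Sum>j<n. d j * (l j v)\<^sup>2)"
begin

definition act :: "'v \<Rightarrow> (nat set \<Rightarrow> 'k) \<Rightarrow> nat set \<Rightarrow> 'k" where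
  "act v \<psi> S = (\<Sum>j<n. l j v * coef d j S * \<psi> (toggle j S))"

lemma act_square: "act v (act v \<psi>) S = Q v * \<psi> S"
proof -
  define a where "a j k = l j v * l k v * (coef d j S * coef d k (toggle j S)) * \<psi> (toggle k (toggle j S))" for j k
  have anti: "a j k = - a k j" if "j \<noteq> k" for j k
    unfolding a_def coef_anti[OF that] toggle_commute[of k j] by simp
  have diag': "a j j = d j * (l j v)\<^sup>2 * \<psi> S" for j
    unfolding a_def coef_same toggle_toggle by (simp add: power2_eq_square)
  have eq: "act v (act v \<psi>) S = (\<Sum>j<n. \<Sum>k<n. a j k)"
    by (simp add: act_def a_def sum_distrib_left mult_ac)
  \<comment> \<open>Adding the double sum to its transpose cancels the antisymmetric off-diagonal
    terms and leaves twice the diagonal; since 2 is invertible, this determines the sum.\<close>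
  have "2 * (\<Sum>j<n. \<Sum>k<n. a j k) = (\<Sum>j<n. \<Sum>k<n. a j k) + (\<Sum>j<n. \<Sum>k<n. a k j)"
    by (subst (3) sum.swap) simp
  also have "\<dots> = (\<Sum>j<n. \<Sum>k<n. a j k + a k j)" by (simp add: sum.distrib)
  also have "\<dots> = (\<Sum>j<n. \<Sum>k<n. if j = k then 2 * a j j else 0)"
  proof (intro sum.cong refl)
    show "a j k + a k j = (if j = k then 2 * a j j else 0)" for j k
      using anti[of j k] by (cases "j = k") simp_all
  qed
  also have "\<dots> = 2 * (\<Sum>j<n. a j j)" by (simp add: sum_distrib_left)
  finally have "(\<Sum>j<n. \<Sum>k<n. a j k) = (\<Sum>j<n. a j j)" using two_nz by simp
  then show ?thesis
    unfolding eq diag' diag by (simp add: sum_distrib_right)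
qed

lemma act_sum: "act v (\<lambda>S. \<Sum>x\<in>I. c x * \<psi> x S) = (\<lambda>S. \<Sum>x\<in>I. c x * act v (\<psi> x) S)"
  by (rule ext) (simp add: act_def sum_distrib_left, subst sum.swap, simp add: mult_ac)

lemma act_word_sum:
  "foldr act u (\<lambda>S. \<Sum>x\<in>I. c x * \<psi> x S) = (\<lambda>S. \<Sum>x\<in>I. c x * foldr act u (\<psi> x) S)"
  by (induction u) (simp_all add: act_sum)

definition rep :: "('v list \<Rightarrow> 'k) \<Rightarrow> (nat set \<Rightarrow> 'k) \<Rightarrow> nat set \<Rightarrow> 'k" where
  "rep f \<psi> S = (\<Sum>w | f w \<noteq> 0. f w * foldr act w \<psi> S)"

lemma rep_superset:
  assumes "finite W" "{w. f w \<noteq> 0} \<subseteq> W"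
  shows "rep f \<psi> S = (\<Sum>w\<in>W. f w * foldr act w \<psi> S)"
  unfolding rep_def using assms by (intro sum.mono_neutral_left) auto

lemma rep_add:
  assumes "f \<in> carrier Fr" "g \<in> carrier Fr"
  shows "rep (\<lambda>w. f w + g w) \<psi> S = rep f \<psi> S + rep g \<psi> S"
proof -
  let ?W = "{w. f w \<noteq> 0} \<union> {w. g w \<noteq> 0}"
  have fin: "finite ?W" using assms by simp
  have "rep (\<lambda>w. f w + g w) \<psi> S = (\<Sum>w\<in>?W. (f w + g w) * foldr act w \<psi> S)"
    by (rule rep_superset[OF fin]) auto
  also have "\<dots> = rep f \<psi> S + rep g \<psi> S"
    by (subst (1 2) rep_superset[OF fin]) (auto simp: algebra_simps sum.distrib)
  finally show ?thesis .
qed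

lemma rep_smult: "f \<in> carrier Fr \<Longrightarrow> rep (\<lambda>w. a * f w) \<psi> S = a * rep f \<psi> S"
  by (subst rep_superset[of "{w. f w \<noteq> 0}"]) (auto simp: rep_def sum_distrib_left mult.assoc)

lemma rep_word: "rep (word u) = foldr act u"
proof (intro ext)
  fix \<psi> S
  have "rep (word u) \<psi> S = (\<Sum>w\<in>{u}. word u w * foldr act w \<psi> S)"
    by (rule rep_superset) (auto simp: word_def)
  then show "rep (word u) \<psi> S = foldr act u \<psi> S" by (simp add: word_def)
qed

lemma rep_conv:
  assumes "f \<in> carrier Fr" "g \<in> carrier Fr"
  shows "rep (conv f g) \<psi> = rep f (rep g \<psi>)"
proof
  fix S
  have "rep (conv f g) \<psi> S = (\<Sum>u | f u \<noteq> 0. \<Sum>v | g v \<noteq> 0. f u * g v * foldr act u (foldr act v \<psi>) S)"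
    unfolding rep_def using assms by (subst sum_conv) auto
  also have "\<dots> = (\<Sum>u | f u \<noteq> 0. f u * foldr act u (rep g \<psi>) S)"
    unfolding rep_def[of g, abs_def] act_word_sum by (simp add: sum_distrib_left mult.assoc)
  finally show "rep (conv f g) \<psi> S = rep f (rep g \<psi>) S" by (simp add: rep_def[of f])
qed

text \<open>The annihilator of the module in the free algebra. Instead of letting the action descend
  through two quotients, both families of relations are shown to lie in this ideal or its
  image.\<close>

definition ker_rep :: "('v list \<Rightarrow> 'k) set" where
  "ker_rep = {f \<in> carrier Fr. \<forall>\<psi>. rep f \<psi> = (\<lambda>S. 0)}"

lemma rep_zero_arg: "rep f (\<lambda>S. 0) = (\<lambda>S. 0)"
proof -
  have "foldr act u (\<lambda>S. 0) = (\<lambda>S. 0)" for u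
    by (induction u) (simp_all add: act_def[abs_def])
  then show ?thesis by (simp add: rep_def[abs_def])
qed

lemma ideal_ker_rep: "ideal ker_rep Fr"
proof (rule idealI[OF Fr.ring_axioms])
  have neg: "rep (\<ominus>\<^bsub>Fr\<^esub> f) \<psi> S = - rep f \<psi> S" if f: "f \<in> carrier Fr" for f \<psi> S
    using rep_smult[OF f, of "-1"] Fr.smult_neg[OF f, of 1] Fr.smult_one[OF f] by simp
  show "subgroup ker_rep (add_monoid Fr)"
  proof
    show "ker_rep \<subseteq> carrier (add_monoid Fr)" by (auto simp: ker_rep_def)
    show "x \<otimes>\<^bsub>add_monoid Fr\<^esub> y \<in> ker_rep" if "x \<in> ker_rep" "y \<in> ker_rep" for x y
      using that Fr.a_closed[of x y] rep_add[of x y] by (auto simp: ker_rep_def)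
    show "\<one>\<^bsub>add_monoid Fr\<^esub> \<in> ker_rep"
      by (auto simp: ker_rep_def rep_def)
    show "inv\<^bsub>add_monoid Fr\<^esub> x \<in> ker_rep" if x: "x \<in> ker_rep" for x
    proof -
      have xc: "x \<in> carrier Fr" using x by (simp add: ker_rep_def)
      have "\<ominus>\<^bsub>Fr\<^esub> x \<in> ker_rep"
        using x Fr.a_inv_closed[OF xc] neg[OF xc] by (auto simp: ker_rep_def)
      then show ?thesis by (simp add: a_inv_def)
    qed
  qed
  fix a x assume ax: "a \<in> ker_rep" "x \<in> carrier Fr"
  then have ac: "a \<in> carrier Fr" by (simp add: ker_rep_def)
  show "x \<otimes>\<^bsub>Fr\<^esub> a \<in> ker_rep"
    using ax Fr.m_closed[OF ax(2) ac] rep_conv[OF ax(2) ac] by (auto simp: ker_rep_def rep_zero_arg)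
  show "a \<otimes>\<^bsub>Fr\<^esub> x \<in> ker_rep"
    using ax Fr.m_closed[OF ac ax(2)] rep_conv[OF ac ax(2)] by (auto simp: ker_rep_def)
qed

lemma LI_ker: "LI \<subseteq> ker_rep"
  unfolding linearity_ideal_def
proof (rule Fr.genideal_minimal[OF ideal_ker_rep])
  have w: "word u \<in> carrier Fr" for u by simp
  have dec: "rep f \<psi> S = rep g \<psi> S - rep h \<psi> S"
    if "f \<in> carrier Fr" "h \<in> carrier Fr" "g = (\<lambda>w. f w + h w)" for f g h \<psi> S
    using rep_add[OF that(1,2)] that(3) by simp
  have "word [v + w] - word [v] - word [w] \<in> ker_rep" for v w
  proof -
    let ?r = "word [v + w] - word [v] - word [w] :: 'v list \<Rightarrow> 'k"
    have rc: "?r \<in> carrier Fr" using lin_gens by blast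
    have "rep ?r \<psi> S = rep (word [v + w]) \<psi> S - rep (\<lambda>u. word [v] u + word [w] u) \<psi> S" for \<psi> S
      by (rule dec[OF rc]) (auto simp: fun_eq_iff finite_support_add)
    then have "rep ?r \<psi> S = 0" for \<psi> S
      using rep_add[OF w w, of "[v]" "[w]"]
      by (simp add: rep_word act_def l_add algebra_simps sum.distrib)
    then show ?thesis using rc by (auto simp: ker_rep_def)
  qed
  moreover have "word [scale a v] - (\<lambda>u. a * word [v] u) \<in> ker_rep" for a v
  proof -
    let ?r = "word [scale a v] - (\<lambda>u. a * word [v] u) :: 'v list \<Rightarrow> 'k"
    have rc: "?r \<in> carrier Fr" using lin_gens by blast
    have "rep ?r \<psi> S = rep (word [scale a v]) \<psi> S - rep (\<lambda>u. a * word [v] u) \<psi> S" for \<psi> S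
      by (rule dec[OF rc]) (auto simp: fun_eq_iff finite_support_smult)
    then have "rep ?r \<psi> S = 0" for \<psi> S
      using rep_smult[OF w, of a "[v]"]
      by (simp add: rep_word act_def l_scale algebra_simps sum_distrib_left)
    then show ?thesis using rc by (auto simp: ker_rep_def)
  qed
  ultimately show "{word [v + w] - word [v] - word [w] | v w. True} \<union>
      {word [scale a v] - (\<lambda>u. a * word [v] u) | a v. True} \<subseteq> ker_rep"
    by blast
qed

lemma ideal_ker_T: "ideal (tensor_class scale ` ker_rep) T"
  unfolding tensor_algebra_def tensor_class_def by (rule Fr.quotient_ideal[OF ideal_LI ideal_ker_rep])

text \<open>Each generator is the class of \<open>[v, v]\<close> minus \<open>Q v\<close> times the
  empty word, which acts as zero by \<open>act_square\<close>.\<close>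

lemma CI_ker: "CI \<subseteq> tensor_class scale ` ker_rep"
  unfolding CI_eq
proof (rule T.genideal_minimal[OF ideal_ker_T], clarify)
  fix v
  let ?r = "word [v, v] \<oplus>\<^bsub>Fr\<^esub> ((- Q v) \<odot>\<^bsub>Fr\<^esub> word [])"
  have w: "word u \<in> carrier Fr" for u by simp
  have rc: "?r \<in> carrier Fr" by (intro Fr.a_closed Fr.smult_closed w)
  have "rep ?r \<psi> S = rep (word [v, v]) \<psi> S + (- Q v) * rep (word []) \<psi> S" for \<psi> S
    by (simp only: free_algebra_simps(5,6) rep_smult[OF w]
        rep_add[OF w Fr.smult_closed[OF w], of "[v, v]" "- Q v" "[]", unfolded free_algebra_simps(6)])
  then have "rep ?r \<psi> S = 0" for \<psi> S
    by (simp add: rep_word act_square)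
  then have "?r \<in> ker_rep" using rc by (auto simp: ker_rep_def)
  moreover have "cliff_gen v = tensor_class scale ?r"
  proof -
    have vv: "word [v] \<otimes>\<^bsub>Fr\<^esub> word [v] = word [v, v]" by (simp add: conv_word_Cons)
    have one: "\<one>\<^bsub>T\<^esub> = tensor_class scale (word [])" using T_one by simp
    have "\<ominus>\<^bsub>T\<^esub> (Q v \<odot>\<^bsub>T\<^esub> \<one>\<^bsub>T\<^esub>) = (- Q v) \<odot>\<^bsub>T\<^esub> \<one>\<^bsub>T\<^esub>"
      by (rule T.smult_neg[OF T.one_closed, symmetric])
    then have "\<ominus>\<^bsub>T\<^esub> (Q v \<odot>\<^bsub>T\<^esub> \<one>\<^bsub>T\<^esub>) = tensor_class scale ((- Q v) \<odot>\<^bsub>Fr\<^esub> word [])"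
      using T_ops(3)[OF w w] one by metis
    then show ?thesis
      unfolding T.minus_eq T_ops(2)[OF w w] vv
      using T_ops(1)[OF w Fr.smult_closed[OF w]] by metis
  qed
  ultimately show "cliff_gen v \<in> tensor_class scale ` ker_rep" by blast
qed

text \<open>If 1 were 0, the empty word would agree modulo the linearity relations with an element
  of \<open>ker_rep\<close>. These relations lie in \<open>ker_rep\<close> too, so the empty word
  would annihilate the module, although it acts as the identity.\<close>

lemma clifford_one_neq_zero: "\<one>\<^bsub>Cl\<^esub> \<noteq> \<zero>\<^bsub>Cl\<^esub>"
proof
  assume "\<one>\<^bsub>Cl\<^esub> = \<zero>\<^bsub>Cl\<^esub>"
  then have "CI +>\<^bsub>T\<^esub> \<one>\<^bsub>T\<^esub> = CI +>\<^bsub>T\<^esub> \<zero>\<^bsub>T\<^esub>"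
    unfolding clifford_algebra_def T.quotient_one[OF ideal_CI] T.quotient_zero[OF ideal_CI] .
  then have "\<one>\<^bsub>T\<^esub> \<ominus>\<^bsub>T\<^esub> \<zero>\<^bsub>T\<^esub> \<in> CI"
    by (simp add: T.quotient_eq_iff[OF ideal_CI T.one_closed T.zero_closed])
  then have "\<one>\<^bsub>T\<^esub> \<in> tensor_class scale ` ker_rep"
    using CI_ker by (auto simp: T.minus_eq)
  then obtain f where f: "f \<in> ker_rep" "tensor_class scale \<one>\<^bsub>Fr\<^esub> = tensor_class scale f"
    unfolding T_one by blast
  interpret K: ideal ker_rep Fr by (rule ideal_ker_rep)
  have fc: "f \<in> carrier Fr" using K.Icarr[OF f(1)] .
  have "\<one>\<^bsub>Fr\<^esub> \<ominus>\<^bsub>Fr\<^esub> f \<in> ker_rep"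
    using f(2) LI_ker Fr.quotient_eq_iff[OF ideal_LI Fr.one_closed fc] unfolding tensor_class_def by blast
  then have "(\<one>\<^bsub>Fr\<^esub> \<ominus>\<^bsub>Fr\<^esub> f) \<oplus>\<^bsub>Fr\<^esub> f \<in> ker_rep"
    using K.a_closed f(1) by blast
  moreover have "(\<one>\<^bsub>Fr\<^esub> \<ominus>\<^bsub>Fr\<^esub> f) \<oplus>\<^bsub>Fr\<^esub> f = \<one>\<^bsub>Fr\<^esub>"
    using fc Fr.one_closed by (simp only: Fr.minus_eq Fr.a_assoc Fr.a_inv_closed Fr.l_neg Fr.r_zero)
  ultimately have "rep (word []) (\<lambda>S. 1) = (\<lambda>S. 0)" by (simp add: ker_rep_def)
  then have "(\<lambda>S::nat set. 1::'k) = (\<lambda>S. 0)" by (simp add: rep_word)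
  then show False by (metis zero_neq_one)
qed

end

end

section \<open>The even Clifford algebra of a split form\<close>

context kalg
begin

lemma anticommutes_mult2:
  assumes "x \<in> carrier A" "y \<in> carrier A" "z \<in> carrier A" "commutes x y" "anticommutes x z"
  shows "anticommutes x (y \<otimes> z)"
proof -
  have "x \<otimes> (y \<otimes> z) = (y \<otimes> x) \<otimes> z" using assms by (simp add: commutes_def flip: m_assoc)
  also have "\<dots> = y \<otimes> (x \<otimes> z)" using assms by (simp add: m_assoc)
  also have "\<dots> = \<ominus> ((y \<otimes> z) \<otimes> x)" using assms by (simp add: anticommutes_def r_minus m_assoc)
  finally show ?thesis by (simp add: anticommutes_def)
qed

lemma commutes_self: "commutes x x"
  by (simp add: commutes_def)

lemma commutes_one: "x \<in> carrier A \<Longrightarrow> commutes x \<one>"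
  by (simp add: commutes_def)

text \<open>In the 2 x 2 picture \<open>x y - y x\<close> is diag(1, -1), an involution that
  anticommutes with off-diagonal matrices.\<close>

lemma unit_pair_sign:
  assumes p: "unit_pair x y"
  shows "(x \<otimes> y \<ominus> y \<otimes> x) \<otimes> (x \<otimes> y \<ominus> y \<otimes> x) = \<one>"
    "anticommutes x (x \<otimes> y \<ominus> y \<otimes> x)" "anticommutes y (x \<otimes> y \<ominus> y \<otimes> x)"
proof -
  have c: "x \<in> carrier A" "y \<in> carrier A" "x \<otimes> x = \<zero>" "y \<otimes> y = \<zero>" "x \<otimes> y \<oplus> y \<otimes> x = \<one>"
    using p unfolding unit_pair_def by blast+
  note ab = unit_pair_absorb[OF p]
  have z: "x \<otimes> (x \<otimes> w) = \<zero>" "y \<otimes> (y \<otimes> w) = \<zero>" if "w \<in> carrier A" for w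
    using c that by (metis m_assoc l_null)+
  have a: "x \<otimes> (y \<otimes> (x \<otimes> w)) = x \<otimes> w" "y \<otimes> (x \<otimes> (y \<otimes> w)) = y \<otimes> w" if "w \<in> carrier A" for w
    using ab c that by (metis m_assoc m_closed)+
  show "anticommutes x (x \<otimes> y \<ominus> y \<otimes> x)" "anticommutes y (x \<otimes> y \<ominus> y \<otimes> x)"
    unfolding anticommutes_def minus_eq using c(1-4)
    by (simp_all add: l_distr r_distr l_minus r_minus m_assoc z ab)
  have "(x \<otimes> y \<ominus> y \<otimes> x) \<otimes> (x \<otimes> y \<ominus> y \<otimes> x) = x \<otimes> y \<oplus> y \<otimes> x"
    unfolding minus_eq using c(1-4)
    by (simp add: l_distr r_distr l_minus r_minus m_assoc z a)
  then show "(x \<otimes> y \<ominus> y \<otimes> x) \<otimes> (x \<otimes> y \<ominus> y \<otimes> x) = \<one>" using c(5) by simp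
qed

end

locale split_space = bilinear_space scale F
  for scale :: "'k::field \<Rightarrow> 'v::ab_group_add \<Rightarrow> 'v" and F +
  fixes m e f g
  assumes hyp: "hyperbolic_basis scale F UNIV m e f g"
begin

lemma basis:
  shows F_eg: "i < m \<Longrightarrow> F (e i) g = 0" and F_fg: "i < m \<Longrightarrow> F (f i) g = 0" and F_gg: "F g g \<noteq> 0"
    and F_ee: "i < m \<Longrightarrow> j < m \<Longrightarrow> F (e i) (e j) = 0"
    and F_ff: "i < m \<Longrightarrow> j < m \<Longrightarrow> F (f i) (f j) = 0"
    and F_ef: "i < m \<Longrightarrow> j < m \<Longrightarrow> F (e i) (f j) = (if i = j then 1 else 0)"
    and expand: "v = (\<Sum>i<m. scale (F v (f i)) (e i) + scale (F v (e i)) (f i)) + scale (F v g / F g g) g"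
  using hyp unfolding hyperbolic_basis_def by blast+

lemma Q_expand: "Q v = (\<Sum>i<m. F v (e i) * F v (f i)) + Q g * (F v g / F g g)\<^sup>2"
proof -
  have "F v v = F v ((\<Sum>i<m. scale (F v (f i)) (e i) + scale (F v (e i)) (f i)) + scale (F v g / F g g) g)"
    using expand[of v] by simp
  also have "\<dots> = (\<Sum>i<m. 2 * (F v (e i) * F v (f i))) + (F v g / F g g) * F v g"
    by (simp add: algebra_simps)
  finally have "F v v = 2 * (\<Sum>i<m. F v (e i) * F v (f i)) + (F v g / F g g) * F v g"
    by (simp add: sum_distrib_left)
  moreover have "F g g * (F v g / F g g)\<^sup>2 = (F v g / F g g) * F v g"
    using F_gg by (simp add: power2_eq_square)
  ultimately show ?thesis
    unfolding quad_def mult.assoc using two_nz by (simp add: distrib_left)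
qed

text \<open>Each hyperbolic plane contributes \<open>a b = ((a + b) / 2)\<^sup>2 - ((a - b) / 2)\<^sup>2\<close>.\<close>

lemma clifford_nontrivial: "\<one>\<^bsub>Cl\<^esub> \<noteq> \<zero>\<^bsub>Cl\<^esub>"
proof -
  \<comment> \<open>Coordinates below \<open>m\<close> are half sums, those from \<open>m\<close> to
    \<open>2 m - 1\<close> half differences with sign -1, and the last one, \<open>2 m\<close>,
    belongs to \<open>g\<close>; hence \<open>Suc (2 * m)\<close> of them.\<close>
  define l where "l j v = (if j < m then (F v (e j) + F v (f j)) / 2
    else if j < 2 * m then (F v (e (j - m)) - F v (f (j - m))) / 2 else F v g / F g g)" for j v
  define d where "d j = (if j < m then 1 else if j < 2 * m then -1 else Q g)" for j
  show ?thesis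
  proof (rule clifford_one_neq_zero[of l d "Suc (2 * m)"])
    show "l j (v + w) = l j v + l j w" for j v w
      by (simp add: l_def add_divide_distrib[symmetric] algebra_simps)
    show "l j (scale a v) = a * l j v" for j a v
      by (simp add: l_def algebra_simps)
    fix v
    have "(\<Sum>j<2 * m. d j * (l j v)\<^sup>2) = (\<Sum>j<m. d j * (l j v)\<^sup>2) + (\<Sum>j<m. d (m + j) * (l (m + j) v)\<^sup>2)"
      using sum.shift_bounds_nat_ivl[of "\<lambda>j. d j * (l j v)\<^sup>2" 0 m m]
        sum.atLeastLessThan_concat[of 0 m "m + m" "\<lambda>j. d j * (l j v)\<^sup>2"]
      by (simp add: lessThan_atLeast0 mult_2 add.commute)
    also have "\<dots> = (\<Sum>j<m. F v (e j) * F v (f j))"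
      unfolding sum.distrib[symmetric]
    proof (intro sum.cong refl)
      fix j assume "j \<in> {..<m}"
      then have "d j * (l j v)\<^sup>2 + d (m + j) * (l (m + j) v)\<^sup>2 =
          ((F v (e j) + F v (f j)) / 2)\<^sup>2 - ((F v (e j) - F v (f j)) / 2)\<^sup>2"
        by (simp add: d_def l_def)
      also have "\<dots> = ((F v (e j) + F v (f j))\<^sup>2 - (F v (e j) - F v (f j))\<^sup>2) / (2 * 2)"
        by (simp only: power2_eq_square times_divide_times_eq diff_divide_distrib[symmetric])
      also have "(F v (e j) + F v (f j))\<^sup>2 - (F v (e j) - F v (f j))\<^sup>2 = F v (e j) * F v (f j) * (2 * 2)"
        by (simp add: power2_eq_square algebra_simps)
      also have "\<dots> / (2 * 2) = F v (e j) * F v (f j)"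
        by (intro nonzero_mult_div_cancel_right no_zero_divisors two_nz)
      finally show "d j * (l j v)\<^sup>2 + d (m + j) * (l (m + j) v)\<^sup>2 = F v (e j) * F v (f j)" .
    qed
    finally show "Q v = (\<Sum>j<Suc (2 * m). d j * (l j v)\<^sup>2)"
      unfolding Q_expand[of v] by (simp add: d_def l_def)
  qed
qed

section \<open>Twisting hyperbolic pairs into commuting even pairs\<close>

notation C.commutes (infix "\<leftrightarrow>" 50)

abbreviation cmult (infixl "\<cdot>" 70) where "x \<cdot> y \<equiv> x \<otimes>\<^bsub>Cl\<^esub> y"

lemma pair_ef: "i < m \<Longrightarrow> C.unit_pair (\<iota> (e i)) (\<iota> (f i))"
  unfolding C.unit_pair_def \<iota>_square \<iota>_polar quad_def by (simp add: F_ee F_ff F_ef)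

definition sgn_el where "sgn_el i = \<iota> (e i) \<cdot> \<iota> (f i) \<ominus>\<^bsub>Cl\<^esub> \<iota> (f i) \<cdot> \<iota> (e i)"

lemma sgn_closed [simp]: "sgn_el i \<in> carrier Cl"
  by (simp add: sgn_el_def)

lemma sgn_square: "i < m \<Longrightarrow> sgn_el i \<cdot> sgn_el i = \<one>\<^bsub>Cl\<^esub>"
  and sgn_anti_e: "i < m \<Longrightarrow> C.anticommutes (\<iota> (e i)) (sgn_el i)"
  and sgn_anti_f: "i < m \<Longrightarrow> C.anticommutes (\<iota> (f i)) (sgn_el i)"
  unfolding sgn_el_def using C.unit_pair_sign[OF pair_ef] by auto

lemma commutes_sgn:
  "x \<in> carrier Cl \<Longrightarrow> C.anticommutes x (\<iota> (e i)) \<Longrightarrow> C.anticommutes x (\<iota> (f i)) \<Longrightarrow> x \<leftrightarrow> sgn_el i"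
  unfolding sgn_el_def by (intro C.commutes_diff C.commutes_mult_anti) auto

lemma F_fe: "i < m \<Longrightarrow> j < m \<Longrightarrow> F (f i) (e j) = (if i = j then 1 else 0)"
  using F_ef[of j i] F_commute by auto

lemma e_commutes_sgn: "i < m \<Longrightarrow> j < m \<Longrightarrow> i \<noteq> j \<Longrightarrow> \<iota> (e i) \<leftrightarrow> sgn_el j"
  and f_commutes_sgn: "i < m \<Longrightarrow> j < m \<Longrightarrow> i \<noteq> j \<Longrightarrow> \<iota> (f i) \<leftrightarrow> sgn_el j"
  and g_commutes_sgn: "j < m \<Longrightarrow> \<iota> g \<leftrightarrow> sgn_el j"
  by (auto intro!: commutes_sgn \<iota>_anticommute
      simp: F_ee F_ef F_fe F_ff F_eg F_fg F_commute[of g])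

lemma sgn_commutes_sgn: "i < m \<Longrightarrow> j < m \<Longrightarrow> sgn_el i \<leftrightarrow> sgn_el j"
proof (cases "i = j")
  case False
  assume ij: "i < m" "j < m"
  have "sgn_el j \<leftrightarrow> sgn_el i"
    unfolding sgn_el_def[of i]
    by (intro C.commutes_diff C.commutes_mult C.commutes_sym[OF e_commutes_sgn]
        C.commutes_sym[OF f_commutes_sgn]) (use ij False in auto)
  then show ?thesis by (rule C.commutes_sym)
qed (simp add: C.commutes_self)

primrec sgn_prod where
  "sgn_prod 0 = \<one>\<^bsub>Cl\<^esub>"
| "sgn_prod (Suc k) = sgn_prod k \<cdot> sgn_el k"

lemma sgn_prod_closed [simp]: "sgn_prod k \<in> carrier Cl"
  by (induction k) auto

lemma commutes_sgn_prod:
  "x \<in> carrier Cl \<Longrightarrow> (\<And>i. i < k \<Longrightarrow> x \<leftrightarrow> sgn_el i) \<Longrightarrow> x \<leftrightarrow> sgn_prod k"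
  by (induction k) (auto intro!: C.commutes_mult C.commutes_one)

lemma sgn_prod_square: "k \<le> m \<Longrightarrow> sgn_prod k \<cdot> sgn_prod k = \<one>\<^bsub>Cl\<^esub>"
proof (induction k)
  case (Suc k)
  have "sgn_el k \<leftrightarrow> sgn_prod k"
    by (intro commutes_sgn_prod sgn_commutes_sgn) (use Suc in auto)
  then have "sgn_prod (Suc k) \<cdot> sgn_prod (Suc k) = (sgn_prod k \<cdot> sgn_prod k) \<cdot> (sgn_el k \<cdot> sgn_el k)"
    unfolding C.commutes_def sgn_prod.simps by (metis C.m_assoc C.m_closed sgn_closed sgn_prod_closed)
  then show ?case using Suc sgn_square by simp
qed simp

lemma commutes_sgn_prod_ge:
  assumes "k \<le> j" "j < m"
  shows "\<iota> (e j) \<leftrightarrow> sgn_prod k" "\<iota> (f j) \<leftrightarrow> sgn_prod k"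
  by (intro commutes_sgn_prod e_commutes_sgn f_commutes_sgn; use assms in simp)+

lemma g_commutes_sgn_prod: "k \<le> m \<Longrightarrow> \<iota> g \<leftrightarrow> sgn_prod k"
  by (intro commutes_sgn_prod g_commutes_sgn) auto

lemma sgn_prod_commutes: "j \<le> m \<Longrightarrow> k \<le> m \<Longrightarrow> sgn_prod j \<leftrightarrow> sgn_prod k"
  by (intro commutes_sgn_prod C.commutes_sym[OF commutes_sgn_prod] sgn_commutes_sgn) auto

text \<open>Among the factors of \<open>sgn_prod k\<close>, only \<open>sgn_el j\<close>
  anticommutes with the vectors of plane \<open>j\<close>.\<close>

lemma anticommutes_sgn_prod_less:
  assumes "j < k" "k \<le> m"
  shows "C.anticommutes (\<iota> (e j)) (sgn_prod k)" "C.anticommutes (\<iota> (f j)) (sgn_prod k)"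
proof -
  have "C.anticommutes (\<iota> (e j)) (sgn_prod k) \<and> C.anticommutes (\<iota> (f j)) (sgn_prod k)"
    using assms
  proof (induction k)
    case (Suc k)
    show ?case
    proof (cases "j = k")
      case True
      then show ?thesis
        using Suc.prems commutes_sgn_prod_ge[of k k] sgn_anti_e[of k] sgn_anti_f[of k]
        by (auto intro!: C.anticommutes_mult2)
    next
      case False
      then show ?thesis
        using Suc e_commutes_sgn[of j k] f_commutes_sgn[of j k]
        by (auto intro!: C.anticommutes_mult)
    qed
  qed simp
  then show "C.anticommutes (\<iota> (e j)) (sgn_prod k)" "C.anticommutes (\<iota> (f j)) (sgn_prod k)" by auto
qed

definition tw where "tw k = \<iota> g \<cdot> sgn_prod k"

lemma tw_closed [simp]: "tw k \<in> carrier Cl"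
  by (simp add: tw_def)

lemma tw_square: "k \<le> m \<Longrightarrow> tw k \<cdot> tw k = Q g \<odot>\<^bsub>Cl\<^esub> \<one>\<^bsub>Cl\<^esub>"
proof -
  assume k: "k \<le> m"
  have "tw k \<cdot> tw k = (\<iota> g \<cdot> \<iota> g) \<cdot> (sgn_prod k \<cdot> sgn_prod k)"
    using g_commutes_sgn_prod[OF k] unfolding tw_def C.commutes_def
    by (metis C.m_assoc C.m_closed \<iota>_carrier sgn_prod_closed)
  then show ?thesis by (simp add: sgn_prod_square[OF k] \<iota>_square)
qed

lemma tw_anticommutes:
  assumes "k \<le> j" "j < m"
  shows "C.anticommutes (\<iota> (e j)) (tw k)" "C.anticommutes (\<iota> (f j)) (tw k)"
  unfolding tw_def
  by (intro C.anticommutes_mult commutes_sgn_prod_ge \<iota>_anticommute F_eg F_fg; use assms in simp)+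

text \<open>Both \<open>\<iota> g\<close> and \<open>sgn_prod k\<close> anticommute with the vectors
  of an earlier plane, and the two signs cancel.\<close>

lemma tw_commutes:
  assumes "j < k" "k \<le> m"
  shows "\<iota> (e j) \<leftrightarrow> tw k" "\<iota> (f j) \<leftrightarrow> tw k"
  unfolding tw_def
  by (intro C.commutes_mult_anti anticommutes_sgn_prod_less \<iota>_anticommute F_eg F_fg; use assms in simp)+

lemma tw_commutes_tw:
  assumes "j \<le> m" "k \<le> m"
  shows "tw j \<leftrightarrow> tw k"
  unfolding tw_def
  by (intro C.commutes_mult C.commutes_mult_left C.commutes_self g_commutes_sgn_prod
      C.commutes_sym[OF g_commutes_sgn_prod] sgn_prod_commutes) (use assms in auto)

definition up where "up k = tw k \<cdot> \<iota> (e k)"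
text \<open>The scalar cancels the factor \<open>- Q g\<close> that \<open>tw_mult\<close> yields
  for a product of two twisted vectors.\<close>

definition down where "down k = (- inverse (Q g)) \<odot>\<^bsub>Cl\<^esub> (tw k \<cdot> \<iota> (f k))"

lemma up_closed [simp]: "up k \<in> carrier Cl" and down_closed [simp]: "down k \<in> carrier Cl"
  by (simp_all add: up_def down_def)

lemma Qg: "Q g \<noteq> 0"
  using F_gg two_nz by (simp add: quad_def)

text \<open>Moving the second twist to the left past \<open>a\<close> costs a sign, and the two
  twists then multiply to \<open>Q g\<close>.\<close>

lemma tw_mult:
  assumes k: "k < m" and a: "a \<in> carrier Cl" "C.anticommutes a (tw k)" and b: "b \<in> carrier Cl"
  shows "(tw k \<cdot> a) \<cdot> (tw k \<cdot> b) = (- Q g) \<odot>\<^bsub>Cl\<^esub> (a \<cdot> b)"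
proof -
  have "(tw k \<cdot> a) \<cdot> (tw k \<cdot> b) = tw k \<cdot> (a \<cdot> tw k) \<cdot> b"
    using a b by (simp add: C.m_assoc)
  also have "\<dots> = \<ominus>\<^bsub>Cl\<^esub> ((tw k \<cdot> tw k) \<cdot> (a \<cdot> b))"
    using a b by (simp add: C.anticommutes_def C.r_minus C.l_minus C.m_assoc)
  also have "\<dots> = (- Q g) \<odot>\<^bsub>Cl\<^esub> (a \<cdot> b)"
    using a b k by (simp add: tw_square C.smult_mult_l C.smult_neg)
  finally show ?thesis .
qed

lemma up_down_products:
  assumes k: "k < m"
  shows "up k \<cdot> up k = \<zero>\<^bsub>Cl\<^esub>" "down k \<cdot> down k = \<zero>\<^bsub>Cl\<^esub>"
    "up k \<cdot> down k = \<iota> (e k) \<cdot> \<iota> (f k)" "down k \<cdot> up k = \<iota> (f k) \<cdot> \<iota> (e k)"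
proof -
  have p: "\<iota> (e k) \<cdot> \<iota> (e k) = \<zero>\<^bsub>Cl\<^esub>" "\<iota> (f k) \<cdot> \<iota> (f k) = \<zero>\<^bsub>Cl\<^esub>"
    using pair_ef[OF k] unfolding C.unit_pair_def by blast+
  note t = tw_mult[OF k \<iota>_carrier tw_anticommutes(1)[OF order_refl k] \<iota>_carrier]
    tw_mult[OF k \<iota>_carrier tw_anticommutes(2)[OF order_refl k] \<iota>_carrier]
  show "up k \<cdot> up k = \<zero>\<^bsub>Cl\<^esub>" "down k \<cdot> down k = \<zero>\<^bsub>Cl\<^esub>"
    unfolding up_def down_def by (simp_all add: t p C.smult_mult_l C.smult_mult_r)
  show "up k \<cdot> down k = \<iota> (e k) \<cdot> \<iota> (f k)" "down k \<cdot> up k = \<iota> (f k) \<cdot> \<iota> (e k)"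
    unfolding up_def down_def using Qg
    by (simp_all add: t C.smult_mult_l C.smult_mult_r C.smult_smult)
qed

lemma unit_pair_up_down: "k < m \<Longrightarrow> C.unit_pair (up k) (down k)"
  using pair_ef[of k] unfolding C.unit_pair_def by (simp add: up_down_products)

text \<open>The left product commutes with \<open>tw k\<close> factor by factor, whereas
  \<open>\<iota> b\<close> anticommutes with both \<open>tw j\<close> and \<open>\<iota> a\<close>,
  so that the signs cancel there as well.\<close>

lemma tw_commute_less:
  assumes jk: "j < k" "k < m" and a: "a = e j \<or> a = f j" and b: "b = e k \<or> b = f k"
  shows "tw j \<cdot> \<iota> a \<leftrightarrow> tw k \<cdot> \<iota> b"
proof (rule C.commutes_mult)
  have "\<iota> a \<leftrightarrow> tw k" using tw_commutes[of j k] jk a by auto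
  then show "tw j \<cdot> \<iota> a \<leftrightarrow> tw k"
    using jk by (intro C.commutes_mult_left tw_commutes_tw) auto
  have "C.anticommutes (\<iota> b) (tw j)" using tw_anticommutes[of j k] jk b by auto
  moreover have "C.anticommutes (\<iota> b) (\<iota> a)"
    using a b jk by (intro \<iota>_anticommute) (auto simp: F_ee F_ef F_fe F_ff)
  ultimately show "tw j \<cdot> \<iota> a \<leftrightarrow> \<iota> b"
    by (intro C.commutes_sym[OF C.commutes_mult_anti]) auto
qed auto

lemma up_down_commute:
  assumes "j < m" "k < m" "j \<noteq> k"
  shows "up j \<leftrightarrow> up k \<and> up j \<leftrightarrow> down k \<and> down j \<leftrightarrow> down k"
proof -
  have *: "tw j \<cdot> \<iota> a \<leftrightarrow> tw k \<cdot> \<iota> b" if "a = e j \<or> a = f j" "b = e k \<or> b = f k" for a b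
    using tw_commute_less[of j k a b] C.commutes_sym[OF tw_commute_less[of k j b a]] assms that
    by (cases j k rule: linorder_cases) auto
  then show ?thesis
    unfolding up_def down_def
    by (intro conjI C.commutes_smult C.commutes_sym[OF C.commutes_smult]
        C.commutes_sym[OF *]) (auto intro: * C.commutes_sym[OF *] C.commutes_smult C.commutes_sym[OF C.commutes_smult])
qed

text \<open>The products of \<open>up k\<close> and \<open>down k\<close> are those of
  \<open>\<iota> (e k)\<close> and \<open>\<iota> (f k)\<close>, so they give back the sign
  elements. Multiplying by \<open>sgn_prod k\<close> undoes the twist up to
  \<open>\<iota> g\<close>, which yields all products of \<open>g\<close> with a vector on either
  side; finally (v g)(g w) is \<open>Q g\<close> times v w.\<close>

lemma up_down_generate:
  assumes S: "C.subalg S" and ud: "\<And>k. k < m \<Longrightarrow> up k \<in> S \<and> down k \<in> S"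
  shows "even_part \<subseteq> S"
proof (rule even_part_generated[OF S])
  have sgnS: "sgn_el k \<in> S" if "k < m" for k
    unfolding sgn_el_def up_down_products(3,4)[OF that, symmetric]
    using ud[OF that] C.subalgD(4,8)[OF S] by blast
  have prodS: "sgn_prod k \<in> S" if "k \<le> m" for k
    using that by (induction k) (auto intro!: C.subalgD(2,4)[OF S] sgnS)
  have untwist: "sgn_prod k \<cdot> (tw k \<cdot> a) = \<iota> g \<cdot> a" if "k \<le> m" "a \<in> carrier Cl" for k a
  proof -
    have "sgn_prod k \<cdot> (tw k \<cdot> a) = ((sgn_prod k \<cdot> \<iota> g) \<cdot> sgn_prod k) \<cdot> a"
      using that by (simp add: tw_def C.m_assoc)
    also have "sgn_prod k \<cdot> \<iota> g = \<iota> g \<cdot> sgn_prod k"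
      using g_commutes_sgn_prod[OF that(1)] by (simp add: C.commutes_def)
    also have "(\<iota> g \<cdot> sgn_prod k) \<cdot> sgn_prod k \<cdot> a = \<iota> g \<cdot> ((sgn_prod k \<cdot> sgn_prod k) \<cdot> a)"
      using that by (simp add: C.m_assoc)
    also have "\<dots> = \<iota> g \<cdot> a" using that by (simp add: sgn_prod_square)
    finally show ?thesis .
  qed
  have ge: "\<iota> g \<cdot> \<iota> (e k) \<in> S" if k: "k < m" for k
  proof -
    have "sgn_prod k \<cdot> up k \<in> S" using C.subalgD(4)[OF S prodS] ud[OF k] k by simp
    then show ?thesis using untwist[of k "\<iota> (e k)"] k by (simp add: up_def)
  qed
  have gf: "\<iota> g \<cdot> \<iota> (f k) \<in> S" if k: "k < m" for k
  proof -
    have "(- Q g) \<odot>\<^bsub>Cl\<^esub> down k \<in> S" using C.subalgD(5)[OF S] ud[OF k] by blast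
    then have "tw k \<cdot> \<iota> (f k) \<in> S" using Qg by (simp add: down_def C.smult_smult)
    then have "sgn_prod k \<cdot> (tw k \<cdot> \<iota> (f k)) \<in> S" using C.subalgD(4)[OF S prodS] k by simp
    then show ?thesis using untwist[of k "\<iota> (f k)"] k by simp
  qed
  have gg: "\<iota> g \<cdot> \<iota> g \<in> S"
    unfolding \<iota>_square by (intro C.subalgD(5)[OF S] C.subalgD(2)[OF S])
  have gadd: "\<iota> g \<cdot> \<iota> (v + w) \<in> S" if "\<iota> g \<cdot> \<iota> v \<in> S" "\<iota> g \<cdot> \<iota> w \<in> S" for v w
    using C.subalgD(3)[OF S that] by (simp add: \<iota>_add C.r_distr)
  have gscale: "\<iota> g \<cdot> \<iota> (scale a v) \<in> S" if "\<iota> g \<cdot> \<iota> v \<in> S" for a v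
    using C.subalgD(5)[OF S that] by (simp add: \<iota>_scale C.smult_mult_r)
  have gsum: "\<iota> g \<cdot> \<iota> (\<Sum>i\<in>I. h i) \<in> S" if "finite I" "\<And>i. i \<in> I \<Longrightarrow> \<iota> g \<cdot> \<iota> (h i) \<in> S" for I :: "nat set" and h
    using that
  proof (induction I rule: finite_induct)
    case empty
    show ?case using gscale[OF gg, of 0] by simp
  qed (simp add: gadd)
  have gv: "\<iota> g \<cdot> \<iota> v \<in> S" for v
    by (subst expand[of v]) (intro gadd gscale gsum ge gf gg; simp)
  have vg: "\<iota> v \<cdot> \<iota> g \<in> S" for v
  proof -
    have "\<iota> v \<cdot> \<iota> g = F v g \<odot>\<^bsub>Cl\<^esub> \<one>\<^bsub>Cl\<^esub> \<ominus>\<^bsub>Cl\<^esub> \<iota> g \<cdot> \<iota> v"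
      unfolding \<iota>_polar[symmetric] by (simp add: C.minus_eq C.a_assoc C.r_neg)
    then show ?thesis
      using C.subalgD(8)[OF S C.subalgD(5)[OF S C.subalgD(2)[OF S]] gv] by simp
  qed
  fix v w
  have "(\<iota> v \<cdot> \<iota> g) \<cdot> (\<iota> g \<cdot> \<iota> w) = \<iota> v \<cdot> ((\<iota> g \<cdot> \<iota> g) \<cdot> \<iota> w)"
    by (simp add: C.m_assoc)
  also have "\<dots> = Q g \<odot>\<^bsub>Cl\<^esub> (\<iota> v \<cdot> \<iota> w)"
    by (simp add: \<iota>_square C.smult_mult_l C.smult_mult_r)
  finally have "inverse (Q g) \<odot>\<^bsub>Cl\<^esub> ((\<iota> v \<cdot> \<iota> g) \<cdot> (\<iota> g \<cdot> \<iota> w)) = \<iota> v \<cdot> \<iota> w"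
    using Qg by (simp add: C.smult_smult)
  then show "\<iota> v \<cdot> \<iota> w \<in> S"
    using C.subalgD(5)[OF S C.subalgD(4)[OF S vg gv]] by metis
qed

lemma up_down_even:
  assumes k: "k < m"
  shows "up k \<in> even_part" "down k \<in> even_part"
proof -
  note D = C.subalgD[OF subalg_even]
  have s: "sgn_el i \<in> even_part" for i
    unfolding sgn_el_def by (intro D(8) \<iota>_mult_even)
  have p: "sgn_prod i \<in> even_part" for i
    by (induction i) (auto intro: D(2,4) s)
  have "tw k \<cdot> \<iota> a = sgn_prod k \<cdot> (\<iota> g \<cdot> \<iota> a)" for a
    using g_commutes_sgn_prod[of k] k by (simp add: tw_def C.commutes_def flip: C.m_assoc)
  then have "tw k \<cdot> \<iota> a \<in> even_part" for a
    using D(4)[OF p \<iota>_mult_even] by simp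
  then show "up k \<in> even_part" "down k \<in> even_part"
    unfolding up_def down_def by (auto intro: D(5))
qed

lemma clifford_invariant_split: "clifford_invariant scale F = brauer_one"
proof -
  let ?A = "even_clifford_algebra scale F"
  interpret A: kalg ?A
    unfolding even_clifford_eq by (rule kalg.intro[OF C.subalg_k_algebra[OF subalg_even]])
  have ops: "carrier ?A = even_part" "monoid.mult ?A = monoid.mult Cl" "add ?A = add Cl"
    "one ?A = one Cl" "ring.zero ?A = ring.zero Cl" "module.smult ?A = module.smult Cl"
    by (simp_all add: even_clifford_eq)
  have sub: "C.subalg S" if "A.subalg S" for S
    using that C.subalgD(1)[OF subalg_even] unfolding A.subalg_def C.subalg_def ops by blast
  have pairs: "A.unit_pair (up k) (down k)" if "k < m" for k
    using unit_pair_up_down[OF that] up_down_even[OF that]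
    unfolding A.unit_pair_def C.unit_pair_def ops by blast
  have comm: "A.commutes (up i) (up j) \<and> A.commutes (up i) (down j) \<and> A.commutes (down i) (down j)"
    if "i < m" "j < m" "i \<noteq> j" for i j
    using up_down_commute[OF that] unfolding A.commutes_def C.commutes_def ops .
  obtain E where E: "A.matrix_units (2 ^ m) E"
    and gen: "\<forall>S. A.subalg S \<longrightarrow> (\<forall>i<2 ^ m. \<forall>j<2 ^ m. E i j \<in> S) \<longrightarrow> (\<forall>i<m. up i \<in> S \<and> down i \<in> S)"
    using A.units_of_commuting_pairs[of m up down m, OF pairs comm order_refl] by blast
  \<comment> \<open>A subalgebra containing the matrix units contains the pairs they were built
    from, and those generate the even part.\<close>
  have gen': "S = carrier ?A" if S: "A.subalg S" "\<forall>i<2 ^ m. \<forall>j<2 ^ m. E i j \<in> S" for S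
  proof
    show "S \<subseteq> carrier ?A" using A.subalgD(1)[OF S(1)] by blast
    show "carrier ?A \<subseteq> S"
      unfolding ops by (rule up_down_generate[OF sub[OF S(1)]]) (use gen S in blast)
  qed
  have nt: "\<one>\<^bsub>?A\<^esub> \<noteq> \<zero>\<^bsub>?A\<^esub>" using clifford_nontrivial unfolding ops .
  show ?thesis
    unfolding clifford_invariant_def
    by (rule brauer_class_split[OF A.csa[OF E nt gen'] _ A.matrix_iso[OF E nt gen']]) simp_all
qed

end

theorem corollary3p5:
  fixes R :: "'k::field set"
    and scale :: "'k \<Rightarrow> 'v::ab_group_add \<Rightarrow> 'v"
    and F :: "'v \<Rightarrow> 'v \<Rightarrow> 'k"
    and L :: "'v set"
  assumes "complete_dvr R"
    and "finite_residue_field R"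
    and "\<exists>p::nat. Factorial_Ring.prime p \<and> finite_extension_of_padics p TYPE('k)"
    and "vector_space scale"
    and "finite_dimensional scale"
    and "odd (vector_space.dim scale (UNIV :: 'v set))"
    and "symmetric_bilinear_form scale F"
    and "nondegenerate F"
    and "semi_regular scale F R L"
  shows "clifford_invariant scale F = brauer_one"
proof -
  obtain m e f g where "(2::'k) \<noteq> 0" "hyperbolic_basis scale F UNIV m e f g"
    using semi_regular_hyperbolic_basis[OF assms(1,2,4,5,7,8,9)] by blast
  then interpret split_space scale F m e f g
    using assms(4,7)
    by (intro split_space.intro bilinear_space.intro bilinear_space_axioms.intro split_space_axioms.intro)
  show ?thesis by (rule clifford_invariant_split)
qed

end
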